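(* Let $\mathbf{k}$ be a field in which $q$ is invertible. Let $\Theta$ be any representation of $\mathrm{GL}_d$ over $\mathbf{k}$. Then the descending chain $M_{d,\Theta}\supset M_{d+1,\Theta}\supset\cdots$ stabilizes in $\mathrm{Mod}_{\mathrm{VI}}^{\mathrm{gen}}$. In fact, for each $n\ge d$, $M_{d,\Theta}/M_{n,\Theta}$ is supported in degrees $<n+q^{d(n-d)}(1+q+\cdots+q^{d-1})$. In other words, $M_{n,\Theta}=M_{d,\Theta}$ in $\mathrm{Mod}_{\mathrm{VI}}^{\mathrm{gen}}$ for each $n\ge d$.
   Context: $\mathbb{F}=\mathbb{F}_q$ is a finite field, $\mathrm{GL}_n=\mathrm{GL}_n(\mathbb{F})$. $\mathrm{VI}$ is the category of finite dimensional $\mathbb{F}$-vector spaces with injective linear maps. A $\mathrm{VI}$-module is a functor $\mathrm{VI}\to\mathrm{Mod}_{\mathbf{k}}$. A $\mathrm{VI}$-module $M$ is supported in degrees $<N$ if $M(\mathbb{F}^m)=0$ for all $m\ge N$. $M$ is torsion if every $x\in M(X)$ is killed by the map induced by some $\mathrm{VI}$-morphism $X\to Y$; $\mathrm{Mod}_{\mathrm{VI}}^{\mathrm{gen}}$ is the Serre quotient of $\mathrm{Mod}_{\mathrm{VI}}$ by the torsion modules, and submodules are said to be equal in $\mathrm{Mod}_{\mathrm{VI}}^{\mathrm{gen}}$ if their images under the quotient functor are. For a $\mathbf{k}[\mathrm{GL}_d]$-module $\Theta$, $\mathcal{I}(\Theta)=\mathbf{k}[\mathrm{Hom}_{\mathrm{VI}}(\mathbb{F}^d,-)]\otimes_{\mathbf{k}[\mathrm{GL}_d]}\Theta$,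 with elements written as linear combinations of $[g]\otimes\theta$. Sums of vector spaces such as $X+E$ are external direct sums. Construction. Let $f\colon\mathbb{F}^d\to X$ be a $\mathrm{VI}$-morphism and $(\mathcal{B}_f,\prec)$ an ordered basis of $\mathrm{im}(f)$. $\mathcal{V}_f$ is the (finite) set of triples $(\alpha,C,C')$ where $\alpha\in\mathcal{B}_f$, $C$ is a complement of the line $\mathbb{F}\alpha$ in $\mathrm{im}(f)$ containing all elements of $\mathcal{B}_f$ that are $\prec\alpha$, and $C'$ is a complement of $\mathrm{im}(f)$ in $X$. For $v\in\mathcal{V}_f$ write $v=(\alpha_v,C_v,C'_v)$. $\mathcal{E}_f=\bigoplus_{v\in\mathcal{V}_f}\mathbb{F}e_v$ is the vector space with basis $\{e_v\}$. For $v\in\mathcal{V}_f$, $\sigma_v\in\mathrm{GL}(X+\mathcal{E}_f)$ is the automorphism with $\sigma_v(\alpha_v)=e_v$ that fixes pointwise $C_v$, $C'_v$ and $\alpha_w-e_w$ for every $w\in\mathcal{V}_f$. Fix a linear order $<$ on $\mathcal{V}_f$; for $S\subset\mathcal{V}_f$, $L_S=\prod_{v\in S}(\mathrm{id}-\sigma_v)\in \mathbf{k}[\mathrm{GL}(X+\mathcal{E}_f)]$ is the descending product (larger elements on the left). $L_S$ acts on $M(X+\mathcal{E}_f)$ for any $\mathrm{VI}$-module $M$. For a $\mathrm{VI}$-morphism $g\colon Y\to X$ and a space $E$, $g^E\colon Y\to X+E$ is $g$ followed by the inclusion $X\subset X+E$. For $n\ge d$ let $f_n\colon\mathbb{F}^d\to\mathbb{F}^n$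 be the natural inclusion sending the standard basis of $\mathbb{F}^d$ to the first $d$ standard basis vectors of $\mathbb{F}^n$, with $(\mathcal{B}_{f_n},\prec)$ these vectors in their usual order. $M_{n,\Theta}$ is the $\mathrm{VI}$-submodule of $\mathcal{I}(\Theta)$ generated by the elements $L_{\mathcal{V}_{f_n}}([f_n^{\mathcal{E}_{f_n}}]\otimes\theta)\in\mathcal{I}(\Theta)(\mathbb{F}^n+\mathcal{E}_{f_n})$, $\theta\in\Theta$. (This does not depend on the order $<$ on $\mathcal{V}_{f_n}$.) *)

theory Defs
  imports
    "HOL-Algebra.Algebraic_Closure_Type"
    "HOL-Algebra.AbelCoset"
    "HOL-Algebra.Module"
    "HOL-Library.Cardinality"
    "HOL-Library.Poly_Mapping"
    "HOL-Library.Function_Algebras"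
    "HOL-Library.FuncSet"
begin

no_notation var (\<open>X\<index>\<close>)  \<comment> \<open>frees \<open>X\<close> for use as a variable\<close>


section \<open>The category VI\<close>

text \<open>
  The finite-dimensional vector spaces over the field \<open>'f\<close> are taken to be the finite-dimensional
  subspaces of \<open>nat \<Rightarrow> 'f\<close>; every finite-dimensional space is isomorphic to one of these.
  Morphisms are extensional functions, so that equality of morphisms is equality in HOL.
\<close>

type_synonym 'f fvec = "nat \<Rightarrow> 'f"

definition fscale :: "'f::field \<Rightarrow> 'f fvec \<Rightarrow> 'f fvec" where
  "fscale c x = (\<lambda>i. c * x i)"

global_interpretation fvs: vector_space "fscale :: 'f::field \<Rightarrow> 'f fvec \<Rightarrow> 'f fvec"
  by unfold_locales (auto simp: fscale_def fun_eq_iff algebra_simps)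

definition VI_obj :: "'f::field fvec set set" where
  "VI_obj = {X. \<exists>B. finite B \<and> X = fvs.span B}"

definition VI_hom :: "'f::field fvec set \<Rightarrow> 'f fvec set \<Rightarrow> ('f fvec \<Rightarrow> 'f fvec) set" where
  "VI_hom X Y = {g \<in> X \<rightarrow>\<^sub>E Y.
     (\<forall>x\<in>X. \<forall>y\<in>X. g (x + y) = g x + g y) \<and>
     (\<forall>c. \<forall>x\<in>X. g (fscale c x) = fscale c (g x)) \<and>
     inj_on g X}"

definition GL :: "'f::field fvec set \<Rightarrow> ('f fvec \<Rightarrow> 'f fvec) set" where
  "GL X = {g \<in> VI_hom X X. g ` X = X}"

definition std_space :: "nat \<Rightarrow> 'f::field fvec set" where
  "std_space m = {x. \<forall>i\<ge>m. x i = 0}"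

definition std_vec :: "nat \<Rightarrow> 'f::field fvec" where
  "std_vec i = (\<lambda>j. if j = i then 1 else 0)"

text \<open>
  The external direct sum: the pair \<open>(x, e)\<close> is encoded by interleaving the coordinates of \<open>x\<close>
  (even positions) and of \<open>e\<close> (odd positions).
\<close>

definition dpair :: "'f::field fvec \<Rightarrow> 'f fvec \<Rightarrow> 'f fvec" where
  "dpair x e = (\<lambda>i. if even i then x (i div 2) else e (i div 2))"

definition dsum :: "'f::field fvec set \<Rightarrow> 'f fvec set \<Rightarrow> 'f fvec set" where
  "dsum X E = {dpair x e |x e. x \<in> X \<and> e \<in> E}"


section \<open>Modules over the field \<open>'k\<close>\<close>

text \<open>
  A \<open>'k\<close>-module is a \<^locale>\<open>module\<close> over the ring \<^term>\<open>ring_of_type_algebra\<close> of the type \<open>'k\<close>.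
  The fields \<open>mult\<close> and \<open>one\<close> of the record carry no information for modules.
\<close>

abbreviation kmodule :: "('k::field, 'm) module \<Rightarrow> bool" where
  "kmodule M \<equiv> module ring_of_type_algebra M"

abbreviation ksubmodule :: "'m set \<Rightarrow> ('k::field, 'm) module \<Rightarrow> bool" where
  "ksubmodule H M \<equiv> submodule H ring_of_type_algebra M"

definition kspan :: "('k::field, 'm) module \<Rightarrow> 'm set \<Rightarrow> 'm set" where
  "kspan M S = \<Inter>{H. ksubmodule H M \<and> S \<subseteq> H}"

definition klinear :: "('k::field, 'm) module \<Rightarrow> ('k, 'n) module \<Rightarrow> ('m \<Rightarrow> 'n) set" where
  "klinear M N = {h \<in> carrier M \<rightarrow> carrier N.
     (\<forall>x\<in>carrier M. \<forall>y\<in>carrier M. h (x \<oplus>\<^bsub>M\<^esub> y) = h x \<oplus>\<^bsub>N\<^esub> h y) \<and>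
     (\<forall>c. \<forall>x\<in>carrier M. h (c \<odot>\<^bsub>M\<^esub> x) = c \<odot>\<^bsub>N\<^esub> h x)}"

definition quot_module :: "('k::field, 'm) module \<Rightarrow> 'm set \<Rightarrow> ('k, 'm set) module" where
  "quot_module M N = \<lparr>carrier = a_rcosets\<^bsub>M\<^esub> N, monoid.mult = undefined, one = undefined,
     ring.zero = N, add = (\<lambda>S T. S <+>\<^bsub>M\<^esub> T),
     module.smult = (\<lambda>c S. \<Union>x\<in>S. N +>\<^bsub>M\<^esub> (c \<odot>\<^bsub>M\<^esub> x))\<rparr>"

definition free_module :: "'s set \<Rightarrow> ('k::field, 's \<Rightarrow>\<^sub>0 'k) module" where
  "free_module S = \<lparr>carrier = {p. Poly_Mapping.keys p \<subseteq> S},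
     monoid.mult = undefined, one = undefined,
     ring.zero = 0, add = (+), module.smult = (\<lambda>c. Poly_Mapping.map ((*) c))\<rparr>"

abbreviation basis_elt :: "'s \<Rightarrow> 's \<Rightarrow>\<^sub>0 'k::field" where
  "basis_elt s \<equiv> Poly_Mapping.single s 1"

text \<open>
  The tensor product of a right module \<open>A\<close> and a left module \<open>T\<close> over a \<open>'k\<close>-algebra with
  carrier \<open>R\<close>, where \<open>ra\<close> and \<open>la\<close> are the right and the left action of \<open>R\<close>: the free
  \<open>'k\<close>-module on the pairs \<open>(a, \<theta>)\<close> modulo the bilinearity and balancing relations.
  Linearity over \<open>'k\<close> in \<open>\<theta>\<close> follows from balancing over the scalars in \<open>R\<close>.
\<close>

definition tensor_rels ::
  "('k::field, 'a) module \<Rightarrow> 'r set \<Rightarrow> ('a \<Rightarrow> 'r \<Rightarrow> 'a) \<Rightarrow> ('k, 'v) module \<Rightarrow> ('r \<Rightarrow> 'v \<Rightarrow> 'v) \<Rightarrow>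
   (('a \<times> 'v) \<Rightarrow>\<^sub>0 'k) set" where
  "tensor_rels A R ra T la =
     {basis_elt (a \<oplus>\<^bsub>A\<^esub> a', \<theta>) - basis_elt (a, \<theta>) - basis_elt (a', \<theta>) |a a' \<theta>.
        a \<in> carrier A \<and> a' \<in> carrier A \<and> \<theta> \<in> carrier T} \<union>
     {basis_elt (a, \<theta> \<oplus>\<^bsub>T\<^esub> \<theta>') - basis_elt (a, \<theta>) - basis_elt (a, \<theta>') |a \<theta> \<theta>'.
        a \<in> carrier A \<and> \<theta> \<in> carrier T \<and> \<theta>' \<in> carrier T} \<union>
     {basis_elt (c \<odot>\<^bsub>A\<^esub> a, \<theta>) - Poly_Mapping.single (a, \<theta>) c |a c \<theta>.
        a \<in> carrier A \<and> \<theta> \<in> carrier T} \<union>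
     {basis_elt (ra a r, \<theta>) - basis_elt (a, la r \<theta>) |a r \<theta>.
        a \<in> carrier A \<and> r \<in> R \<and> \<theta> \<in> carrier T}"

definition tensor_null ::
  "('k::field, 'a) module \<Rightarrow> 'r set \<Rightarrow> ('a \<Rightarrow> 'r \<Rightarrow> 'a) \<Rightarrow> ('k, 'v) module \<Rightarrow> ('r \<Rightarrow> 'v \<Rightarrow> 'v) \<Rightarrow>
   (('a \<times> 'v) \<Rightarrow>\<^sub>0 'k) set" where
  "tensor_null A R ra T la =
     kspan (free_module (carrier A \<times> carrier T)) (tensor_rels A R ra T la)"

definition tensor ::
  "('k::field, 'a) module \<Rightarrow> 'r set \<Rightarrow> ('a \<Rightarrow> 'r \<Rightarrow> 'a) \<Rightarrow> ('k, 'v) module \<Rightarrow> ('r \<Rightarrow> 'v \<Rightarrow> 'v) \<Rightarrow>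
   ('k, (('a \<times> 'v) \<Rightarrow>\<^sub>0 'k) set) module" where
  "tensor A R ra T la =
     quot_module (free_module (carrier A \<times> carrier T)) (tensor_null A R ra T la)"


section \<open>VI-modules\<close>

text \<open>
  The record fixes only the data of a functor to \<open>'k\<close>-modules; the functor laws are collected in \<open>VI_module\<close>.
  Values at arguments that are not objects of VI are irrelevant throughout.
\<close>

record ('f, 'k, 'm) vimod =
  Ob :: "'f fvec set \<Rightarrow> ('k, 'm) module"
  Act :: "'f fvec set \<Rightarrow> 'f fvec set \<Rightarrow> ('f fvec \<Rightarrow> 'f fvec) \<Rightarrow> 'm \<Rightarrow> 'm"

definition VI_module :: "('f::field, 'k::field, 'm) vimod \<Rightarrow> bool" where
  "VI_module M \<longleftrightarrow>
     (\<forall>X\<in>VI_obj. kmodule (Ob M X)) \<and>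
     (\<forall>X\<in>VI_obj. \<forall>Y\<in>VI_obj. \<forall>g\<in>VI_hom X Y. Act M X Y g \<in> klinear (Ob M X) (Ob M Y)) \<and>
     (\<forall>X\<in>VI_obj. \<forall>x\<in>carrier (Ob M X). Act M X X (restrict id X) x = x) \<and>
     (\<forall>X\<in>VI_obj. \<forall>Y\<in>VI_obj. \<forall>Z\<in>VI_obj. \<forall>g\<in>VI_hom X Y. \<forall>h\<in>VI_hom Y Z. \<forall>x\<in>carrier (Ob M X).
        Act M X Z (compose X h g) x = Act M Y Z h (Act M X Y g x))"

definition VI_submodule ::
  "('f::field fvec set \<Rightarrow> 'm set) \<Rightarrow> ('f, 'k::field, 'm) vimod \<Rightarrow> bool" where
  "VI_submodule N M \<longleftrightarrow>
     (\<forall>X\<in>VI_obj. ksubmodule (N X) (Ob M X)) \<and>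
     (\<forall>X\<in>VI_obj. \<forall>Y\<in>VI_obj. \<forall>g\<in>VI_hom X Y. \<forall>x\<in>N X. Act M X Y g x \<in> N Y)"

definition VI_generated ::
  "('f::field, 'k::field, 'm) vimod \<Rightarrow> ('f fvec set \<times> 'm) set \<Rightarrow> 'f fvec set \<Rightarrow> 'm set" where
  "VI_generated M G = (\<lambda>X. \<Inter>{N X |N. VI_submodule N M \<and> (\<forall>(Y, x)\<in>G. x \<in> N Y)})"

definition VI_sub ::
  "('f::field, 'k::field, 'm) vimod \<Rightarrow> ('f fvec set \<Rightarrow> 'm set) \<Rightarrow> ('f, 'k, 'm) vimod" where
  "VI_sub M N = \<lparr>Ob = (\<lambda>X. (Ob M X)\<lparr>carrier := N X\<rparr>), Act = Act M\<rparr>"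

definition VI_quot ::
  "('f::field, 'k::field, 'm) vimod \<Rightarrow> ('f fvec set \<Rightarrow> 'm set) \<Rightarrow> ('f, 'k, 'm set) vimod" where
  "VI_quot M N = \<lparr>Ob = (\<lambda>X. quot_module (Ob M X) (N X)),
     Act = (\<lambda>X Y g S. \<Union>x\<in>S. N Y +>\<^bsub>Ob M Y\<^esub> Act M X Y g x)\<rparr>"

definition VI_trans ::
  "('f::field, 'k::field, 'm) vimod \<Rightarrow> ('f, 'k, 'n) vimod \<Rightarrow> ('f fvec set \<Rightarrow> 'm \<Rightarrow> 'n) \<Rightarrow> bool" where
  "VI_trans M N \<eta> \<longleftrightarrow>
     (\<forall>X\<in>VI_obj. \<eta> X \<in> klinear (Ob M X) (Ob N X)) \<and>
     (\<forall>X\<in>VI_obj. \<forall>Y\<in>VI_obj. \<forall>g\<in>VI_hom X Y. \<forall>x\<in>carrier (Ob M X).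
        \<eta> Y (Act M X Y g x) = Act N X Y g (\<eta> X x))"

definition supported_below :: "nat \<Rightarrow> ('f::field, 'k::field, 'm) vimod \<Rightarrow> bool" where
  "supported_below N M \<longleftrightarrow>
     (\<forall>m\<ge>N. carrier (Ob M (std_space m)) = {\<zero>\<^bsub>Ob M (std_space m)\<^esub>})"

definition VI_torsion :: "('f::field, 'k::field, 'm) vimod \<Rightarrow> bool" where
  "VI_torsion M \<longleftrightarrow>
     (\<forall>X\<in>VI_obj. \<forall>x\<in>carrier (Ob M X). \<exists>Y\<in>VI_obj. \<exists>g\<in>VI_hom X Y.
        Act M X Y g x = \<zero>\<^bsub>Ob M Y\<^esub>)"


section \<open>The Serre quotient by the torsion modules\<close>

text \<open>
  Gabriel's construction: a morphism \<open>A \<rightarrow> B\<close> of the quotient category is represented by a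
  triple \<open>(A', B', \<phi>)\<close> where \<open>A' \<subseteq> A\<close> has torsion cokernel, \<open>B' \<subseteq> B\<close> is torsion and
  \<open>\<phi> : A' \<rightarrow> B/B'\<close> is a morphism of VI-modules. Two triples represent the same morphism if they
  agree after shrinking \<open>A'\<close> and enlarging \<open>B'\<close>, i.e. in the colimit of the groups
  \<open>Hom(A', B/B')\<close>.
\<close>

type_synonym ('f, 'a, 'b) fraction =
  "('f fvec set \<Rightarrow> 'a set) \<times> ('f fvec set \<Rightarrow> 'b set) \<times> ('f fvec set \<Rightarrow> 'a \<Rightarrow> 'b set)"

definition admissible ::
  "('f::field, 'k::field, 'a) vimod \<Rightarrow> ('f, 'k, 'b) vimod \<Rightarrow>
   ('f fvec set \<Rightarrow> 'a set) \<Rightarrow> ('f fvec set \<Rightarrow> 'b set) \<Rightarrow> bool" where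
  "admissible A B A' B' \<longleftrightarrow>
     VI_submodule A' A \<and> VI_torsion (VI_quot A A') \<and> VI_submodule B' B \<and> VI_torsion (VI_sub B B')"

fun gen_hom ::
  "('f::field, 'k::field, 'a) vimod \<Rightarrow> ('f, 'k, 'b) vimod \<Rightarrow> ('f, 'a, 'b) fraction \<Rightarrow> bool" where
  "gen_hom A B (A', B', \<phi>) \<longleftrightarrow> admissible A B A' B' \<and> VI_trans (VI_sub A A') (VI_quot B B') \<phi>"

text \<open>
  The image of the coset \<open>\<phi> X a\<close> under \<open>B/B' \<rightarrow> B/B'''\<close> is \<open>B''' X <+> \<phi> X a\<close>.
\<close>

fun gen_hom_eq ::
  "('f::field, 'k::field, 'a) vimod \<Rightarrow> ('f, 'k, 'b) vimod \<Rightarrow>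
   ('f, 'a, 'b) fraction \<Rightarrow> ('f, 'a, 'b) fraction \<Rightarrow> bool" where
  "gen_hom_eq A B (A', B', \<phi>) (A'', B'', \<psi>) \<longleftrightarrow>
     (\<exists>A''' B'''. admissible A B A''' B''' \<and>
        (\<forall>X\<in>VI_obj. A''' X \<subseteq> A' X \<inter> A'' X \<and> B' X \<union> B'' X \<subseteq> B''' X \<and>
           (\<forall>a\<in>A''' X. B''' X <+>\<^bsub>Ob B X\<^esub> \<phi> X a = B''' X <+>\<^bsub>Ob B X\<^esub> \<psi> X a)))"

text \<open>
  The composite of \<open>(A', B', \<phi>)\<close> and \<open>(B'', C', \<psi>)\<close> restricts \<open>\<phi>\<close> to the preimage of
  \<open>(B'' + B')/B' \<cong> B''/(B'' \<inter> B')\<close> and follows it by the map to \<open>C/C''\<close> induced by \<open>\<psi>\<close>, where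
  \<open>C''/C' = \<psi> (B'' \<inter> B')\<close>. As the values of \<open>\<phi>\<close> and \<open>\<psi>\<close> are cosets, both \<open>C''\<close> and the
  values of the composite are unions of values of \<open>\<psi>\<close>.
\<close>

fun gen_comp ::
  "('f::field, 'b, 'c) fraction \<Rightarrow> ('f, 'a, 'b) fraction \<Rightarrow> ('f, 'a, 'c) fraction" where
  "gen_comp (B'', C', \<psi>) (A', B', \<phi>) =
     (\<lambda>X. {a \<in> A' X. \<phi> X a \<inter> B'' X \<noteq> {}},
      \<lambda>X. \<Union>b \<in> B'' X \<inter> B' X. \<psi> X b,
      \<lambda>X a. \<Union>b \<in> \<phi> X a \<inter> B'' X. \<psi> X b)"

text \<open>The image under the quotient functor of the inclusion of the submodule \<open>A\<close> into \<open>M\<close>.\<close>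

definition gen_incl ::
  "('f::field, 'k::field, 'm) vimod \<Rightarrow> ('f fvec set \<Rightarrow> 'm set) \<Rightarrow> ('f, 'm, 'm) fraction" where
  "gen_incl M A = (A, \<lambda>X. {\<zero>\<^bsub>Ob M X\<^esub>}, \<lambda>X a. {\<zero>\<^bsub>Ob M X\<^esub>} +>\<^bsub>Ob M X\<^esub> a)"

text \<open>
  Submodules \<open>A\<close> and \<open>B\<close> of \<open>M\<close> are equal in the quotient category if their images are the same
  subobject of the image of \<open>M\<close>, i.e. each inclusion factors through the other.
\<close>

definition gen_factors ::
  "('f::field, 'k::field, 'm) vimod \<Rightarrow> ('f fvec set \<Rightarrow> 'm set) \<Rightarrow> ('f fvec set \<Rightarrow> 'm set) \<Rightarrow> bool" where
  "gen_factors M A B \<longleftrightarrow>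
     (\<exists>u. gen_hom (VI_sub M A) (VI_sub M B) u \<and>
          gen_hom_eq (VI_sub M A) M (gen_comp (gen_incl M B) u) (gen_incl M A))"

definition gen_equal ::
  "('f::field, 'k::field, 'm) vimod \<Rightarrow> ('f fvec set \<Rightarrow> 'm set) \<Rightarrow> ('f fvec set \<Rightarrow> 'm set) \<Rightarrow> bool" where
  "gen_equal M A B \<longleftrightarrow> gen_factors M A B \<and> gen_factors M B A"


section \<open>Group algebras and induced VI-modules\<close>

text \<open>
  The bilinear extension of composition of maps, where \<open>D\<close> is the domain of the maps in the right
  factor: the product of a group algebra, and its right action on the span of a set of morphisms.
\<close>

definition alg_mult ::
  "'x set \<Rightarrow> (('y \<Rightarrow> 'z) \<Rightarrow>\<^sub>0 'k::field) \<Rightarrow> (('x \<Rightarrow> 'y) \<Rightarrow>\<^sub>0 'k) \<Rightarrow> (('x \<Rightarrow> 'z) \<Rightarrow>\<^sub>0 'k)" where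
  "alg_mult D a b = (\<Sum>g\<in>Poly_Mapping.keys a. \<Sum>h\<in>Poly_Mapping.keys b.
     Poly_Mapping.single (compose D g h) (Poly_Mapping.lookup a g * Poly_Mapping.lookup b h))"

definition is_GL_rep ::
  "nat \<Rightarrow> ('k::field, 'v) module \<Rightarrow> (('f::field fvec \<Rightarrow> 'f fvec) \<Rightarrow> 'v \<Rightarrow> 'v) \<Rightarrow> bool" where
  "is_GL_rep d \<Theta> \<rho> \<longleftrightarrow>
     kmodule \<Theta> \<and>
     (\<forall>t\<in>GL (std_space d). \<rho> t \<in> klinear \<Theta> \<Theta>) \<and>
     (\<forall>\<theta>\<in>carrier \<Theta>. \<rho> (restrict id (std_space d)) \<theta> = \<theta>) \<and>
     (\<forall>s\<in>GL (std_space d). \<forall>t\<in>GL (std_space d). \<forall>\<theta>\<in>carrier \<Theta>.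
        \<rho> (compose (std_space d) s t) \<theta> = \<rho> s (\<rho> t \<theta>))"

definition alg_act ::
  "('k::field, 'v) module \<Rightarrow> ('g \<Rightarrow> 'v \<Rightarrow> 'v) \<Rightarrow> ('g \<Rightarrow>\<^sub>0 'k) \<Rightarrow> 'v \<Rightarrow> 'v" where
  "alg_act T \<rho> r x = (\<Oplus>\<^bsub>T\<^esub>g\<in>Poly_Mapping.keys r. Poly_Mapping.lookup r g \<odot>\<^bsub>T\<^esub> \<rho> g x)"

type_synonym ('f, 'k, 'v) ind_elt =
  "(((('f fvec \<Rightarrow> 'f fvec) \<Rightarrow>\<^sub>0 'k) \<times> 'v) \<Rightarrow>\<^sub>0 'k) set"

abbreviation kHom :: "nat \<Rightarrow> 'f::field fvec set \<Rightarrow> ('k::field, ('f fvec \<Rightarrow> 'f fvec) \<Rightarrow>\<^sub>0 'k) module" where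
  "kHom d X \<equiv> free_module (VI_hom (std_space d) X)"

abbreviation ind_free ::
  "nat \<Rightarrow> ('k::field, 'v) module \<Rightarrow> 'f::field fvec set \<Rightarrow>
   ('k, ((('f fvec \<Rightarrow> 'f fvec) \<Rightarrow>\<^sub>0 'k) \<times> 'v) \<Rightarrow>\<^sub>0 'k) module" where
  "ind_free d \<Theta> X \<equiv> free_module (carrier (kHom d X :: ('k, _) module) \<times> carrier \<Theta>)"

abbreviation ind_null ::
  "nat \<Rightarrow> ('k::field, 'v) module \<Rightarrow> (('f::field fvec \<Rightarrow> 'f fvec) \<Rightarrow> 'v \<Rightarrow> 'v) \<Rightarrow> 'f fvec set \<Rightarrow>
   ('f, 'k, 'v) ind_elt" where
  "ind_null d \<Theta> \<rho> X \<equiv>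
     tensor_null (kHom d X) (carrier (free_module (GL (std_space d)))) (alg_mult (std_space d))
       \<Theta> (alg_act \<Theta> \<rho>)"

text \<open>
  The VI-module \<open>\<I>(\<Theta>)\<close>; a morphism \<open>h\<close> acts by \<open>h\<^sub>* \<otimes> id\<close>, computed on representatives.
\<close>

definition ind_push ::
  "nat \<Rightarrow> ('f::field fvec \<Rightarrow> 'f fvec) \<Rightarrow> (((('f fvec \<Rightarrow> 'f fvec) \<Rightarrow>\<^sub>0 'k::field) \<times> 'v) \<Rightarrow>\<^sub>0 'k) \<Rightarrow>
   (((('f fvec \<Rightarrow> 'f fvec) \<Rightarrow>\<^sub>0 'k) \<times> 'v) \<Rightarrow>\<^sub>0 'k)" where
  "ind_push d h p = (\<Sum>(a, \<theta>)\<in>Poly_Mapping.keys p.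
     Poly_Mapping.single (alg_mult (std_space d) (basis_elt h) a, \<theta>) (Poly_Mapping.lookup p (a, \<theta>)))"

definition Ind ::
  "nat \<Rightarrow> ('k::field, 'v) module \<Rightarrow> (('f::field fvec \<Rightarrow> 'f fvec) \<Rightarrow> 'v \<Rightarrow> 'v) \<Rightarrow>
   ('f, 'k, ('f, 'k, 'v) ind_elt) vimod" where
  "Ind d \<Theta> \<rho> = \<lparr>
     Ob = (\<lambda>X. tensor (kHom d X) (carrier (free_module (GL (std_space d))))
                 (alg_mult (std_space d)) \<Theta> (alg_act \<Theta> \<rho>)),
     Act = (\<lambda>X Y h S. \<Union>p\<in>S. ind_null d \<Theta> \<rho> Y +>\<^bsub>ind_free d \<Theta> Y\<^esub> ind_push d h p)\<rparr>"

text \<open>The element \<open>[g] \<otimes> \<theta>\<close> of \<open>\<I>(\<Theta>)(X)\<close>.\<close>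

definition ind_tensor ::
  "nat \<Rightarrow> ('k::field, 'v) module \<Rightarrow> (('f::field fvec \<Rightarrow> 'f fvec) \<Rightarrow> 'v \<Rightarrow> 'v) \<Rightarrow> 'f fvec set \<Rightarrow>
   ('f fvec \<Rightarrow> 'f fvec) \<Rightarrow> 'v \<Rightarrow> ('f, 'k, 'v) ind_elt" where
  "ind_tensor d \<Theta> \<rho> X g \<theta> =
     ind_null d \<Theta> \<rho> X +>\<^bsub>ind_free d \<Theta> X\<^esub> basis_elt (basis_elt g, \<theta>)"


section \<open>The elements \<open>L\<^sub>S\<close>\<close>

definition is_complement :: "'f::field fvec set \<Rightarrow> 'f fvec set \<Rightarrow> 'f fvec set \<Rightarrow> bool" where
  "is_complement W U C \<longleftrightarrow>
     fvs.subspace C \<and> C \<subseteq> W \<and> U \<inter> C = {0} \<and> W = {u + c |u c. u \<in> U \<and> c \<in> C}"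

type_synonym 'f triple = "'f fvec \<times> 'f fvec set \<times> 'f fvec set"

text \<open>
  The set \<open>\<V>\<^sub>f\<close>, where \<open>X\<close> is the codomain and \<open>W\<close> the image of \<open>f\<close>. The list \<open>bs\<close> is the
  ordered basis of \<open>W\<close> in increasing order.
\<close>

definition Vset :: "'f::field fvec set \<Rightarrow> 'f fvec set \<Rightarrow> 'f fvec list \<Rightarrow> 'f triple set" where
  "Vset X W bs = {(\<alpha>, C, C'). \<exists>i<length bs. \<alpha> = bs ! i \<and>
     is_complement W (fvs.span {\<alpha>}) C \<and> set (take i bs) \<subseteq> C \<and> is_complement X W C'}"

text \<open>
  In what follows \<open>vs\<close> lists \<open>\<V>\<^sub>f\<close> without repetition in increasing order; this is the linear
  order fixed on \<open>\<V>\<^sub>f\<close>. The space \<open>\<E>\<^sub>f\<close> is realised as \<^term>\<open>std_space (length vs)\<close>, with the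
  basis vector \<open>e\<^sub>v\<close> at the position of \<open>v\<close> in the list.
\<close>

abbreviation XE :: "'f::field fvec set \<Rightarrow> 'f triple list \<Rightarrow> 'f fvec set" where
  "XE X vs \<equiv> dsum X (std_space (length vs))"

definition e_vec :: "'f::field triple list \<Rightarrow> 'f triple \<Rightarrow> 'f fvec" where
  "e_vec vs v = std_vec (THE i. i < length vs \<and> vs ! i = v)"

definition sigma ::
  "'f::field fvec set \<Rightarrow> 'f triple list \<Rightarrow> 'f triple \<Rightarrow> ('f fvec \<Rightarrow> 'f fvec)" where
  "sigma X vs v = (case v of (\<alpha>, C, C') \<Rightarrow>
     (THE s. s \<in> GL (XE X vs) \<and>
        s (dpair \<alpha> 0) = dpair 0 (e_vec vs v) \<and>
        (\<forall>c\<in>C \<union> C'. s (dpair c 0) = dpair c 0) \<and>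
        (\<forall>w\<in>set vs. s (dpair (fst w) 0 - dpair 0 (e_vec vs w)) =
                      dpair (fst w) 0 - dpair 0 (e_vec vs w))))"

definition L_elt ::
  "'f::field fvec set \<Rightarrow> 'f triple list \<Rightarrow> 'f triple set \<Rightarrow> (('f fvec \<Rightarrow> 'f fvec) \<Rightarrow>\<^sub>0 'k::field)" where
  "L_elt X vs S =
     fold (\<lambda>v a. alg_mult (XE X vs)
                   (basis_elt (restrict id (XE X vs)) - basis_elt (sigma X vs v)) a)
       (filter (\<lambda>v. v \<in> S) vs) (basis_elt (restrict id (XE X vs)))"


section \<open>The submodules \<open>M\<^bsub>n,\<Theta>\<^esub>\<close>\<close>

text \<open>The inclusion \<open>f\<^sub>n\<close>; as a function it does not depend on \<open>n\<close>.\<close>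

definition std_incl :: "nat \<Rightarrow> 'f::field fvec \<Rightarrow> 'f fvec" where
  "std_incl d = restrict id (std_space d)"

definition std_V :: "nat \<Rightarrow> nat \<Rightarrow> 'f::field triple set" where
  "std_V d n = Vset (std_space n) (std_incl d ` std_space d) (map std_vec [0..<d])"

definition M_sub ::
  "nat \<Rightarrow> ('k::field, 'v) module \<Rightarrow> (('f::field fvec \<Rightarrow> 'f fvec) \<Rightarrow> 'v \<Rightarrow> 'v) \<Rightarrow>
   nat \<Rightarrow> 'f triple list \<Rightarrow> 'f fvec set \<Rightarrow> ('f, 'k, 'v) ind_elt set" where
  "M_sub d \<Theta> \<rho> n vs =
     (let Z = XE (std_space n) vs;
          fE = compose (std_space d) (\<lambda>x. dpair x 0) (std_incl d)
      in VI_generated (Ind d \<Theta> \<rho>)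
           {(Z, alg_act (Ob (Ind d \<Theta> \<rho>) Z) (Act (Ind d \<Theta> \<rho>) Z Z)
                  (L_elt (std_space n) vs (std_V d n))
                  (ind_tensor d \<Theta> \<rho> Z fE \<theta>)) |\<theta>. \<theta> \<in> carrier \<Theta>})"

end

(*
  The automorphisms sigma_v are commuting transvections z |-> z + phi_v(z) (e_v - alpha_v), so that
  L_V [f^E] is the product of [f] with the factors [0] - [c_v (x) (e_v - alpha_v)] in the group algebra of
  linear maps, where c_v is the functional phi_v o f. It depends only on the multiset of the functionals
  c_v: each nonzero functional on F^d up to scalars occurs once for every complement of im(f). Over
  F^(n+1) these multiplicities only grow, and expanding the additional factors gives the inclusion
  M_(n+1) <= M_n.
  Conversely, since q is invertible, a factor [0] - [c (x) u] is the average over l in F of the products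
  ([0] - [c (x) (b + l u)]) ([0] - [c (x) u]) for any vector b independent of the data. So multiplicities
  can be raised as long as the ambient space has room for one more independent vector, which is the
  case up to multiplicity q^(d(n-d)) in dimension at least n + |V|; there M_d and M_n agree.
*)

theory Submission
  imports Defs
begin

section \<open>Injective maps of coordinate spaces\<close>

text \<open>A linear map that is not injective has no action on a VI-module, so the group algebra of
  all linear maps is only a guide: every map g + (sum of c (x) u) that occurs in an expansion must
  be injective. Independence of the values of g together with all the vectors u guarantees this and
  is the hypothesis carried throughout. It also fixes the role of dimension. An injection can move
  one independent family to any other of the same length, so a single generator over Z yields all
  elements with the same functionals over every Y with dim Y >= dim Z. The generators of M_n live in
  dimension n + |V|, which gives the bound. In |V| <= q^(d(n-d)) (1 + q + ... + q^(d-1)) the first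
  factor counts the complements of the image; the complements of the line of the i-th basis vector
  (from 0) that contain the earlier vectors number q^(d-1-i). Passing between M_d and M_n changes
  multiplicities only, since every functional that occurs over F^n already occurs over F^d. Theta
  enters through the elements [id] (x) theta; the core argument treats an arbitrary element x of
  M(F^d) for any VI-module M.\<close>

global_interpretation fvs_pair: vector_space_pair
  "fscale :: 'f::field \<Rightarrow> 'f fvec \<Rightarrow> 'f fvec" "fscale :: 'f \<Rightarrow> 'f fvec \<Rightarrow> 'f fvec" ..

abbreviation flinear :: "('f::field fvec \<Rightarrow> 'f fvec) \<Rightarrow> bool" where
  "flinear \<equiv> Vector_Spaces.linear fscale fscale"

lemma VI_obj_subspace: "X \<in> VI_obj \<Longrightarrow> fvs.subspace X"
  by (auto simp: VI_obj_def)

lemma VI_obj_basis_extend: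
  assumes "X \<in> VI_obj" "S \<subseteq> X" "fvs.independent S"
  obtains B where "S \<subseteq> B" "B \<subseteq> X" "finite B" "fvs.independent B" "fvs.span B = X" "card B = fvs.dim X"
proof -
  obtain B where B: "S \<subseteq> B" "B \<subseteq> X" "fvs.independent B" "X \<subseteq> fvs.span B"
    using fvs.maximal_independent_subset_extend[OF assms(2,3)] by blast
  obtain F where F: "finite F" "X = fvs.span F" using assms(1) by (auto simp: VI_obj_def)
  have "finite B" using fvs.independent_span_bound[OF F(1) B(3)] B(2) F(2) by auto
  moreover have "fvs.span B = X"
    using B fvs.span_minimal[OF B(2) VI_obj_subspace[OF assms(1)]] by auto
  moreover have "card B = fvs.dim X" using fvs.basis_card_eq_dim[OF B(2,4,3)] .
  ultimately show ?thesis using that B by blast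
qed

text \<open>One equation expresses that a list is independent and free of repetitions. It depends
  only on the span and the length, so it survives every change of vectors that keeps the
  span.\<close>

lemma dim_set_eq_length_iff:
  "fvs.dim (set xs) = length xs \<longleftrightarrow> distinct xs \<and> fvs.independent (set xs)"
proof
  assume L: "fvs.dim (set xs) = length xs"
  obtain B where B: "B \<subseteq> set xs" "fvs.independent B" "card B = fvs.dim (set xs)"
    by (rule fvs.basis_exists)
  have "card (set xs) \<le> card B" using B(3) L card_length[of xs] by simp
  then have eq: "B = set xs" using card_seteq[OF _ B(1)] by simp
  then have "card (set xs) = length xs" using B(3) L by simp
  then show "distinct xs \<and> fvs.independent (set xs)" using B(2) eq card_distinct by simp
next
  assume "distinct xs \<and> fvs.independent (set xs)"
  then show "fvs.dim (set xs) = length xs"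
    by (simp add: fvs.dim_eq_card_independent distinct_card)
qed

lemma VI_hom_closed: "h \<in> VI_hom X Y \<Longrightarrow> x \<in> X \<Longrightarrow> h x \<in> Y"
  by (auto simp: VI_hom_def)

lemma VI_hom_add: "h \<in> VI_hom X Y \<Longrightarrow> x \<in> X \<Longrightarrow> y \<in> X \<Longrightarrow> h (x + y) = h x + h y"
  by (auto simp: VI_hom_def)

lemma VI_hom_scale: "h \<in> VI_hom X Y \<Longrightarrow> x \<in> X \<Longrightarrow> h (fscale c x) = fscale c (h x)"
  by (auto simp: VI_hom_def)

lemma VI_hom_inj: "h \<in> VI_hom X Y \<Longrightarrow> inj_on h X"
  by (auto simp: VI_hom_def)

lemma VI_hom_extensional: "h \<in> VI_hom X Y \<Longrightarrow> h \<in> extensional X"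
  by (auto simp: VI_hom_def PiE_def)

lemma VI_hom_restrict:
  assumes "flinear k" "inj_on k X" "k ` X \<subseteq> Y" "fvs.subspace X"
  shows "restrict k X \<in> VI_hom X Y"
proof -
  interpret k: Vector_Spaces.linear fscale fscale k by (rule assms(1))
  show ?thesis using assms(2-) unfolding VI_hom_def
    by (auto simp: k.add k.scale fvs.subspace_add fvs.subspace_scale inj_on_def)
qed

text \<open>Morphisms are linear on their domain only and \<open>undefined\<close> outside it.
  Extending the values on a basis of \<open>X\<close> gives a total linear map, to which the facts
  about linear maps apply.\<close>

lemma VI_hom_linear:
  assumes "X \<in> VI_obj" "h \<in> VI_hom X Y"
  obtains k where "flinear k" "\<And>x. x \<in> X \<Longrightarrow> k x = h x"
proof -
  obtain B where B: "B \<subseteq> X" "fvs.independent B" "fvs.span B = X"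
    using VI_obj_basis_extend[OF assms(1), of "{}"] by (metis empty_subsetI fvs.independent_empty)
  define k where "k = fvs_pair.construct B h"
  have lin: "flinear k" unfolding k_def by (rule fvs_pair.linear_construct[OF B(2)])
  interpret k: Vector_Spaces.linear fscale fscale k by (rule lin)
  have sub: "fvs.subspace X" by (rule VI_obj_subspace[OF assms(1)])
  have h0: "h 0 = 0" using VI_hom_scale[OF assms(2) fvs.subspace_0[OF sub], of 0] by simp
  have "fvs.span B \<subseteq> {x \<in> X. k x = h x}"
  proof (rule fvs.span_minimal)
    show "B \<subseteq> {x \<in> X. k x = h x}"
      using B by (auto simp: k_def fvs_pair.construct_basis)
    show "fvs.subspace {x \<in> X. k x = h x}"
      unfolding fvs.subspace_def using sub h0
      by (auto simp: fvs.subspace_0 fvs.subspace_add fvs.subspace_scale k.zero k.add k.scale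
          VI_hom_add[OF assms(2)] VI_hom_scale[OF assms(2)])
  qed
  then show ?thesis using that lin B(3) by blast
qed

lemma VI_hom_compose:
  assumes "g \<in> VI_hom X Y" "h \<in> VI_hom Y Z" "X \<in> VI_obj"
  shows "compose X h g \<in> VI_hom X Z"
  using assms VI_obj_subspace[OF assms(3)] unfolding VI_hom_def
  by (auto simp: compose_def inj_on_def PiE_def Pi_def fvs.subspace_add fvs.subspace_scale)

lemma VI_hom_id: "X \<in> VI_obj \<Longrightarrow> restrict id X \<in> VI_hom X X"
  using VI_obj_subspace[of X] unfolding VI_hom_def
  by (auto simp: fvs.subspace_add fvs.subspace_scale inj_on_def)

text \<open>Both families extend to bases, and the dimension inequality leaves enough basis vectors
  of \<open>Y\<close> to receive the remaining ones of \<open>X\<close> injectively. This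
  transitivity lets a single generator reach all data with the same functionals.\<close>

lemma VI_hom_extend:
  assumes X: "X \<in> VI_obj" and Y: "Y \<in> VI_obj" and xs: "set xs \<subseteq> X" and ys: "set ys \<subseteq> Y"
    and len: "length xs = length ys"
    and dx: "fvs.dim (set xs) = length xs" and dy: "fvs.dim (set ys) = length ys"
    and le: "fvs.dim X \<le> fvs.dim Y"
  obtains h where "h \<in> VI_hom X Y" "\<And>i. i < length xs \<Longrightarrow> h (xs ! i) = ys ! i"
proof -
  have dix: "distinct xs" "fvs.independent (set xs)" using dx dim_set_eq_length_iff by auto
  have diy: "distinct ys" "fvs.independent (set ys)" using dy dim_set_eq_length_iff by auto
  obtain B where B: "set xs \<subseteq> B" "B \<subseteq> X" "finite B" "fvs.independent B" "fvs.span B = X" "card B = fvs.dim X"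
    using VI_obj_basis_extend[OF X xs dix(2)] .
  obtain B' where B': "set ys \<subseteq> B'" "B' \<subseteq> Y" "finite B'" "fvs.independent B'" "fvs.span B' = Y" "card B' = fvs.dim Y"
    using VI_obj_basis_extend[OF Y ys diy(2)] .
  define f where "f x = ys ! (THE i. i < length xs \<and> xs ! i = x)" for x
  have f: "f (xs ! i) = ys ! i" if "i < length xs" for i
  proof -
    have "(THE j. j < length xs \<and> xs ! j = xs ! i) = i"
      using that dix(1) by (intro the_equality) (auto simp: nth_eq_iff_index_eq)
    then show ?thesis by (simp add: f_def)
  qed
  have fset: "f ` set xs = set ys"
  proof -
    have "set xs = (\<lambda>i. xs ! i) ` {..<length xs}" "set ys = (\<lambda>i. ys ! i) ` {..<length ys}"
      using nth_image[of "length xs" xs] nth_image[of "length ys" ys] by (simp_all add: lessThan_atLeast0)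
    moreover have "f ` (\<lambda>i. xs ! i) ` {..<length xs} = (\<lambda>i. ys ! i) ` {..<length xs}"
      unfolding image_image using f by (intro image_cong) auto
    ultimately show ?thesis using len by simp
  qed
  have finj: "inj_on f (set xs)"
  proof (rule inj_onI)
    fix a b assume "a \<in> set xs" "b \<in> set xs" "f a = f b"
    then show "a = b" using f len diy(1) by (auto simp: in_set_conv_nth nth_eq_iff_index_eq)
  qed
  have cards: "card (set xs) = card (set ys)" using dix diy len by (simp add: distinct_card)
  have "card (B - set xs) \<le> card (B' - set ys)"
    using B B' le cards by (simp add: card_Diff_subset)
  then obtain e where e: "e ` (B - set xs) \<subseteq> B' - set ys" "inj_on e (B - set xs)"
    using card_le_inj[of "B - set xs" "B' - set ys"] B B' by auto
  define F where "F x = (if x \<in> set xs then f x else e x)" for x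
  have Fimg: "F ` B \<subseteq> B'"
    using fset B' e by (auto simp: F_def)
  have Finj: "inj_on F B"
  proof (rule inj_onI)
    fix a b assume ab: "a \<in> B" "b \<in> B" "F a = F b"
    have ne: "f x \<noteq> e y" if "x \<in> set xs" "y \<in> B - set xs" for x y
      using that fset e(1) by blast
    then have "f a \<noteq> e b" if "a \<in> set xs" "b \<notin> set xs" using that ab(2) by blast
    moreover have "f b \<noteq> e a" if "b \<in> set xs" "a \<notin> set xs" using that ab(1) ne by blast
    moreover have "a = b" if "a \<in> set xs" "b \<in> set xs" "f a = f b"
      using inj_onD[OF finj] that by blast
    moreover have "a = b" if "a \<notin> set xs" "b \<notin> set xs" "e a = e b"
      using inj_onD[OF e(2)] that ab by blast
    ultimately show "a = b" using ab(3) unfolding F_def by metis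
  qed
  define k where "k = fvs_pair.construct B F"
  have lin: "flinear k" unfolding k_def by (rule fvs_pair.linear_construct[OF B(4)])
  have kB: "k b = F b" if "b \<in> B" for b
    unfolding k_def by (rule fvs_pair.construct_basis[OF B(4) that])
  have kimg: "k ` B = F ` B" using kB by auto
  have ind: "fvs.independent (k ` B)" using fvs.independent_mono[OF B'(4)] Fimg kimg by simp
  have "inj_on k B" using Finj kB by (simp add: inj_on_def)
  then have "inj_on k (fvs.span B)"
    by (rule fvs_pair.linear_inj_on_span_independent_image[OF lin ind, rotated -1])
  moreover have "k ` X \<subseteq> Y"
    using fvs_pair.linear_span_image[OF lin, of B] B(5) B'(5) kimg Fimg fvs.span_mono[of "F ` B" B'] by simp
  ultimately have "restrict k X \<in> VI_hom X Y"
    using VI_hom_restrict[OF lin _ _ VI_obj_subspace[OF X]] B(5) by simp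
  moreover have "restrict k X (xs ! i) = ys ! i" if "i < length xs" for i
  proof -
    have "xs ! i \<in> set xs" using that by simp
    then have "xs ! i \<in> X" "k (xs ! i) = f (xs ! i)" using xs B(1) kB by (auto simp: F_def)
    then show ?thesis using f[OF that] by simp
  qed
  ultimately show ?thesis using that by blast
qed

lemma VI_hom_dim_image:
  assumes "X \<in> VI_obj" "h \<in> VI_hom X Y" "S \<subseteq> X"
  shows "fvs.dim (h ` S) = fvs.dim S"
proof -
  obtain k where k: "flinear k" "\<And>x. x \<in> X \<Longrightarrow> k x = h x"
    using VI_hom_linear[OF assms(1,2)] by blast
  obtain B where B: "B \<subseteq> S" "fvs.independent B" "S \<subseteq> fvs.span B" "card B = fvs.dim S"
    by (rule fvs.basis_exists)
  have sub: "fvs.subspace X" by (rule VI_obj_subspace[OF assms(1)])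
  have sp: "fvs.span B \<subseteq> X" using fvs.span_minimal[OF _ sub] B(1) assms(3) by auto
  have inj: "inj_on k X" using VI_hom_inj[OF assms(2)] k(2) by (simp add: inj_on_def)
  have injB: "inj_on k (fvs.span B)" using inj_on_subset[OF inj sp] .
  have eq: "h ` S = k ` S" "h ` B = k ` B" using k(2) B(1) assms(3) by (force intro!: image_cong)+
  have "fvs.independent (k ` B)"
    by (rule fvs_pair.linear_independent_injective_image[OF k(1) B(2) injB])
  moreover have "k ` S \<subseteq> fvs.span (k ` B)"
    using fvs_pair.linear_span_image[OF k(1), of B] B(3) by auto
  moreover have "card (k ` B) = card B"
    using injB fvs.span_superset by (intro card_image) (auto simp: inj_on_def)
  ultimately show ?thesis unfolding eq(1)
    using fvs.dim_unique[of "k ` B" "k ` S" "card B"] B by auto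
qed

section \<open>Coordinate spaces and the external direct sum\<close>

lemma std_vec_in: "i < m \<Longrightarrow> std_vec i \<in> std_space m"
  by (auto simp: std_vec_def std_space_def)

text \<open>Interleaving turns a sum of standard spaces into the span of coordinate vectors whose
  positions need not form an initial segment. Arbitrary index sets cover the standard spaces and
  their sums alike.\<close>

definition coord_space :: "nat set \<Rightarrow> 'f::field fvec set" where
  "coord_space I = {x. \<forall>i. i \<notin> I \<longrightarrow> x i = 0}"

lemma coord_space_subspace: "fvs.subspace (coord_space I)"
  by (auto simp: fvs.subspace_def coord_space_def fscale_def)

lemma sum_fun_apply: "(\<Sum>i\<in>A. f i) j = (\<Sum>i\<in>A. f i j)" for f :: "'a \<Rightarrow> 'b \<Rightarrow> 'c::comm_monoid_add"
  by (induction A rule: infinite_finite_induct) auto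

lemma coord_expand:
  assumes "finite I" "x \<in> coord_space I"
  shows "x = (\<Sum>i\<in>I. fscale (x i) (std_vec i))"
proof
  fix j
  have "(\<Sum>i\<in>I. fscale (x i) (std_vec i)) j = (\<Sum>i\<in>I. if i = j then x j else 0)"
    unfolding sum_fun_apply by (rule sum.cong) (auto simp: fscale_def std_vec_def)
  then show "x j = (\<Sum>i\<in>I. fscale (x i) (std_vec i)) j"
    using assms by (auto simp: coord_space_def)
qed

lemma inj_std_vec: "inj (std_vec :: nat \<Rightarrow> 'f::field fvec)"
proof (rule injI)
  fix i j assume "std_vec i = (std_vec j :: 'f fvec)"
  then have "std_vec i i = (std_vec j :: 'f fvec) i" by simp
  then show "i = j" by (simp add: std_vec_def split: if_splits)
qed

lemma span_std_vec: "finite I \<Longrightarrow> fvs.span (std_vec ` I) = coord_space I"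
proof
  assume "finite I"
  show "fvs.span (std_vec ` I) \<subseteq> coord_space I"
    by (rule fvs.span_minimal[OF _ coord_space_subspace]) (auto simp: coord_space_def std_vec_def)
  show "coord_space I \<subseteq> fvs.span (std_vec ` I)"
  proof
    fix x assume "x \<in> coord_space I"
    then have "x = (\<Sum>i\<in>I. fscale (x i) (std_vec i))" using \<open>finite I\<close> by (rule coord_expand[rotated])
    also have "\<dots> \<in> fvs.span (std_vec ` I)"
      by (intro fvs.span_sum fvs.span_scale fvs.span_base) auto
    finally show "x \<in> fvs.span (std_vec ` I)" .
  qed
qed

lemma independent_std_vec: "fvs.independent (std_vec ` I :: 'f::field fvec set)"
proof -
  have "std_vec i \<notin> fvs.span (std_vec ` I - {std_vec i} :: 'f fvec set)" for i
  proof
    assume "std_vec i \<in> fvs.span (std_vec ` I - {std_vec i} :: 'f fvec set)"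
    moreover have "fvs.span (std_vec ` I - {std_vec i}) \<subseteq> (coord_space (- {i}) :: 'f fvec set)"
      by (rule fvs.span_minimal[OF _ coord_space_subspace]) (auto simp: coord_space_def std_vec_def)
    ultimately show False by (auto simp: coord_space_def std_vec_def)
  qed
  then show ?thesis unfolding fvs.dependent_def by auto
qed

lemma dim_coord_space: "finite I \<Longrightarrow> fvs.dim (coord_space I :: 'f::field fvec set) = card I"
proof -
  assume "finite I"
  have "fvs.dim (coord_space I :: 'f fvec set) = card ((std_vec :: nat \<Rightarrow> 'f fvec) ` I)"
    using fvs.dim_span_eq_card_independent[OF independent_std_vec, of I] span_std_vec[OF \<open>finite I\<close>] by metis
  then show ?thesis using card_image[OF inj_on_subset[OF inj_std_vec]] by (metis subset_UNIV)
qed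

lemma coord_space_VI_obj: "finite I \<Longrightarrow> coord_space I \<in> VI_obj"
  unfolding VI_obj_def by (metis (mono_tags, lifting) finite_imageI mem_Collect_eq span_std_vec)

lemma std_space_coord: "std_space m = coord_space {..<m}"
  by (auto simp: std_space_def coord_space_def not_less)

lemma std_space_VI_obj: "std_space m \<in> VI_obj"
  by (simp add: std_space_coord coord_space_VI_obj)

lemma dim_std_space: "fvs.dim (std_space m :: 'f::field fvec set) = m"
  by (simp add: std_space_coord dim_coord_space)

lemma std_expand: "x \<in> std_space m \<Longrightarrow> x = (\<Sum>i<m. fscale (x i) (std_vec i))"
  unfolding std_space_coord by (rule coord_expand) auto

lemma std_space_subspace: "fvs.subspace (std_space m)"
  by (simp add: std_space_coord coord_space_subspace)

definition dsum_idx :: "nat \<Rightarrow> nat \<Rightarrow> nat set" where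
  "dsum_idx n r = (\<lambda>i. 2 * i) ` {..<n} \<union> (\<lambda>i. 2 * i + 1) ` {..<r}"

lemma dpair_fst: "dpair x e (2 * i) = x i" and dpair_snd: "dpair x e (Suc (2 * i)) = e i"
  by (auto simp: dpair_def)

lemma dpair_inject: "dpair x e = dpair x' e' \<longleftrightarrow> x = x' \<and> e = e'"
  by (metis dpair_fst dpair_snd ext)

lemma dpair_add: "dpair x e + dpair x' e' = dpair (x + x') (e + e')"
  by (auto simp: dpair_def)

lemma dpair_scale: "fscale c (dpair x e) = dpair (fscale c x) (fscale c e)"
  by (auto simp: dpair_def fscale_def)

lemma dpair_diff: "dpair x e - dpair x' e' = dpair (x - x') (e - e')"
  by (auto simp: dpair_def)

lemma dpair_zero: "dpair 0 0 = 0"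
  by (auto simp: dpair_def)

lemma dpair_std_vec: "dpair (std_vec i) 0 = std_vec (2 * i)" "dpair 0 (std_vec i) = std_vec (2 * i + 1)"
  by (auto simp: dpair_def std_vec_def fun_eq_iff)

lemma finite_dsum_idx: "finite (dsum_idx n r)"
  by (simp add: dsum_idx_def)

lemma card_dsum_idx: "card (dsum_idx n r) = n + r"
proof -
  have "card (dsum_idx n r) = card ((\<lambda>i. 2 * i) ` {..<n}) + card ((\<lambda>i. 2 * i + 1) ` {..<r})"
    unfolding dsum_idx_def
  proof (rule card_Un_disjoint)
    show "(\<lambda>i. 2 * i) ` {..<n} \<inter> (\<lambda>i. 2 * i + 1) ` {..<r} = {}"
      by (metis (no_types, lifting) disjoint_iff even_plus_one_iff dvd_triv_left imageE)
  qed auto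
  then show ?thesis by (simp add: card_image inj_on_def)
qed

lemma mem_dsum_idx: "2 * i \<in> dsum_idx n r \<longleftrightarrow> i < n" "Suc (2 * i) \<in> dsum_idx n r \<longleftrightarrow> i < r"
proof -
  have "2 * i \<noteq> Suc (2 * j)" for j by presburger
  then show "2 * i \<in> dsum_idx n r \<longleftrightarrow> i < n" by (auto simp: dsum_idx_def)
  have "Suc (2 * i) \<noteq> 2 * j" for j by presburger
  then show "Suc (2 * i) \<in> dsum_idx n r \<longleftrightarrow> i < r" by (auto simp: dsum_idx_def)
qed

lemma dpair_in_coord_space:
  "dpair x e \<in> coord_space (dsum_idx n r) \<longleftrightarrow> x \<in> std_space n \<and> e \<in> std_space r"
proof
  assume "dpair x e \<in> coord_space (dsum_idx n r)"
  then have z: "dpair x e i = 0" if "i \<notin> dsum_idx n r" for i using that by (simp add: coord_space_def)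
  have "x i = 0" if "n \<le> i" for i using z[of "2 * i"] that by (simp add: mem_dsum_idx dpair_fst)
  moreover have "e i = 0" if "r \<le> i" for i using z[of "Suc (2 * i)"] that by (simp add: mem_dsum_idx dpair_snd)
  ultimately show "x \<in> std_space n \<and> e \<in> std_space r" by (simp add: std_space_def)
next
  assume *: "x \<in> std_space n \<and> e \<in> std_space r"
  show "dpair x e \<in> coord_space (dsum_idx n r)" unfolding coord_space_def
  proof (intro CollectI allI impI)
    fix i assume i: "i \<notin> dsum_idx n r"
    obtain j where "i = 2 * j \<or> i = Suc (2 * j)" by (metis oddE evenE Suc_eq_plus1)
    then show "dpair x e i = 0"
      using i * by (auto simp: mem_dsum_idx dpair_fst dpair_snd std_space_def)
  qed
qed

lemma dpair_surj: "\<exists>x e. z = dpair x e"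
proof -
  have "z = dpair (\<lambda>i. z (2 * i)) (\<lambda>i. z (Suc (2 * i)))"
    by (auto simp: dpair_def fun_eq_iff)
  then show ?thesis by blast
qed

lemma dsum_std: "dsum (std_space n) (std_space r) = coord_space (dsum_idx n r)"
proof (rule Set.set_eqI)
  fix z :: "'a fvec"
  obtain x e where z: "z = dpair x e" using dpair_surj by blast
  show "z \<in> dsum (std_space n) (std_space r) \<longleftrightarrow> z \<in> coord_space (dsum_idx n r)"
    unfolding z dpair_in_coord_space by (auto simp: dsum_def dpair_inject)
qed

lemma XE_VI_obj: "XE (std_space n) vs \<in> VI_obj"
  by (simp add: dsum_std coord_space_VI_obj finite_dsum_idx)

lemma dim_XE: "fvs.dim (XE (std_space n) vs) = n + length vs"
  by (simp add: dsum_std dim_coord_space finite_dsum_idx card_dsum_idx)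

section \<open>Modules and VI-modules\<close>

lemma ring_of_type_algebra_simps [simp]:
  "carrier ring_of_type_algebra = UNIV"
  "x \<oplus>\<^bsub>ring_of_type_algebra\<^esub> y = x + y"
  "x \<otimes>\<^bsub>ring_of_type_algebra\<^esub> y = x * y"
  "\<one>\<^bsub>ring_of_type_algebra\<^esub> = 1"
  "\<zero>\<^bsub>ring_of_type_algebra\<^esub> = 0"
  by (simp_all add: ring_of_type_algebra_def)

text \<open>With \<open>ring_of_type_algebra\<close> fixed as the scalars, the module laws can be
  restated with the operations of the type \<open>'k\<close> itself.\<close>

locale kmod = module ring_of_type_algebra A for A :: "('k::field, 'm) module" (structure)
begin

lemma k_closed: "x \<in> carrier A \<Longrightarrow> c \<odot> x \<in> carrier A"
  using smult_closed by simp

lemma k_assoc: "x \<in> carrier A \<Longrightarrow> a \<odot> (b \<odot> x) = (a * b) \<odot> x"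
  using smult_assoc1[of a b x] by simp

lemma k_one: "x \<in> carrier A \<Longrightarrow> 1 \<odot> x = x"
  using smult_one[of x] by simp

lemma k_distr_l: "x \<in> carrier A \<Longrightarrow> (a + b) \<odot> x = a \<odot> x \<oplus> b \<odot> x"
  using smult_l_distr[of a b x] by simp

lemma k_distr_r: "x \<in> carrier A \<Longrightarrow> y \<in> carrier A \<Longrightarrow> a \<odot> (x \<oplus> y) = a \<odot> x \<oplus> a \<odot> y"
  using smult_r_distr[of a x y] by simp

lemma k_zero: "x \<in> carrier A \<Longrightarrow> 0 \<odot> x = \<zero>"
  using smult_l_null[of x] by simp

lemma k_neg: "x \<in> carrier A \<Longrightarrow> (-1) \<odot> x = \<ominus> x"
  using k_distr_l[of x "-1" 1] k_one[of x] k_zero[of x] k_closed[of x "-1"]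
  by (metis M.minus_equality ab_left_minus)

lemma minus_minus_swap:
  "\<lbrakk>a \<in> carrier A; b \<in> carrier A; c \<in> carrier A; e \<in> carrier A\<rbrakk> \<Longrightarrow>
   (a \<ominus> b) \<ominus> (c \<ominus> e) = (a \<ominus> c) \<ominus> (b \<ominus> e)"
  by (simp add: M.minus_eq M.minus_add M.a_ac)

lemma k_submodule:
  assumes "ksubmodule H A"
  shows "H \<subseteq> carrier A" "\<zero> \<in> H" "x \<in> H \<Longrightarrow> y \<in> H \<Longrightarrow> x \<oplus> y \<in> H" "x \<in> H \<Longrightarrow> c \<odot> x \<in> H"
    "x \<in> H \<Longrightarrow> \<ominus> x \<in> H" "x \<in> H \<Longrightarrow> y \<in> H \<Longrightarrow> x \<ominus> y \<in> H"
proof -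
  note E = submoduleE[OF assms]
  show "H \<subseteq> carrier A" by (rule E(1))
  show "x \<in> H \<Longrightarrow> y \<in> H \<Longrightarrow> x \<oplus> y \<in> H" by (rule E(5))
  show "x \<in> H \<Longrightarrow> c \<odot> x \<in> H" by (rule E(4)) auto
  show "x \<in> H \<Longrightarrow> \<ominus> x \<in> H" by (rule E(3))
  show "x \<in> H \<Longrightarrow> y \<in> H \<Longrightarrow> x \<ominus> y \<in> H" using E(3,5) by (simp add: M.minus_eq)
  obtain z where "z \<in> H" using E(2) by auto
  then have "0 \<odot> z \<in> H" "z \<in> carrier A" using E(1,4) by auto
  then show "\<zero> \<in> H" using k_zero by simp
qed

lemma k_submoduleI:
  assumes "H \<subseteq> carrier A" "\<zero> \<in> H" "\<And>x y. x \<in> H \<Longrightarrow> y \<in> H \<Longrightarrow> x \<oplus> y \<in> H"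
    "\<And>c x. x \<in> H \<Longrightarrow> c \<odot> x \<in> H"
  shows "ksubmodule H A"
proof (rule submoduleI)
  fix a assume "a \<in> H"
  then show "\<ominus> a \<in> H" using assms(1,4) k_neg[of a] by (metis subsetD)
qed (use assms in auto)

lemma finsum_const_k: "finite S \<Longrightarrow> x \<in> carrier A \<Longrightarrow> (\<Oplus>s\<in>S. x) = of_nat (card S) \<odot> x"
  by (induction S rule: finite_induct) (auto simp: k_zero k_distr_l k_one k_closed)

end

lemma klinearD:
  assumes "h \<in> klinear A B" "kmodule A" "kmodule B"
  shows "x \<in> carrier A \<Longrightarrow> h x \<in> carrier B"
    "x \<in> carrier A \<Longrightarrow> y \<in> carrier A \<Longrightarrow> h (x \<oplus>\<^bsub>A\<^esub> y) = h x \<oplus>\<^bsub>B\<^esub> h y"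
    "x \<in> carrier A \<Longrightarrow> h (c \<odot>\<^bsub>A\<^esub> x) = c \<odot>\<^bsub>B\<^esub> h x"
    "h \<zero>\<^bsub>A\<^esub> = \<zero>\<^bsub>B\<^esub>"
    "x \<in> carrier A \<Longrightarrow> y \<in> carrier A \<Longrightarrow> h (x \<ominus>\<^bsub>A\<^esub> y) = h x \<ominus>\<^bsub>B\<^esub> h y"
proof -
  interpret A: kmod A using assms(2) by (simp add: kmod_def)
  interpret B: kmod B using assms(3) by (simp add: kmod_def)
  show cl: "x \<in> carrier A \<Longrightarrow> h x \<in> carrier B" for x using assms(1) by (auto simp: klinear_def)
  show add: "x \<in> carrier A \<Longrightarrow> y \<in> carrier A \<Longrightarrow> h (x \<oplus>\<^bsub>A\<^esub> y) = h x \<oplus>\<^bsub>B\<^esub> h y" for x y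
    using assms(1) by (auto simp: klinear_def)
  show sc: "x \<in> carrier A \<Longrightarrow> h (c \<odot>\<^bsub>A\<^esub> x) = c \<odot>\<^bsub>B\<^esub> h x" for x c
    using assms(1) by (auto simp: klinear_def)
  show "h \<zero>\<^bsub>A\<^esub> = \<zero>\<^bsub>B\<^esub>"
    using sc[of "\<zero>\<^bsub>A\<^esub>" 0] A.k_zero[of "\<zero>\<^bsub>A\<^esub>"] B.k_zero[OF cl[of "\<zero>\<^bsub>A\<^esub>"]] by simp
  show "x \<in> carrier A \<Longrightarrow> y \<in> carrier A \<Longrightarrow> h (x \<ominus>\<^bsub>A\<^esub> y) = h x \<ominus>\<^bsub>B\<^esub> h y"
    using add[of x "\<ominus>\<^bsub>A\<^esub> y"] sc[of y "-1"] A.k_neg[of y] B.k_neg[OF cl[of y]]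
    by (simp add: A.M.minus_eq B.M.minus_eq)
qed

locale vi_mod =
  fixes M :: "('f::field, 'k::field, 'm) vimod"
  assumes VI_mod: "VI_module M"
begin

lemma kmodule_Ob: "X \<in> VI_obj \<Longrightarrow> kmodule (Ob M X)"
  using VI_mod by (simp add: VI_module_def)

lemma kmod_Ob: "X \<in> VI_obj \<Longrightarrow> kmod (Ob M X)"
  using kmodule_Ob by (simp add: kmod_def)

lemma Act_klinear:
  "X \<in> VI_obj \<Longrightarrow> Y \<in> VI_obj \<Longrightarrow> g \<in> VI_hom X Y \<Longrightarrow> Act M X Y g \<in> klinear (Ob M X) (Ob M Y)"
  using VI_mod by (simp add: VI_module_def)

lemmas Act_linear = klinearD[OF Act_klinear kmodule_Ob kmodule_Ob]

lemma Act_id: "X \<in> VI_obj \<Longrightarrow> x \<in> carrier (Ob M X) \<Longrightarrow> Act M X X (restrict id X) x = x"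
  using VI_mod by (simp add: VI_module_def)

lemma Act_compose:
  "\<lbrakk>X \<in> VI_obj; Y \<in> VI_obj; Z \<in> VI_obj; g \<in> VI_hom X Y; h \<in> VI_hom Y Z; x \<in> carrier (Ob M X)\<rbrakk> \<Longrightarrow>
   Act M X Z (compose X h g) x = Act M Y Z h (Act M X Y g x)"
  using VI_mod unfolding VI_module_def by blast

end

section \<open>Alternating sums over independent translations\<close>

definition lin_map :: "nat \<Rightarrow> (nat \<Rightarrow> 'f::field fvec) \<Rightarrow> 'f fvec \<Rightarrow> 'f fvec" where
  "lin_map d gs = restrict (\<lambda>x. \<Sum>i<d. fscale (x i) (gs i)) (std_space d)"

definition data_frame :: "nat \<Rightarrow> (nat \<Rightarrow> 'f::field fvec) \<Rightarrow> ('f fvec \<times> 'f fvec) list \<Rightarrow> 'f fvec list" where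
  "data_frame d gs ps = map gs [0..<d] @ map snd ps"

text \<open>
  The pair \<open>(gs, ps)\<close> encodes a map \<open>g\<close> from the standard space of dimension \<open>d\<close> (by its values \<open>gs i\<close>,
  \<open>i < d\<close>, on the standard basis) and a list of pairs (functional, vector); a functional is given by its
  coefficients on the standard basis. Values of \<open>gs\<close> at indices \<open>\<ge> d\<close> are junk.
\<close>

definition indep_data :: "'f::field fvec set \<Rightarrow> nat \<Rightarrow> (nat \<Rightarrow> 'f fvec) \<Rightarrow> ('f fvec \<times> 'f fvec) list \<Rightarrow> bool" where
  "indep_data Y d gs ps \<longleftrightarrow> set (data_frame d gs ps) \<subseteq> Y \<and> fvs.dim (set (data_frame d gs ps)) = length (data_frame d gs ps)"

text \<open>For \<open>p = (c, u)\<close> this is the map g + c (x) u, again given by its values on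
  the standard basis.\<close>

definition shift :: "(nat \<Rightarrow> 'f::field fvec) \<Rightarrow> 'f fvec \<times> 'f fvec \<Rightarrow> nat \<Rightarrow> 'f fvec" where
  "shift gs p i = gs i + fscale (fst p i) (snd p)"

lemma set_data_frame: "set (data_frame d gs ps) = gs ` {..<d} \<union> snd ` set ps"
  by (simp add: data_frame_def atLeast0LessThan)

lemma length_data_frame: "length (data_frame d gs ps) = d + length ps"
  by (simp add: data_frame_def)

lemma indep_data_iff:
  "indep_data Y d gs ps \<longleftrightarrow> gs ` {..<d} \<subseteq> Y \<and> snd ` set ps \<subseteq> Y \<and>
     fvs.dim (gs ` {..<d} \<union> snd ` set ps) = d + length ps"
  by (auto simp: indep_data_def set_data_frame length_data_frame)

text \<open>Independence is an equation between a dimension and a length, hence it passes to any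
  data with the same span and the same number of vectors.\<close>

lemma indep_data_span:
  assumes "indep_data Y d gs ps" "fvs.subspace Y"
    and "gs' ` {..<d} \<union> snd ` set ps' \<subseteq> fvs.span (gs ` {..<d} \<union> snd ` set ps)"
    and "gs ` {..<d} \<union> snd ` set ps \<subseteq> fvs.span (gs' ` {..<d} \<union> snd ` set ps')"
    and "length ps' = length ps"
  shows "indep_data Y d gs' ps'"
proof -
  have "fvs.span (gs' ` {..<d} \<union> snd ` set ps') = fvs.span (gs ` {..<d} \<union> snd ` set ps)"
    using assms(3,4) fvs.span_minimal[OF _ fvs.subspace_span] by (metis subset_antisym)
  then have "fvs.dim (gs' ` {..<d} \<union> snd ` set ps') = fvs.dim (gs ` {..<d} \<union> snd ` set ps)"
    by (rule fvs.span_eq_dim)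
  moreover have "fvs.span (gs ` {..<d} \<union> snd ` set ps) \<subseteq> Y"
    using assms(1,2) by (intro fvs.span_minimal) (auto simp: indep_data_iff)
  ultimately show ?thesis using assms by (auto simp: indep_data_iff)
qed

lemma indep_data_mset:
  "indep_data Y d gs ps \<Longrightarrow> mset ps' = mset ps \<Longrightarrow> indep_data Y d gs ps'"
  using mset_eq_setD[of ps' ps] mset_eq_length[of ps' ps] by (simp add: indep_data_iff)

lemma indep_data_tail:
  assumes "indep_data Y d gs (p # ps)" shows "indep_data Y d gs ps"
proof -
  have "distinct (data_frame d gs (p # ps))" "fvs.independent (set (data_frame d gs (p # ps)))"
    using assms dim_set_eq_length_iff[of "data_frame d gs (p # ps)"] by (auto simp: indep_data_def)
  then have "distinct (data_frame d gs ps)" "fvs.independent (set (data_frame d gs ps))"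
    by (auto simp: data_frame_def elim!: fvs.independent_mono)
  then show ?thesis
    using assms dim_set_eq_length_iff[of "data_frame d gs ps"] by (auto simp: indep_data_def data_frame_def)
qed

lemma indep_data_suffix: "indep_data Y d gs (qs @ rs) \<Longrightarrow> indep_data Y d gs rs"
  by (induction qs) (auto dest: indep_data_tail)

text \<open>Adding multiples of \<open>snd p\<close> to the values of \<open>gs\<close> is a
  unipotent change of the frame. Hence every map that occurs when \<open>diff_elt\<close> is
  expanded is injective again.\<close>

lemma indep_data_shift:
  assumes "indep_data Y d gs (p # ps)" "fvs.subspace Y" shows "indep_data Y d (shift gs p) (p # ps)"
proof (rule indep_data_span[OF assms])
  let ?S = "gs ` {..<d} \<union> snd ` set (p # ps)" and ?S' = "shift gs p ` {..<d} \<union> snd ` set (p # ps)"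
  have "shift gs p i \<in> fvs.span ?S" if "i < d" for i
    unfolding shift_def using that by (intro fvs.span_add fvs.span_scale fvs.span_base) auto
  then show "?S' \<subseteq> fvs.span ?S" by (auto intro: fvs.span_base)
  have "gs i \<in> fvs.span ?S'" if "i < d" for i
  proof -
    have "gs i = shift gs p i - fscale (fst p i) (snd p)" by (simp add: shift_def)
    also have "\<dots> \<in> fvs.span ?S'"
      using that by (intro fvs.span_diff fvs.span_scale fvs.span_base) auto
    finally show ?thesis .
  qed
  then show "?S \<subseteq> fvs.span ?S'" by (auto intro: fvs.span_base)
qed simp

lemma indep_data_shift_tail:
  "indep_data Y d gs (p # ps) \<Longrightarrow> fvs.subspace Y \<Longrightarrow> indep_data Y d (shift gs p) ps"
  using indep_data_shift indep_data_tail by blast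

lemma indep_data_insert:
  assumes "indep_data Y d gs ps" "b \<in> Y" "b \<notin> fvs.span (gs ` {..<d} \<union> snd ` set ps)"
  shows "indep_data Y d gs ((c, b) # ps)"
proof -
  have 1: "distinct (data_frame d gs ps)" "fvs.independent (set (data_frame d gs ps))"
    using assms dim_set_eq_length_iff[of "data_frame d gs ps"] by (auto simp: indep_data_def)
  have 2: "b \<notin> set (data_frame d gs ps)" using assms(3) by (auto simp: set_data_frame intro: fvs.span_base)
  have 3: "fvs.independent (insert b (set (data_frame d gs ps)))"
    using fvs.independent_insertI[OF _ 1(2)] assms(3) by (simp add: set_data_frame)
  have 4: "set (data_frame d gs ((c, b) # ps)) = insert b (set (data_frame d gs ps))" by (auto simp: set_data_frame)
  have "fvs.dim (set (data_frame d gs ((c, b) # ps))) = card (insert b (set (data_frame d gs ps)))"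
    unfolding 4 by (rule fvs.dim_eq_card_independent[OF 3])
  also have "\<dots> = length (data_frame d gs ((c, b) # ps))"
    using 1(1) 2 by (simp add: distinct_card length_data_frame)
  finally show ?thesis using assms 4 by (simp add: indep_data_def)
qed

lemma lin_map_VI_hom:
  assumes "indep_data Y d gs ps" "Y \<in> VI_obj"
  shows "lin_map d gs \<in> VI_hom (std_space d) Y"
proof -
  have sub: "fvs.subspace Y" by (rule VI_obj_subspace[OF assms(2)])
  have dis: "distinct (data_frame d gs ps)" "fvs.independent (set (data_frame d gs ps))"
    using assms dim_set_eq_length_iff[of "data_frame d gs ps"] by (auto simp: indep_data_def)
  then have inj: "inj_on gs {..<d}" and ind: "fvs.independent (gs ` {..<d})"
    by (auto simp: data_frame_def distinct_map atLeast0LessThan elim!: fvs.independent_mono)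
  have gsY: "gs i \<in> Y" if "i < d" for i using assms(1) that by (auto simp: indep_data_iff)
  have fs: "(\<lambda>i. c * x i) = fscale c x" "\<And>i. fscale c x i = c * x i" for c :: 'a and x by (simp_all add: fscale_def)
  have zero: "x = 0" if x: "x \<in> std_space d" "(\<Sum>i<d. fscale (x i) (gs i)) = 0" for x
  proof
    fix i show "x i = 0 i"
    proof (cases "i < d")
      case True
      \<comment> \<open>Independence speaks of sums over a set of vectors, so the sum over indices
        is carried to the image of \<open>gs\<close>.\<close>
      have "(\<Sum>v\<in>gs ` {..<d}. fscale (x (the_inv_into {..<d} gs v)) v) = (\<Sum>i<d. fscale (x i) (gs i))"
        using inj by (simp add: sum.reindex the_inv_into_f_f)
      then have "x (the_inv_into {..<d} gs (gs i)) = 0"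
        using True x(2) by (intro fvs.independentD[OF ind _ subset_refl]) auto
      then show ?thesis using True inj by (simp add: the_inv_into_f_f)
    qed (use x in \<open>simp add: std_space_def\<close>)
  qed
  have dsub: "fvs.subspace (std_space d :: 'a fvec set)" by (rule std_space_subspace)
  have add: "lin_map d gs (x + y) = lin_map d gs x + lin_map d gs y"
    if "x \<in> std_space d" "y \<in> std_space d" for x y
    using that fvs.subspace_add[OF dsub that] by (simp add: lin_map_def fvs.scale_left_distrib sum.distrib)
  have scale: "lin_map d gs (fscale c x) = fscale c (lin_map d gs x)"
    if "x \<in> std_space d" for c x
    using that fvs.subspace_scale[OF dsub that] by (simp add: lin_map_def fvs.scale_sum_right fs)
  have "inj_on (lin_map d gs) (std_space d)"
  proof (rule inj_onI)
    fix x y assume xy: "x \<in> std_space d" "y \<in> std_space d" "lin_map d gs x = lin_map d gs y"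
    have d: "x - y \<in> std_space d" by (rule fvs.subspace_diff[OF dsub xy(1,2)])
    have "(\<Sum>i<d. fscale ((x - y) i) (gs i)) = 0"
      using xy by (simp add: lin_map_def fvs.scale_left_diff_distrib sum_subtractf)
    then show "x = y" using zero[OF d] by simp
  qed
  moreover have "lin_map d gs \<in> std_space d \<rightarrow>\<^sub>E Y"
    unfolding lin_map_def by (auto intro!: fvs.subspace_sum[OF sub] fvs.subspace_scale[OF sub] gsY)
  ultimately show ?thesis using add scale by (simp add: VI_hom_def)
qed

lemma VI_hom_sum:
  assumes h: "h \<in> VI_hom Y Z" and Y: "Y \<in> VI_obj" and S: "finite S" "\<And>i. i \<in> S \<Longrightarrow> gs i \<in> Y"
  shows "h (\<Sum>i\<in>S. fscale (x i) (gs i)) = (\<Sum>i\<in>S. fscale (x i) (h (gs i)))"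
proof -
  obtain k where k: "flinear k" "\<And>y. y \<in> Y \<Longrightarrow> k y = h y" using VI_hom_linear[OF Y h] by blast
  interpret k: Vector_Spaces.linear fscale fscale k by (rule k(1))
  have sub: "fvs.subspace Y" by (rule VI_obj_subspace[OF Y])
  have "(\<Sum>i\<in>S. fscale (x i) (gs i)) \<in> Y"
    using S by (intro fvs.subspace_sum[OF sub] fvs.subspace_scale[OF sub]) auto
  then show ?thesis using k(2) S by (simp add: k.sum k.scale flip: k(2))
qed

lemma compose_lin_map:
  assumes h: "h \<in> VI_hom Y Z" and Y: "Y \<in> VI_obj" and gs: "gs ` {..<d} \<subseteq> Y"
  shows "compose (std_space d) h (lin_map d gs) = lin_map d (h \<circ> gs)"
  unfolding compose_def lin_map_def
  using VI_hom_sum[OF h Y, of "{..<d}" gs] gs by (intro restrict_ext) auto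

lemma lin_map_cong: "(\<And>i. i < d \<Longrightarrow> gs i = gs' i) \<Longrightarrow> lin_map d gs = lin_map d gs'"
  unfolding lin_map_def by (intro restrict_ext sum.cong) auto

text \<open>
  In the group algebra of the additive group of all linear maps this is
  \<open>[g] * \<Prod>(c, u). ([0] - [c \<otimes> u])\<close>, applied to \<open>x\<close>.
\<close>

fun diff_elt :: "('f::field, 'k::field, 'm) vimod \<Rightarrow> nat \<Rightarrow> 'm \<Rightarrow> 'f fvec set \<Rightarrow> (nat \<Rightarrow> 'f fvec) \<Rightarrow>
    ('f fvec \<times> 'f fvec) list \<Rightarrow> 'm" where
  "diff_elt M d x Y gs [] = Act M (std_space d) Y (lin_map d gs) x"
| "diff_elt M d x Y gs (p # ps) = diff_elt M d x Y gs ps \<ominus>\<^bsub>Ob M Y\<^esub> diff_elt M d x Y (shift gs p) ps"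

lemma diff_elt_cong: "(\<And>i. i < d \<Longrightarrow> gs i = gs' i) \<Longrightarrow> diff_elt M d x Y gs ps = diff_elt M d x Y gs' ps"
proof (induction ps arbitrary: gs gs')
  case Nil
  then show ?case using lin_map_cong[of d gs gs'] by simp
next
  case (Cons p ps)
  have "diff_elt M d x Y gs ps = diff_elt M d x Y gs' ps" by (rule Cons.IH[OF Cons.prems])
  moreover have "diff_elt M d x Y (shift gs p) ps = diff_elt M d x Y (shift gs' p) ps"
    by (rule Cons.IH) (simp add: shift_def Cons.prems)
  ultimately show ?case by simp
qed

lemma shift_commute: "shift (shift gs p) q = shift (shift gs q) p"
  by (auto simp: shift_def fun_eq_iff add_ac)

text \<open>The quantification over all independent data makes this a property of the multiset of
  functionals alone, so multiplicities can be changed one at a time without keeping track of maps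
  and vectors.\<close>

definition contains_type :: "('f::field, 'k::field, 'm) vimod \<Rightarrow> nat \<Rightarrow> 'm \<Rightarrow> 'f fvec set \<Rightarrow> 'm set \<Rightarrow> 'f fvec multiset \<Rightarrow> bool" where
  "contains_type M d x Y H A \<longleftrightarrow>
     (\<forall>gs ps. indep_data Y d gs ps \<longrightarrow> image_mset fst (mset ps) = A \<longrightarrow> diff_elt M d x Y gs ps \<in> H)"

text \<open>The arguments on \<open>diff_elt\<close> use only functoriality, so they are made for an
  arbitrary VI-module and an arbitrary element over the standard space. They are applied later to
  the elements [id] (x) theta.\<close>

locale vi_elt = vi_mod M for M :: "('f::field, 'k::field, 'm) vimod" +
  fixes d :: nat and x :: 'm
  assumes x_in: "x \<in> carrier (Ob M (std_space d))"
begin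

abbreviation "G \<equiv> diff_elt M d x"

lemma G_closed: "Y \<in> VI_obj \<Longrightarrow> indep_data Y d gs ps \<Longrightarrow> G Y gs ps \<in> carrier (Ob M Y)"
proof (induction ps arbitrary: gs)
  case Nil
  then show ?case
    using Act_linear(1)[OF std_space_VI_obj Nil(1) lin_map_VI_hom[OF Nil(2,1)] std_space_VI_obj Nil(1) x_in]
    by simp
next
  case (Cons p ps)
  interpret kmod "Ob M Y" by (rule kmod_Ob[OF Cons.prems(1)])
  show ?case
    using Cons.IH[OF Cons.prems(1) indep_data_tail[OF Cons.prems(2)]]
      Cons.IH[OF Cons.prems(1) indep_data_shift_tail[OF Cons.prems(2) VI_obj_subspace[OF Cons.prems(1)]]]
    by simp
qed

lemma G_swap:
  assumes "Y \<in> VI_obj" "indep_data Y d gs (p # q # ps)"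
  shows "G Y gs (p # q # ps) = G Y gs (q # p # ps)"
proof -
  interpret kmod "Ob M Y" by (rule kmod_Ob[OF assms(1)])
  have sub: "fvs.subspace Y" by (rule VI_obj_subspace[OF assms(1)])
  have g2: "indep_data Y d gs (q # p # ps)" by (rule indep_data_mset[OF assms(2)]) simp
  have cl: "G Y gs' ps \<in> carrier (Ob M Y)" if "indep_data Y d gs' (r # ps)" for gs' r
    using G_closed[OF assms(1) indep_data_tail[OF that]] .
  have g: "indep_data Y d gs (q # ps)" "indep_data Y d gs (p # ps)" "indep_data Y d (shift gs p) (q # ps)"
    "indep_data Y d (shift gs q) (p # ps)"
    using indep_data_tail indep_data_shift_tail assms(2) g2 sub by blast+
  have c: "G Y gs ps \<in> carrier (Ob M Y)" "G Y (shift gs p) ps \<in> carrier (Ob M Y)"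
    "G Y (shift gs q) ps \<in> carrier (Ob M Y)" "G Y (shift (shift gs q) p) ps \<in> carrier (Ob M Y)"
    using cl[OF g(1)] cl[OF g(3)] cl[OF g(4)]
      cl[OF indep_data_shift[OF g(4) sub]] by simp_all
  show ?thesis
    unfolding diff_elt.simps shift_commute[of gs p q]
    by (rule minus_minus_swap[OF c(1,3,2,4)])
qed

lemma G_move:
  assumes "Y \<in> VI_obj" "indep_data Y d gs (as @ p # bs)"
  shows "G Y gs (as @ p # bs) = G Y gs (p # as @ bs)"
  using assms(2)
proof (induction as arbitrary: gs)
  case (Cons a as)
  have sub: "fvs.subspace Y" by (rule VI_obj_subspace[OF assms(1)])
  have g: "indep_data Y d gs (a # as @ p # bs)" using Cons.prems by simp
  have "G Y gs (a # as @ p # bs) = G Y gs (a # p # as @ bs)"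
    using Cons.IH[OF indep_data_tail[OF g]] Cons.IH[OF indep_data_shift_tail[OF g sub]] by simp
  also have "\<dots> = G Y gs (p # a # as @ bs)"
    by (rule G_swap[OF assms(1) indep_data_mset[OF g]]) simp
  finally show ?case by simp
qed simp

text \<open>The factors are differences of translations, and translations commute. Independence
  keeps all terms of the expansion inside the module, where they may be regrouped.\<close>

lemma G_mset:
  assumes "Y \<in> VI_obj" "indep_data Y d gs ps" "mset ps = mset qs"
  shows "G Y gs ps = G Y gs qs"
  using assms(2,3)
proof (induction ps arbitrary: gs qs)
  case (Cons p ps)
  then obtain as bs where q: "qs = as @ p # bs" by (metis in_set_conv_decomp list.set_intros(1) mset_eq_setD)
  have m: "mset ps = mset (as @ bs)" using Cons.prems(2) q by simp
  have sub: "fvs.subspace Y" by (rule VI_obj_subspace[OF assms(1)])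
  have "indep_data Y d gs qs" by (rule indep_data_mset[OF Cons.prems(1)]) (use Cons.prems(2) in simp)
  then have "G Y gs qs = G Y gs (p # as @ bs)" unfolding q by (rule G_move[OF assms(1)])
  also have "\<dots> = G Y gs (p # ps)"
    using Cons.IH[OF indep_data_tail[OF Cons.prems(1)] m] Cons.IH[OF indep_data_shift_tail[OF Cons.prems(1) sub] m] by simp
  finally show ?case by simp
qed simp

lemma indep_data_VI_hom:
  assumes "indep_data Y d gs ps" "Y \<in> VI_obj" "h \<in> VI_hom Y Z"
  shows "indep_data Z d (h \<circ> gs) (map (apsnd h) ps)"
proof -
  have Y: "gs ` {..<d} \<subseteq> Y" "snd ` set ps \<subseteq> Y" using assms(1) by (auto simp: indep_data_iff)
  have eq: "(h \<circ> gs) ` {..<d} \<union> snd ` set (map (apsnd h) ps) = h ` (gs ` {..<d} \<union> snd ` set ps)"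
    by (auto simp: image_Un image_image)
  show ?thesis unfolding indep_data_iff eq
    using VI_hom_dim_image[OF assms(2,3), of "gs ` {..<d} \<union> snd ` set ps"] Y assms VI_hom_closed[OF assms(3)]
    by (auto simp: indep_data_iff)
qed

text \<open>Composition with \<open>h\<close> sends g + c (x) u to h g + c (x) h u: vectors move
  while functionals stay. This is why the multiset of functionals is the invariant that
  matters.\<close>

lemma G_Act:
  assumes "Y \<in> VI_obj" "Z \<in> VI_obj" "h \<in> VI_hom Y Z" "indep_data Y d gs ps"
  shows "Act M Y Z h (G Y gs ps) = G Z (h \<circ> gs) (map (apsnd h) ps)"
  using assms(4)
proof (induction ps arbitrary: gs)
  case Nil
  have "gs ` {..<d} \<subseteq> Y" using Nil by (simp add: indep_data_iff)
  then show ?case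
    using Act_compose[OF std_space_VI_obj assms(1,2) lin_map_VI_hom[OF Nil assms(1)] assms(3) x_in]
      compose_lin_map[OF assms(3,1) \<open>gs ` {..<d} \<subseteq> Y\<close>] by (simp add: o_def)
next
  case (Cons p ps)
  have sub: "fvs.subspace Y" by (rule VI_obj_subspace[OF assms(1)])
  note g = indep_data_tail[OF Cons.prems] indep_data_shift_tail[OF Cons.prems sub]
  have Y: "gs i \<in> Y" "snd p \<in> Y" if "i < d" for i using Cons.prems that by (auto simp: indep_data_iff)
  have "G Z (h \<circ> shift gs p) (map (apsnd h) ps) = G Z (shift (h \<circ> gs) (apsnd h p)) (map (apsnd h) ps)"
    by (rule diff_elt_cong)
      (simp add: shift_def Y VI_hom_add[OF assms(3)] VI_hom_scale[OF assms(3)] fvs.subspace_scale[OF sub])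
  then show ?case
    using Cons.IH[OF g(1)] Cons.IH[OF g(2)]
      Act_linear(5)[OF assms(1,2,3,1,2) G_closed[OF assms(1) g(1)] G_closed[OF assms(1) g(2)]]
    by (simp add: o_def)
qed

text \<open>Expanding one extra factor leaves a difference of two elements with one functional
  fewer, for \<open>gs\<close> and for its shift. Both are independent data of the smaller type, so
  the difference lies in \<open>H\<close>.\<close>

lemma contains_type_add:
  assumes "Y \<in> VI_obj" "ksubmodule H (Ob M Y)" "contains_type M d x Y H A"
  shows "contains_type M d x Y H (A + B)"
proof (induction B)
  case empty
  then show ?case using assms(3) by simp
next
  case (add c B)
  interpret kmod "Ob M Y" by (rule kmod_Ob[OF assms(1)])
  show ?case unfolding contains_type_def
  proof (intro allI impI)
    fix gs ps assume g: "indep_data Y d gs ps" and t: "image_mset fst (mset ps) = A + add_mset c B"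
    then have "c \<in># image_mset fst (mset ps)" by simp
    then obtain p where p: "p \<in> set ps" "fst p = c" by auto
    then obtain as bs where ps: "ps = as @ p # bs" by (metis split_list)
    have t': "image_mset fst (mset (as @ bs)) = A + B" using t p ps by simp
    have g': "indep_data Y d gs (p # as @ bs)" by (rule indep_data_mset[OF g]) (simp add: ps)
    have "G Y gs (as @ bs) \<in> H" "G Y (shift gs p) (as @ bs) \<in> H"
      using add t' indep_data_tail[OF g'] indep_data_shift_tail[OF g' VI_obj_subspace[OF assms(1)]]
      unfolding contains_type_def by blast+
    moreover have "G Y gs ps = G Y gs (p # as @ bs)"
      by (rule G_mset[OF assms(1) g]) (simp add: ps)
    ultimately show "G Y gs ps \<in> H" using k_submodule(6)[OF assms(2)] by simp
  qed
qed

text \<open>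
  With \<open>D(u) = [0] - [c \<otimes> u]\<close> and \<open>b\<close> a new independent vector, translation by \<open>u\<close> permutes the vectors
  \<open>b + l u\<close>, \<open>l \<in> F\<close>; hence \<open>\<Sum>l. D(b + l u) D(u) = q D(u)\<close>.
\<close>

lemma contains_type_remove:
  assumes Y: "Y \<in> VI_obj" and H: "ksubmodule H (Ob M Y)" and hit: "contains_type M d x Y H (add_mset c A)"
    and c: "c \<in># A" and room: "d + size A < fvs.dim Y"
    and fin: "finite (UNIV :: 'f set)" and q: "of_nat CARD('f) \<noteq> (0 :: 'k)"
  shows "contains_type M d x Y H A"
  unfolding contains_type_def
proof (intro allI impI)
  fix gs ps assume g: "indep_data Y d gs ps" and t: "image_mset fst (mset ps) = A"
  interpret kmod "Ob M Y" by (rule kmod_Ob[OF Y])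
  note Hsub = k_submodule[OF H]
  have sub: "fvs.subspace Y" by (rule VI_obj_subspace[OF Y])
  \<comment> \<open>A factor with the functional \<open>c\<close> is present already; its vector
    \<open>u\<close> is the translation used for the averaging.\<close>
  obtain u where u: "(c, u) \<in> set ps" using c unfolding t[symmetric] by auto
  then obtain as bs where ps: "ps = as @ (c, u) # bs" by (metis split_list)
  define ps' where "ps' = as @ bs"
  define p where "p = (c, u)"
  have g': "indep_data Y d gs (p # ps')" by (rule indep_data_mset[OF g]) (simp add: ps ps'_def p_def)
  define y where "y = G Y gs (p # ps')"
  have Gy: "G Y gs ps = y" unfolding y_def
    by (rule G_mset[OF Y g]) (simp add: ps ps'_def p_def)
  have yc: "y \<in> carrier (Ob M Y)" unfolding y_def by (rule G_closed[OF Y g'])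
  let ?S = "gs ` {..<d} \<union> snd ` set (p # ps')"
  \<comment> \<open>The data consist of at most \<open>d + size A\<close> vectors, fewer than the
    dimension of \<open>Y\<close>, so some \<open>b\<close> lies outside their span.\<close>
  have "\<not> Y \<subseteq> fvs.span ?S"
  proof
    assume "Y \<subseteq> fvs.span ?S"
    then have "fvs.dim Y \<le> card ?S" by (rule fvs.dim_le_card) simp
    also have "\<dots> \<le> d + length (p # ps')"
      using card_length[of "data_frame d gs (p # ps')"] by (simp add: set_data_frame length_data_frame)
    also have "\<dots> = d + size A" by (simp add: ps ps'_def t[symmetric])
    finally show False using room by simp
  qed
  then obtain b where b: "b \<in> Y" "b \<notin> fvs.span ?S" by blast
  define w where "w l = b + fscale l u" for l
  define K where "K l = G Y (shift gs (c, w l)) ps'" for l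
  have gb: "indep_data Y d gs ((c, w l) # p # ps')" for l
  proof (rule indep_data_insert[OF g'])
    have "u \<in> Y" using g' by (auto simp: indep_data_iff p_def)
    then show "w l \<in> Y" using b sub by (simp add: w_def fvs.subspace_add fvs.subspace_scale)
    have us: "fscale l u \<in> fvs.span ?S" by (intro fvs.span_scale fvs.span_base) (simp add: p_def)
    show "w l \<notin> fvs.span ?S"
      unfolding w_def using b(2) fvs.span_diff[OF _ us, of "b + fscale l u"] by auto
  qed
  \<comment> \<open>The shift by \<open>(c, u)\<close> moves \<open>w l\<close> to
    \<open>w (l + 1)\<close>. This permutation of the vectors \<open>w l\<close> makes the two sums
    over \<open>K\<close> agree below.\<close>
  have sh: "shift (shift gs (c, w l)) p = shift gs (c, w (l + 1))" for l
    by (simp add: shift_def p_def w_def fun_eq_iff fvs.scale_right_distrib fvs.scale_left_distrib add_ac)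
  have gK: "indep_data Y d (shift gs (c, w l)) ps'" for l
    using indep_data_tail indep_data_shift_tail[OF gb sub] by blast
  have Kc: "K l \<in> carrier (Ob M Y)" for l unfolding K_def by (rule G_closed[OF Y gK])
  \<comment> \<open>The element with the two factors for \<open>w l\<close> and \<open>u\<close>
    lies in \<open>H\<close>; expanding both yields \<open>y\<close> and the difference
    \<open>K l - K (l + 1)\<close>. This difference need not lie in \<open>H\<close>, but it cancels
    in the sum over all \<open>l\<close>.\<close>
  have mem: "y \<ominus>\<^bsub>Ob M Y\<^esub> (K l \<ominus>\<^bsub>Ob M Y\<^esub> K (l + 1)) \<in> H" for l
  proof -
    have "G Y gs ((c, w l) # p # ps') \<in> H"
    proof -
      have "image_mset fst (mset ((c, w l) # p # ps')) = add_mset c A"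
        by (simp add: ps'_def ps p_def t[symmetric])
      then show ?thesis using hit gb[of l] unfolding contains_type_def by blast
    qed
    then show ?thesis by (simp add: y_def K_def sh)
  qed
  let ?D = "\<lambda>S. finsum (Ob M Y) (\<lambda>l. y) S \<ominus>\<^bsub>Ob M Y\<^esub> (finsum (Ob M Y) K S \<ominus>\<^bsub>Ob M Y\<^esub> finsum (Ob M Y) (\<lambda>l. K (l + 1)) S)"
  have "?D S \<in> H" if "finite S" for S
    using that
  proof (induction S rule: finite_induct)
    case empty
    then show ?case using Hsub(2) by (simp add: M.minus_eq)
  next
    case (insert l S)
    have fc: "finsum (Ob M Y) K S \<in> carrier (Ob M Y)" "finsum (Ob M Y) (\<lambda>l. K (l + 1)) S \<in> carrier (Ob M Y)"
      "finsum (Ob M Y) (\<lambda>l. y) S \<in> carrier (Ob M Y)"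
      using Kc yc by (auto intro!: M.finsum_closed)
    have "?D (insert l S) = (y \<ominus>\<^bsub>Ob M Y\<^esub> (K l \<ominus>\<^bsub>Ob M Y\<^esub> K (l + 1))) \<oplus>\<^bsub>Ob M Y\<^esub> ?D S"
      using insert(1,2) Kc yc fc by (simp add: M.minus_eq M.minus_add M.a_ac)
    then show ?case using mem insert Hsub(3) by simp
  qed
  then have D: "?D UNIV \<in> H" using fin by blast
  have "finsum (Ob M Y) (\<lambda>l. K (l + 1)) UNIV = finsum (Ob M Y) K UNIV"
  proof -
    have "range (\<lambda>l :: 'f. l + 1) = UNIV" by (metis diff_add_cancel surj_def)
    moreover have "finsum (Ob M Y) K (range (\<lambda>l :: 'f. l + 1)) = finsum (Ob M Y) (\<lambda>l. K (l + 1)) UNIV"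
      by (rule M.finsum_reindex) (use Kc in \<open>auto simp: inj_def\<close>)
    ultimately show ?thesis by simp
  qed
  then have "?D UNIV = finsum (Ob M Y) (\<lambda>l :: 'f. y) UNIV"
    using Kc yc by (simp add: M.minus_eq M.r_neg M.finsum_closed)
  then have "of_nat CARD('f) \<odot>\<^bsub>Ob M Y\<^esub> y \<in> H"
    using D finsum_const_k[OF fin yc] by simp
  \<comment> \<open>What lies in \<open>H\<close> so far is q times \<open>y\<close>; invertibility
    of q in \<open>'k\<close> recovers \<open>y\<close> itself.\<close>
  then have "inverse (of_nat CARD('f)) \<odot>\<^bsub>Ob M Y\<^esub> (of_nat CARD('f) \<odot>\<^bsub>Ob M Y\<^esub> y) \<in> H"
    by (rule Hsub(4))
  then show "G Y gs ps \<in> H" using q Gy by (simp add: k_assoc[OF yc] k_one[OF yc])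
qed

text \<open>Copies are removed one by one. Each removal needs another copy of the same functional to
  remain, which \<open>A\<close> supplies, and the demand on the dimension is greatest at the first
  removal, when the multiset is largest.\<close>

lemma contains_type_remove_many:
  assumes Y: "Y \<in> VI_obj" and H: "ksubmodule H (Ob M Y)" and hit: "contains_type M d x Y H (A + B)"
    and c: "set_mset B \<subseteq> set_mset A" and room: "d + size (A + B) \<le> fvs.dim Y"
    and fin: "finite (UNIV :: 'f set)" and q: "of_nat CARD('f) \<noteq> (0 :: 'k)"
  shows "contains_type M d x Y H A"
  using hit c room
proof (induction B)
  case (add c B)
  have "contains_type M d x Y H (add_mset c (A + B))" using add.prems(1) by simp
  then have "contains_type M d x Y H (A + B)"
    by (rule contains_type_remove[OF Y H _ _ _ fin q]) (use add.prems in auto)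
  then show ?case using add.IH add.prems by simp
qed simp

end

section \<open>The induced VI-module\<close>

abbreviation psmult :: "'k::field \<Rightarrow> ('s \<Rightarrow>\<^sub>0 'k) \<Rightarrow> ('s \<Rightarrow>\<^sub>0 'k)" where
  "psmult c \<equiv> Poly_Mapping.map ((*) c)"

lemma lookup_psmult [simp]: "Poly_Mapping.lookup (psmult c p) s = c * Poly_Mapping.lookup p s"
  by (simp add: Poly_Mapping.map.rep_eq when_def)

lemma keys_psmult: "Poly_Mapping.keys (psmult c p) \<subseteq> Poly_Mapping.keys p"
  by (auto simp: in_keys_iff)

lemma psmult_single [simp]: "psmult c (Poly_Mapping.single s a) = Poly_Mapping.single s (c * a)"
  by (rule poly_mapping_eqI) (simp add: lookup_single when_def)

lemma psmult_add: "psmult c (p + q) = psmult c p + psmult c q"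
  by (rule poly_mapping_eqI) (simp add: lookup_add algebra_simps)

lemma psmult_add_left: "psmult (a + b) p = psmult a p + psmult b p"
  by (rule poly_mapping_eqI) (simp add: lookup_add algebra_simps)

lemma psmult_psmult: "psmult a (psmult b p) = psmult (a * b) p"
  by (rule poly_mapping_eqI) (simp add: mult.assoc)

lemma psmult_zero_left [simp]: "psmult 0 p = 0"
  by (rule poly_mapping_eqI) simp

lemma psmult_one [simp]: "psmult 1 p = p"
  by (rule poly_mapping_eqI) simp

lemma psmult_minus_one: "psmult (-1) p = - p"
  by (rule poly_mapping_eqI) simp

lemma psmult_sum: "psmult c (\<Sum>i\<in>A. f i) = (\<Sum>i\<in>A. psmult c (f i))"
  by (rule poly_mapping_eqI) (simp add: lookup_sum sum_distrib_left)

lemma keys_add_subset: "Poly_Mapping.keys p \<subseteq> S \<Longrightarrow> Poly_Mapping.keys q \<subseteq> S \<Longrightarrow> Poly_Mapping.keys (p + q) \<subseteq> S"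
  using keys_add[of p q] by blast

lemma keys_diff_subset:
  assumes "Poly_Mapping.keys p \<subseteq> S" "Poly_Mapping.keys q \<subseteq> S"
  shows "Poly_Mapping.keys (p - q) \<subseteq> S"
proof
  fix k assume "k \<in> Poly_Mapping.keys (p - q)"
  then have "k \<in> Poly_Mapping.keys p \<or> k \<in> Poly_Mapping.keys q"
    by (auto simp: in_keys_iff lookup_minus)
  then show "k \<in> S" using assms by blast
qed

lemma keys_single_subset: "s \<in> S \<Longrightarrow> Poly_Mapping.keys (Poly_Mapping.single s c) \<subseteq> S"
  by auto

lemma keys_psmult_subset: "Poly_Mapping.keys p \<subseteq> S \<Longrightarrow> Poly_Mapping.keys (psmult c p) \<subseteq> S"
  using keys_psmult[of c p] by blast

text \<open>Group algebra products and the push-forward on the free modules are both linear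
  extensions of maps on basis elements. Writing them in this form reduces linearity, associativity
  and functoriality to identities between compositions of maps.\<close>

definition lin_ext :: "('s \<Rightarrow> ('t \<Rightarrow>\<^sub>0 'k::field)) \<Rightarrow> ('s \<Rightarrow>\<^sub>0 'k) \<Rightarrow> ('t \<Rightarrow>\<^sub>0 'k)" where
  "lin_ext F p = (\<Sum>s\<in>Poly_Mapping.keys p. psmult (Poly_Mapping.lookup p s) (F s))"

lemma lin_ext_superset:
  assumes "finite A" "Poly_Mapping.keys p \<subseteq> A"
  shows "lin_ext F p = (\<Sum>s\<in>A. psmult (Poly_Mapping.lookup p s) (F s))"
  unfolding lin_ext_def
  by (rule sum.mono_neutral_left) (use assms in \<open>auto simp: in_keys_iff\<close>)

lemma lin_ext_add: "lin_ext F (p + q) = lin_ext F p + lin_ext F q"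
proof -
  let ?A = "Poly_Mapping.keys p \<union> Poly_Mapping.keys q"
  have "lin_ext F r = (\<Sum>s\<in>?A. psmult (Poly_Mapping.lookup r s) (F s))" if "r \<in> {p, q, p + q}" for r
    by (rule lin_ext_superset) (use that keys_add[of p q] in auto)
  then show ?thesis by (simp add: lookup_add psmult_add_left sum.distrib)
qed

lemma lin_ext_psmult: "lin_ext F (psmult c p) = psmult c (lin_ext F p)"
  using lin_ext_superset[of "Poly_Mapping.keys p" "psmult c p" F] keys_psmult[of c p]
  by (simp add: lin_ext_def psmult_sum psmult_psmult)

lemma lin_ext_single [simp]: "lin_ext F (Poly_Mapping.single s c) = psmult c (F s)"
  using lin_ext_superset[of "{s}" "Poly_Mapping.single s c" F] by simp

lemma lin_ext_zero [simp]: "lin_ext F 0 = 0"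
  by (simp add: lin_ext_def)

lemma lin_ext_diff: "lin_ext F (p - q) = lin_ext F p - lin_ext F q"
  using lin_ext_add[of F p "- q"] lin_ext_psmult[of F "-1" q] unfolding psmult_minus_one by simp

lemma lin_ext_sum: "lin_ext F (\<Sum>i\<in>A. f i) = (\<Sum>i\<in>A. lin_ext F (f i))"
  by (induction A rule: infinite_finite_induct) (simp_all add: lin_ext_add)

lemma lin_ext_lin_ext: "lin_ext F (lin_ext F' p) = lin_ext (\<lambda>s. lin_ext F (F' s)) p"
  unfolding lin_ext_def[of F' p] lin_ext_sum lin_ext_psmult by (simp add: lin_ext_def)

lemma lin_ext_cong: "(\<And>s. s \<in> Poly_Mapping.keys p \<Longrightarrow> F s = F' s) \<Longrightarrow> lin_ext F p = lin_ext F' p"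
  by (simp add: lin_ext_def)

lemma lin_ext_basis [simp]: "lin_ext basis_elt p = p"
proof -
  have "lin_ext basis_elt p = (\<Sum>s\<in>Poly_Mapping.keys p. Poly_Mapping.single s (Poly_Mapping.lookup p s))"
    by (simp add: lin_ext_def)
  also have "\<dots> = p"
    by (rule poly_mapping_eqI) (auto simp: lookup_sum lookup_single when_def in_keys_iff)
  finally show ?thesis .
qed

lemma keys_lin_ext: "Poly_Mapping.keys (lin_ext F p) \<subseteq> (\<Union>s\<in>Poly_Mapping.keys p. Poly_Mapping.keys (F s))"
  unfolding lin_ext_def using keys_sum[of "\<lambda>s. psmult (Poly_Mapping.lookup p s) (F s)" "Poly_Mapping.keys p"]
    keys_psmult by fastforce

lemma alg_mult_lin_ext:
  "alg_mult D a b = lin_ext (\<lambda>g. lin_ext (\<lambda>h. basis_elt (compose D g h)) b) a"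
  unfolding alg_mult_def lin_ext_def by (simp add: psmult_sum mult.commute)

lemma alg_mult_basis: "alg_mult D (basis_elt h) a = lin_ext (\<lambda>g. basis_elt (compose D h g)) a"
  by (simp add: alg_mult_lin_ext)

lemma ind_push_lin_ext:
  "ind_push d h p = lin_ext (\<lambda>(a, \<theta>). basis_elt (alg_mult (std_space d) (basis_elt h) a, \<theta>)) p"
  unfolding ind_push_def lin_ext_def by (intro sum.cong) auto

lemma free_module_simps [simp]:
  "carrier (free_module S) = {p. Poly_Mapping.keys p \<subseteq> S}"
  "x \<oplus>\<^bsub>free_module S\<^esub> y = x + y"
  "\<zero>\<^bsub>free_module S\<^esub> = 0"
  "c \<odot>\<^bsub>free_module S\<^esub> x = psmult c x"
  by (simp_all add: free_module_def)

lemma kmodI: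
  fixes A (structure)
  assumes "abelian_group A"
    and "\<And>c x. x \<in> carrier A \<Longrightarrow> c \<odot> x \<in> carrier A"
    and "\<And>a b x. x \<in> carrier A \<Longrightarrow> (a + b) \<odot> x = a \<odot> x \<oplus> b \<odot> x"
    and "\<And>a x y. x \<in> carrier A \<Longrightarrow> y \<in> carrier A \<Longrightarrow> a \<odot> (x \<oplus> y) = a \<odot> x \<oplus> a \<odot> y"
    and "\<And>a b x. x \<in> carrier A \<Longrightarrow> (a * b) \<odot> x = a \<odot> (b \<odot> x)"
    and "\<And>x. x \<in> carrier A \<Longrightarrow> 1 \<odot> x = x"
  shows "kmod A"
  unfolding kmod_def by (rule moduleI) (use assms cring_from_type_algebra in auto)

lemma kmod_free_module: "kmod (free_module S)"
proof (rule kmodI)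
  show "abelian_group (free_module S)"
  proof (rule abelian_groupI)
    fix x assume "x \<in> carrier (free_module S)"
    then show "\<exists>y\<in>carrier (free_module S). y \<oplus>\<^bsub>free_module S\<^esub> x = \<zero>\<^bsub>free_module S\<^esub>"
      by (intro bexI[of _ "- x"]) auto
  qed (use keys_add in \<open>fastforce simp: add_ac\<close>)+
qed (use keys_psmult in \<open>fastforce simp: psmult_add psmult_add_left psmult_psmult\<close>)+

context kmod
begin

lemma kspan_submodule: "S \<subseteq> carrier A \<Longrightarrow> ksubmodule (kspan A S) A"
proof (rule k_submoduleI)
  assume S: "S \<subseteq> carrier A"
  have "ksubmodule (carrier A) A" by (rule carrier_is_submodule)
  then show "kspan A S \<subseteq> carrier A" using S unfolding kspan_def by blast
qed (auto simp: kspan_def k_submodule)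

lemma kspan_minimal: "ksubmodule H A \<Longrightarrow> S \<subseteq> H \<Longrightarrow> kspan A S \<subseteq> H"
  by (auto simp: kspan_def)

lemma kspan_superset: "S \<subseteq> kspan A S"
  by (auto simp: kspan_def)

lemma ksubmodule_abelian_subgroup: "ksubmodule H A \<Longrightarrow> abelian_subgroup H A"
  by (intro abelian_subgroupI3 additive_subgroupI submodule.axioms(1)) (simp_all add: M.abelian_group_axioms)

lemma mem_coset:
  assumes "ksubmodule H A" "x \<in> carrier A"
  shows "y \<in> H +> x \<longleftrightarrow> y \<in> carrier A \<and> y \<ominus> x \<in> H"
proof
  assume "y \<in> H +> x"
  then obtain h where h: "h \<in> H" "y = h \<oplus> x" by (auto simp: a_r_coset_def')
  moreover have "h \<in> carrier A" using h k_submodule(1)[OF assms(1)] by auto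
  ultimately show "y \<in> carrier A \<and> y \<ominus> x \<in> H"
    using assms(2) by (simp add: M.minus_eq M.a_assoc M.r_neg)
next
  assume y: "y \<in> carrier A \<and> y \<ominus> x \<in> H"
  then have "y = (y \<ominus> x) \<oplus> x" using assms(2) by (simp add: M.minus_eq M.a_assoc M.l_neg)
  then show "y \<in> H +> x" using y by (auto simp: a_r_coset_def')
qed

lemma coset_eq_iff:
  assumes "ksubmodule H A" "x \<in> carrier A" "y \<in> carrier A"
  shows "H +> x = H +> y \<longleftrightarrow> x \<ominus> y \<in> H"
proof -
  interpret H: abelian_subgroup H A by (rule ksubmodule_abelian_subgroup[OF assms(1)])
  have "x \<in> H +> x" using assms mem_coset[of H x x] k_submodule(2)[OF assms(1)] by (simp add: M.minus_eq M.r_neg)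
  then have "H +> x = H +> y \<Longrightarrow> x \<ominus> y \<in> H" using mem_coset[OF assms(1,3)] by auto
  moreover have "x \<ominus> y \<in> H \<Longrightarrow> H +> x = H +> y"
    using M.a_repr_independence[OF _ assms(3) H.a_subgroup, of x] mem_coset[OF assms(1,3)] assms by auto
  ultimately show ?thesis by blast
qed

lemma carrier_quot_module: "carrier (quot_module A H) = (\<lambda>x. H +> x) ` carrier A"
  by (auto simp: quot_module_def A_RCOSETS_def')

lemma quot_module_simps:
  assumes "ksubmodule H A"
  shows "\<zero>\<^bsub>quot_module A H\<^esub> = H +> \<zero>"
    "x \<in> carrier A \<Longrightarrow> y \<in> carrier A \<Longrightarrow> (H +> x) \<oplus>\<^bsub>quot_module A H\<^esub> (H +> y) = H +> (x \<oplus> y)"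
    "x \<in> carrier A \<Longrightarrow> c \<odot>\<^bsub>quot_module A H\<^esub> (H +> x) = H +> (c \<odot> x)"
proof -
  interpret H: abelian_subgroup H A by (rule ksubmodule_abelian_subgroup[OF assms(1)])
  show "\<zero>\<^bsub>quot_module A H\<^esub> = H +> \<zero>"
    using M.a_coset_add_zero[OF H.a_subset] by (simp add: quot_module_def)
  show "x \<in> carrier A \<Longrightarrow> y \<in> carrier A \<Longrightarrow> (H +> x) \<oplus>\<^bsub>quot_module A H\<^esub> (H +> y) = H +> (x \<oplus> y)"
    using H.a_rcos_sum[of x y] by (simp add: quot_module_def)
  assume x: "x \<in> carrier A"
  have "H +> (c \<odot> y) = H +> (c \<odot> x)" if "y \<in> H +> x" for y
  proof -
    have y: "y \<in> carrier A" "y \<ominus> x \<in> H" using that mem_coset[OF assms x] by auto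
    have "c \<odot> y \<ominus> c \<odot> x = c \<odot> (y \<ominus> x)"
      using x y(1) k_closed[of x] by (simp add: M.minus_eq k_distr_r smult_r_minus)
    then show ?thesis
      using coset_eq_iff[OF assms k_closed[OF y(1)] k_closed[OF x]] k_submodule(4)[OF assms y(2)] by simp
  qed
  moreover have "x \<in> H +> x"
    using x mem_coset[OF assms x] k_submodule(2)[OF assms(1)] by (simp add: M.minus_eq M.r_neg)
  ultimately have "(\<Union>y\<in>H +> x. H +> (c \<odot> y)) = H +> (c \<odot> x)" by blast
  then show "c \<odot>\<^bsub>quot_module A H\<^esub> (H +> x) = H +> (c \<odot> x)"
    by (simp add: quot_module_def)
qed

lemma kmod_quot_module:
  assumes "ksubmodule H A"
  shows "kmod (quot_module A H)"
proof (rule kmodI)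
  note s = carrier_quot_module quot_module_simps[OF assms]
  show "abelian_group (quot_module A H)"
  proof (rule abelian_groupI)
    fix S assume "S \<in> carrier (quot_module A H)"
    then obtain x where x: "x \<in> carrier A" "S = H +> x" by (auto simp: s(1))
    then have "(H +> \<ominus> x) \<oplus>\<^bsub>quot_module A H\<^esub> S = \<zero>\<^bsub>quot_module A H\<^esub>" by (simp add: s M.l_neg)
    moreover have "(H +> \<ominus> x) \<in> carrier (quot_module A H)" using x by (simp add: s(1))
    ultimately show "\<exists>y\<in>carrier (quot_module A H). y \<oplus>\<^bsub>quot_module A H\<^esub> S = \<zero>\<^bsub>quot_module A H\<^esub>" by blast
  qed (auto simp: s M.a_ac)
qed (auto simp: carrier_quot_module quot_module_simps[OF assms] k_closed k_distr_l k_distr_r k_assoc k_one)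

end

text \<open>The induced map is a union over representatives. All cosets in this union coincide,
  because \<open>f\<close> sends differences in \<open>H\<close> to differences in \<open>K\<close>;
  so the union is the expected single coset.\<close>

lemma quot_module_map:
  assumes "kmod A" "kmod B" "ksubmodule H A" "ksubmodule K B" "f \<in> klinear A B" "\<And>x. x \<in> H \<Longrightarrow> f x \<in> K"
  defines "F \<equiv> (\<lambda>S. \<Union>x\<in>S. K +>\<^bsub>B\<^esub> f x)"
  shows "x \<in> carrier A \<Longrightarrow> F (H +>\<^bsub>A\<^esub> x) = K +>\<^bsub>B\<^esub> f x"
    and "F \<in> klinear (quot_module A H) (quot_module B K)"
proof -
  interpret A: kmod A by fact
  interpret B: kmod B by fact
  note f = klinearD[OF assms(5) A.module_axioms B.module_axioms]
  show F: "F (H +>\<^bsub>A\<^esub> x) = K +>\<^bsub>B\<^esub> f x" if x: "x \<in> carrier A" for x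
  proof -
    have "K +>\<^bsub>B\<^esub> f y = K +>\<^bsub>B\<^esub> f x" if "y \<in> H +>\<^bsub>A\<^esub> x" for y
    proof -
      have y: "y \<in> carrier A" "y \<ominus>\<^bsub>A\<^esub> x \<in> H" using that A.mem_coset[OF assms(3) x] by auto
      then show ?thesis
        using B.coset_eq_iff[OF assms(4) f(1)[OF y(1)] f(1)[OF x]] assms(6)[OF y(2)] f(5)[OF y(1) x] by simp
    qed
    moreover have "x \<in> H +>\<^bsub>A\<^esub> x"
      using A.mem_coset[OF assms(3) x] x A.k_submodule(2)[OF assms(3)] by (simp add: A.M.minus_eq A.M.r_neg)
    ultimately show ?thesis unfolding F_def by blast
  qed
  show "F \<in> klinear (quot_module A H) (quot_module B K)"
    unfolding klinear_def
    by (auto simp: A.carrier_quot_module B.carrier_quot_module A.quot_module_simps[OF assms(3)]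
        B.quot_module_simps[OF assms(4)] F f A.k_closed)
qed

section \<open>Functoriality of the tensor product that defines the induced module\<close>

locale gl_rep =
  fixes d :: nat and \<Theta> :: "('k::field, 'v) module" and \<rho> :: "('f::field fvec \<Rightarrow> 'f fvec) \<Rightarrow> 'v \<Rightarrow> 'v"
  assumes rep: "is_GL_rep d \<Theta> \<rho>"
begin

sublocale T: kmod \<Theta>
  using rep by (simp add: is_GL_rep_def kmod_def)

lemma alg_act_closed:
  assumes "Poly_Mapping.keys r \<subseteq> GL (std_space d)" "\<theta> \<in> carrier \<Theta>"
  shows "alg_act \<Theta> \<rho> r \<theta> \<in> carrier \<Theta>"
  unfolding alg_act_def
proof (rule T.M.finsum_closed, rule Pi_I)
  fix g assume "g \<in> Poly_Mapping.keys r"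
  then have "\<rho> g \<in> klinear \<Theta> \<Theta>" using assms(1) rep by (auto simp: is_GL_rep_def)
  then have "\<rho> g \<theta> \<in> carrier \<Theta>" using assms(2) by (auto simp: klinear_def)
  then show "Poly_Mapping.lookup r g \<odot>\<^bsub>\<Theta>\<^esub> \<rho> g \<theta> \<in> carrier \<Theta>" by (rule T.k_closed)
qed

lemma keys_alg_mult:
  assumes "Poly_Mapping.keys a \<subseteq> VI_hom Y Z" "Poly_Mapping.keys b \<subseteq> VI_hom X Y" "X \<in> VI_obj"
  shows "Poly_Mapping.keys (alg_mult X a b) \<subseteq> VI_hom X Z"
proof
  fix k assume "k \<in> Poly_Mapping.keys (alg_mult X a b)"
  then obtain g where g: "g \<in> Poly_Mapping.keys a"
    "k \<in> Poly_Mapping.keys (lin_ext (\<lambda>h. basis_elt (compose X g h)) b)"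
    unfolding alg_mult_lin_ext using keys_lin_ext by fastforce
  then obtain h where "h \<in> Poly_Mapping.keys b" "k = compose X g h"
    using keys_lin_ext[of "\<lambda>h. basis_elt (compose X g h)" b] by fastforce
  then show "k \<in> VI_hom X Z" using g assms VI_hom_compose by blast
qed

lemma GL_VI_hom: "GL X \<subseteq> VI_hom X X"
  by (auto simp: GL_def)

abbreviation "D \<equiv> (std_space d :: 'f fvec set)"
abbreviation "rels X \<equiv> tensor_rels (kHom d X) (carrier (free_module (GL D)))
  (alg_mult D) \<Theta> (alg_act \<Theta> \<rho>)"

lemma keys_alg_mult_GL:
  "Poly_Mapping.keys a \<subseteq> VI_hom D X \<Longrightarrow> Poly_Mapping.keys r \<subseteq> GL D \<Longrightarrow> Poly_Mapping.keys (alg_mult D a r) \<subseteq> VI_hom D X"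
  using keys_alg_mult[of a D X r D] GL_VI_hom std_space_VI_obj by blast

lemma rels_cases:
  assumes "p \<in> rels X"
  obtains
      (1) a a' \<theta> where "p = basis_elt (a + a', \<theta>) - basis_elt (a, \<theta>) - basis_elt (a', \<theta>)"
        "Poly_Mapping.keys a \<subseteq> VI_hom D X" "Poly_Mapping.keys a' \<subseteq> VI_hom D X" "\<theta> \<in> carrier \<Theta>"
    | (2) a \<theta> \<theta>' where "p = basis_elt (a, \<theta> \<oplus>\<^bsub>\<Theta>\<^esub> \<theta>') - basis_elt (a, \<theta>) - basis_elt (a, \<theta>')"
        "Poly_Mapping.keys a \<subseteq> VI_hom D X" "\<theta> \<in> carrier \<Theta>" "\<theta>' \<in> carrier \<Theta>"
    | (3) a c \<theta> where "p = basis_elt (psmult c a, \<theta>) - Poly_Mapping.single (a, \<theta>) c"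
        "Poly_Mapping.keys a \<subseteq> VI_hom D X" "\<theta> \<in> carrier \<Theta>"
    | (4) a r \<theta> where "p = basis_elt (alg_mult D a r, \<theta>) - basis_elt (a, alg_act \<Theta> \<rho> r \<theta>)"
        "Poly_Mapping.keys a \<subseteq> VI_hom D X" "Poly_Mapping.keys r \<subseteq> GL D" "\<theta> \<in> carrier \<Theta>"
  using assms unfolding tensor_rels_def free_module_simps by blast

text \<open>If a relation lay outside the carrier, no submodule would contain it and
  \<open>kspan\<close>, an intersection over an empty family, would be everything. This inclusion
  makes the null space a submodule.\<close>

lemma rels_subset: "rels X \<subseteq> carrier (ind_free d \<Theta> X)"
proof
  fix p assume "p \<in> rels X"
  then have "Poly_Mapping.keys p \<subseteq> {p. Poly_Mapping.keys p \<subseteq> VI_hom D X} \<times> carrier \<Theta>"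
  proof (cases rule: rels_cases)
    case (1 a a' \<theta>)
    show "Poly_Mapping.keys p \<subseteq> {p. Poly_Mapping.keys p \<subseteq> VI_hom D X} \<times> carrier \<Theta>"
      unfolding 1(1) by (intro keys_diff_subset keys_single_subset) (use 1 in \<open>auto intro: keys_add_subset[THEN subsetD]\<close>)
  next
    case (2 a \<theta> \<theta>')
    show "Poly_Mapping.keys p \<subseteq> {p. Poly_Mapping.keys p \<subseteq> VI_hom D X} \<times> carrier \<Theta>"
      unfolding 2(1) by (intro keys_diff_subset keys_single_subset) (use 2 in auto)
  next
    case (3 a c \<theta>)
    show "Poly_Mapping.keys p \<subseteq> {p. Poly_Mapping.keys p \<subseteq> VI_hom D X} \<times> carrier \<Theta>"
      unfolding 3(1) by (intro keys_diff_subset keys_single_subset) (use 3 keys_psmult_subset[OF 3(2)] in auto)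
  next
    case (4 a r \<theta>)
    show "Poly_Mapping.keys p \<subseteq> {p. Poly_Mapping.keys p \<subseteq> VI_hom D X} \<times> carrier \<Theta>"
      unfolding 4(1) by (intro keys_diff_subset keys_single_subset)
        (use 4 keys_alg_mult_GL[OF 4(2,3)] alg_act_closed[OF 4(3,4)] in auto)
  qed
  then show "p \<in> carrier (ind_free d \<Theta> X)" by simp
qed

lemma ind_null_submodule: "ksubmodule (ind_null d \<Theta> \<rho> X) (ind_free d \<Theta> X)"
  unfolding tensor_null_def
  by (rule kmod.kspan_submodule[OF kmod_free_module rels_subset])

text \<open>Composition of maps is associative, provided the inner map preserves the domain on which
  \<open>compose\<close> is meaningful. The identity carries the balancing relations over the source
  to balancing relations over the target.\<close>

lemma push_basis_assoc:
  assumes "Poly_Mapping.keys a \<subseteq> VI_hom D X" "Poly_Mapping.keys r \<subseteq> VI_hom D D"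
  shows "alg_mult D (basis_elt h) (alg_mult D a r) = alg_mult D (alg_mult D (basis_elt h) a) r"
proof -
  have c: "compose D h (compose D g t) = compose D (compose D h g) t"
    if "g \<in> Poly_Mapping.keys a" "t \<in> Poly_Mapping.keys r" for g t
  proof -
    have "t x \<in> D" if "x \<in> D" for x
      using VI_hom_closed[of t D D x] that \<open>t \<in> _\<close> assms(2) by blast
    then show ?thesis by (auto simp: compose_def fun_eq_iff)
  qed
  have "lin_ext (\<lambda>g. lin_ext (\<lambda>t. basis_elt (compose D h (compose D g t))) r) a =
    lin_ext (\<lambda>g. lin_ext (\<lambda>t. basis_elt (compose D (compose D h g) t)) r) a"
    by (intro lin_ext_cong) (simp add: c)
  then show ?thesis
    unfolding alg_mult_basis unfolding alg_mult_lin_ext by (simp add: lin_ext_lin_ext)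
qed

lemma ind_push_klinear:
  fixes X Y :: "'f fvec set"
  assumes "h \<in> VI_hom X Y"
  shows "ind_push d h \<in> klinear (ind_free d \<Theta> X) (ind_free d \<Theta> Y)"
proof -
  have "Poly_Mapping.keys (ind_push d h p) \<subseteq> {p. Poly_Mapping.keys p \<subseteq> VI_hom D Y} \<times> carrier \<Theta>"
    if "Poly_Mapping.keys p \<subseteq> {p. Poly_Mapping.keys p \<subseteq> VI_hom D X} \<times> carrier \<Theta>" for p :: "_ \<Rightarrow>\<^sub>0 'k"
  proof
    fix k assume "k \<in> Poly_Mapping.keys (ind_push d h p)"
    then obtain a \<theta> where "(a, \<theta>) \<in> Poly_Mapping.keys p" "k = (alg_mult D (basis_elt h) a, \<theta>)"
      unfolding ind_push_lin_ext using keys_lin_ext by fastforce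
    moreover have "Poly_Mapping.keys (alg_mult D (basis_elt h) a) \<subseteq> VI_hom D Y"
      if "Poly_Mapping.keys a \<subseteq> VI_hom D X"
      by (rule keys_alg_mult[OF _ that std_space_VI_obj]) (use assms in simp)
    ultimately show "k \<in> {p. Poly_Mapping.keys p \<subseteq> VI_hom D Y} \<times> carrier \<Theta>" using that by auto
  qed
  then show ?thesis
    unfolding klinear_def by (auto simp: ind_push_lin_ext lin_ext_add lin_ext_psmult)
qed

lemma ind_push_rels:
  assumes "h \<in> VI_hom X Y" "p \<in> rels X"
  shows "ind_push d h p \<in> rels Y"
proof -
  let ?h = "alg_mult D (basis_elt h :: _ \<Rightarrow>\<^sub>0 'k)"
  have kh: "Poly_Mapping.keys (?h a) \<subseteq> VI_hom D Y" if "Poly_Mapping.keys a \<subseteq> VI_hom D X" for a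
    by (rule keys_alg_mult[OF _ that std_space_VI_obj]) (use assms in simp)
  have ps: "ind_push d h (Poly_Mapping.single (a, \<theta>) c) = Poly_Mapping.single (?h a, \<theta>) c" for a \<theta> and c :: 'k
    by (simp add: ind_push_lin_ext)
  have pd: "ind_push d h (p - q) = ind_push d h p - ind_push d h q" for p q :: "_ \<Rightarrow>\<^sub>0 'k"
    by (simp add: ind_push_lin_ext lin_ext_diff)
  have ha: "?h (a + b) = ?h a + ?h b" "?h (psmult c a) = psmult c (?h a)" for a b c
    by (simp_all add: alg_mult_basis lin_ext_add lin_ext_psmult)
  from assms(2) show ?thesis
  proof (cases rule: rels_cases)
    case (1 a a' \<theta>)
    then show ?thesis unfolding 1(1) pd ps ha tensor_rels_def free_module_simps
      using kh by blast
  next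
    case (2 a \<theta> \<theta>')
    then show ?thesis unfolding 2(1) pd ps ha tensor_rels_def free_module_simps
      using kh by blast
  next
    case (3 a c \<theta>)
    then show ?thesis unfolding 3(1) pd ps ha tensor_rels_def free_module_simps
      using kh by blast
  next
    case (4 a r \<theta>)
    have "?h (alg_mult D a r) = alg_mult D (?h a) r"
      by (rule push_basis_assoc[OF 4(2)]) (use 4(3) GL_VI_hom in blast)
    then have "ind_push d h p = basis_elt (alg_mult D (?h a) r, \<theta>) - basis_elt (?h a, alg_act \<Theta> \<rho> r \<theta>)"
      unfolding 4(1) pd ps by simp
    then show ?thesis unfolding tensor_rels_def free_module_simps
      using kh[OF 4(2)] 4(3,4) by blast
  qed
qed

text \<open>The elements that are pushed into the null space form a submodule, so the claim need be
  checked only on the defining relations.\<close>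

lemma ind_push_null:
  assumes "h \<in> VI_hom X Y" "p \<in> ind_null d \<Theta> \<rho> X"
  shows "ind_push d h p \<in> ind_null d \<Theta> \<rho> Y"
proof -
  interpret A: kmod "ind_free d \<Theta> X" by (rule kmod_free_module)
  interpret B: kmod "ind_free d \<Theta> Y" by (rule kmod_free_module)
  note f = klinearD[OF ind_push_klinear[OF assms(1)] A.module_axioms B.module_axioms]
  note n = B.k_submodule[OF ind_null_submodule]
  have "ksubmodule {p \<in> carrier (ind_free d \<Theta> X). ind_push d h p \<in> ind_null d \<Theta> \<rho> Y} (ind_free d \<Theta> X)"
    by (rule A.k_submoduleI) (use f n A.k_closed A.M.a_closed in \<open>auto simp del: free_module_simps\<close>)
  moreover have "rels X \<subseteq> {p \<in> carrier (ind_free d \<Theta> X). ind_push d h p \<in> ind_null d \<Theta> \<rho> Y}"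
    using rels_subset ind_push_rels[OF assms(1)] B.kspan_superset[of "rels Y"]
    unfolding tensor_null_def by blast
  ultimately have "ind_null d \<Theta> \<rho> X \<subseteq> {p \<in> carrier (ind_free d \<Theta> X). ind_push d h p \<in> ind_null d \<Theta> \<rho> Y}"
    unfolding tensor_null_def[of _ _ _ _ _] by (rule A.kspan_minimal)
  then show ?thesis using assms(2) by blast
qed

abbreviation "coset X p \<equiv> ind_null d \<Theta> \<rho> X +>\<^bsub>ind_free d \<Theta> X\<^esub> p"

lemma Ob_Ind: "Ob (Ind d \<Theta> \<rho>) X = quot_module (ind_free d \<Theta> X) (ind_null d \<Theta> \<rho> X)"
  by (simp add: Ind_def tensor_def)

lemma Act_Ind:
  assumes "h \<in> VI_hom X Y"
  shows "p \<in> carrier (ind_free d \<Theta> X) \<Longrightarrow> Act (Ind d \<Theta> \<rho>) X Y h (coset X p) = coset Y (ind_push d h p)"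
    and "Act (Ind d \<Theta> \<rho>) X Y h \<in> klinear (Ob (Ind d \<Theta> \<rho>) X) (Ob (Ind d \<Theta> \<rho>) Y)"
proof -
  note q = quot_module_map[OF kmod_free_module kmod_free_module ind_null_submodule ind_null_submodule
      ind_push_klinear[OF assms] ind_push_null[OF assms]]
  show "p \<in> carrier (ind_free d \<Theta> X) \<Longrightarrow> Act (Ind d \<Theta> \<rho>) X Y h (coset X p) = coset Y (ind_push d h p)"
    using q(1) by (simp add: Ind_def)
  show "Act (Ind d \<Theta> \<rho>) X Y h \<in> klinear (Ob (Ind d \<Theta> \<rho>) X) (Ob (Ind d \<Theta> \<rho>) Y)"
    unfolding Ob_Ind using q(2) by (simp add: Ind_def)
qed

lemma carrier_Ind: "carrier (Ob (Ind d \<Theta> \<rho>) X) = coset X ` carrier (ind_free d \<Theta> X)"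
  unfolding Ob_Ind by (rule kmod.carrier_quot_module[OF kmod_free_module])

lemma ind_push_id:
  fixes X :: "'f fvec set"
  assumes "p \<in> carrier (ind_free d \<Theta> X)"
  shows "ind_push d (restrict id X) p = p"
proof -
  have c: "compose D (restrict id X) g = g" if "g \<in> VI_hom D X" for g
    using that VI_hom_closed[OF that] VI_hom_extensional[OF that]
    by (auto simp: compose_def fun_eq_iff extensional_def)
  have "alg_mult D (basis_elt (restrict id X)) a = a" if "Poly_Mapping.keys a \<subseteq> VI_hom D X" for a :: "_ \<Rightarrow>\<^sub>0 'k"
  proof -
    have "lin_ext (\<lambda>g. basis_elt (compose D (restrict id X) g)) a = lin_ext basis_elt a"
      by (rule lin_ext_cong) (use that c in auto)
    then show ?thesis by (simp add: alg_mult_basis)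
  qed
  then have "ind_push d (restrict id X) p = lin_ext basis_elt p"
    unfolding ind_push_lin_ext by (intro lin_ext_cong) (use assms in auto)
  then show ?thesis by simp
qed

lemma ind_push_compose:
  fixes X :: "'f fvec set"
  assumes "p \<in> carrier (ind_free d \<Theta> X)"
  shows "ind_push d (compose X h g) p = ind_push d h (ind_push d g p)"
proof -
  have c: "compose D (compose X h g) t = compose D h (compose D g t)" if "t \<in> VI_hom D X" for t
    using VI_hom_closed[OF that] by (auto simp: compose_def fun_eq_iff)
  have "alg_mult D (basis_elt (compose X h g)) a = alg_mult D (basis_elt h) (alg_mult D (basis_elt g) a)"
    if "Poly_Mapping.keys a \<subseteq> VI_hom D X" for a :: "_ \<Rightarrow>\<^sub>0 'k"
    unfolding alg_mult_basis lin_ext_lin_ext by (rule lin_ext_cong) (use that c in auto)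
  then show ?thesis
    unfolding ind_push_lin_ext lin_ext_lin_ext by (intro lin_ext_cong) (use assms in auto)
qed

lemma VI_module_Ind: "VI_module (Ind d \<Theta> \<rho>)"
  unfolding VI_module_def
proof (intro conjI ballI)
  fix X :: "'f fvec set"
  show "kmodule (Ob (Ind d \<Theta> \<rho>) X)"
    using kmod.kmod_quot_module[OF kmod_free_module ind_null_submodule] by (simp add: Ob_Ind kmod_def)
next
  fix X Y :: "'f fvec set" and g assume "g \<in> VI_hom X Y"
  then show "Act (Ind d \<Theta> \<rho>) X Y g \<in> klinear (Ob (Ind d \<Theta> \<rho>) X) (Ob (Ind d \<Theta> \<rho>) Y)" by (rule Act_Ind)
next
  fix X :: "'f fvec set" and x assume X: "X \<in> VI_obj" and "x \<in> carrier (Ob (Ind d \<Theta> \<rho>) X)"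
  then obtain p where p: "p \<in> carrier (ind_free d \<Theta> X)" "x = coset X p" unfolding carrier_Ind by blast
  show "Act (Ind d \<Theta> \<rho>) X X (restrict id X) x = x"
    unfolding p(2) Act_Ind(1)[OF VI_hom_id[OF X] p(1)] ind_push_id[OF p(1)] ..
next
  fix X Y Z :: "'f fvec set" and g h x
  assume X: "X \<in> VI_obj" and g: "g \<in> VI_hom X Y" and h: "h \<in> VI_hom Y Z"
    and "x \<in> carrier (Ob (Ind d \<Theta> \<rho>) X)"
  then obtain p where p: "p \<in> carrier (ind_free d \<Theta> X)" "x = coset X p" unfolding carrier_Ind by blast
  have gp: "ind_push d g p \<in> carrier (ind_free d \<Theta> Y)"
    using ind_push_klinear[OF g] p(1) by (auto simp: klinear_def simp del: free_module_simps)
  show "Act (Ind d \<Theta> \<rho>) X Z (compose X h g) x = Act (Ind d \<Theta> \<rho>) Y Z h (Act (Ind d \<Theta> \<rho>) X Y g x)"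
    unfolding p(2) Act_Ind(1)[OF g p(1)] Act_Ind(1)[OF h gp]
      Act_Ind(1)[OF VI_hom_compose[OF g h X] p(1)] ind_push_compose[OF p(1)] ..
qed

lemma ind_tensor_closed:
  assumes "g \<in> VI_hom D X" "\<theta> \<in> carrier \<Theta>"
  shows "ind_tensor d \<Theta> \<rho> X g \<theta> \<in> carrier (Ob (Ind d \<Theta> \<rho>) X)"
  unfolding ind_tensor_def carrier_Ind using assms by auto

lemma Act_ind_tensor:
  assumes "g \<in> VI_hom D X" "h \<in> VI_hom X Y" "\<theta> \<in> carrier \<Theta>"
  shows "Act (Ind d \<Theta> \<rho>) X Y h (ind_tensor d \<Theta> \<rho> X g \<theta>) = ind_tensor d \<Theta> \<rho> Y (compose D h g) \<theta>"
proof -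
  have "Act (Ind d \<Theta> \<rho>) X Y h (coset X (basis_elt (basis_elt g, \<theta>))) =
      coset Y (ind_push d h (basis_elt (basis_elt g, \<theta>)))"
    by (rule Act_Ind(1)[OF assms(2)]) (use assms in auto)
  then show ?thesis
    by (simp add: ind_tensor_def ind_push_lin_ext alg_mult_basis)
qed

end

section \<open>The group algebra action\<close>

lemma poly_mapping_keys_induct [consumes 1, case_names zero add]:
  fixes p :: "'s \<Rightarrow>\<^sub>0 'b::comm_monoid_add"
  assumes "Poly_Mapping.keys p \<subseteq> S"
    and zero: "P 0"
    and add: "\<And>s c q. s \<in> S \<Longrightarrow> Poly_Mapping.keys q \<subseteq> S \<Longrightarrow> P q \<Longrightarrow> P (Poly_Mapping.single s c + q)"
  shows "P p"
proof -
  have "P (\<Sum>s\<in>A. Poly_Mapping.single s (Poly_Mapping.lookup p s)) \<and>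
    Poly_Mapping.keys (\<Sum>s\<in>A. Poly_Mapping.single s (Poly_Mapping.lookup p s)) \<subseteq> S"
    if "finite A" "A \<subseteq> S" for A
    using that
  proof (induction A rule: finite_induct)
    case empty
    then show ?case using zero by simp
  next
    case (insert s A)
    let ?q = "\<Sum>s\<in>A. Poly_Mapping.single s (Poly_Mapping.lookup p s)"
    have "Poly_Mapping.keys (Poly_Mapping.single s (Poly_Mapping.lookup p s) + ?q) \<subseteq> S"
      by (intro keys_add_subset keys_single_subset) (use insert in auto)
    then show ?case using insert add[of s ?q "Poly_Mapping.lookup p s"] by simp
  qed
  moreover have "(\<Sum>s\<in>Poly_Mapping.keys p. Poly_Mapping.single s (Poly_Mapping.lookup p s)) = p"
    by (rule poly_mapping_eqI) (auto simp: lookup_sum lookup_single when_def in_keys_iff)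
  ultimately show ?thesis using assms(1) by (metis finite_keys)
qed

context kmod
begin

lemma alg_act_superset:
  assumes "finite S" "Poly_Mapping.keys r \<subseteq> S" "\<And>g. g \<in> S \<Longrightarrow> act g x \<in> carrier A"
  shows "alg_act A act r x = (\<Oplus>g\<in>S. Poly_Mapping.lookup r g \<odot> act g x)"
  unfolding alg_act_def
  by (rule M.add.finprod_mono_neutral_cong_left)
    (use assms in \<open>auto simp: in_keys_iff k_zero k_closed\<close>)

lemma alg_act_add:
  assumes "\<And>g. g \<in> Poly_Mapping.keys r \<union> Poly_Mapping.keys s \<Longrightarrow> act g x \<in> carrier A"
  shows "alg_act A act (r + s) x = alg_act A act r x \<oplus> alg_act A act s x"
proof -
  let ?S = "Poly_Mapping.keys r \<union> Poly_Mapping.keys s"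
  have "alg_act A act t x = (\<Oplus>g\<in>?S. Poly_Mapping.lookup t g \<odot> act g x)" if "t \<in> {r, s, r + s}" for t
    by (rule alg_act_superset) (use that keys_add[of r s] assms in auto)
  moreover have "(\<Oplus>g\<in>?S. Poly_Mapping.lookup (r + s) g \<odot> act g x) =
     (\<Oplus>g\<in>?S. Poly_Mapping.lookup r g \<odot> act g x \<oplus> Poly_Mapping.lookup s g \<odot> act g x)"
    by (rule M.finsum_cong') (use assms in \<open>auto simp: lookup_add k_distr_l k_closed\<close>)
  moreover have "\<dots> = (\<Oplus>g\<in>?S. Poly_Mapping.lookup r g \<odot> act g x) \<oplus> (\<Oplus>g\<in>?S. Poly_Mapping.lookup s g \<odot> act g x)"
    by (rule M.finsum_addf) (use assms k_closed in auto)
  ultimately show ?thesis by simp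
qed

lemma alg_act_single:
  assumes "act g x \<in> carrier A"
  shows "alg_act A act (Poly_Mapping.single g c) x = c \<odot> act g x"
  using alg_act_superset[of "{g}" "Poly_Mapping.single g c" act x] assms k_closed[OF assms] by simp

lemma alg_act_zero: "alg_act A act 0 x = \<zero>"
  by (simp add: alg_act_def)

lemma alg_act_closed':
  assumes "\<And>g. g \<in> Poly_Mapping.keys r \<Longrightarrow> act g x \<in> carrier A"
  shows "alg_act A act r x \<in> carrier A"
  unfolding alg_act_def using assms k_closed by (intro M.finsum_closed) auto

end

context vi_mod
begin

context
  fixes Z :: "'f fvec set" assumes Z: "Z \<in> VI_obj"
begin

abbreviation "zact \<equiv> alg_act (Ob M Z) (Act M Z Z)"

interpretation Z: kmod "Ob M Z" by (rule kmod_Ob[OF Z])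

lemma zact_closed:
  "Poly_Mapping.keys r \<subseteq> VI_hom Z Z \<Longrightarrow> y \<in> carrier (Ob M Z) \<Longrightarrow> zact r y \<in> carrier (Ob M Z)"
  using Act_linear(1)[OF Z Z _ Z Z] by (intro Z.alg_act_closed') auto

lemma zact_add:
  "Poly_Mapping.keys r \<subseteq> VI_hom Z Z \<Longrightarrow> Poly_Mapping.keys s \<subseteq> VI_hom Z Z \<Longrightarrow> y \<in> carrier (Ob M Z) \<Longrightarrow>
   zact (r + s) y = zact r y \<oplus>\<^bsub>Ob M Z\<^esub> zact s y"
  using Act_linear(1)[OF Z Z _ Z Z] by (intro Z.alg_act_add) auto

lemma zact_single:
  "g \<in> VI_hom Z Z \<Longrightarrow> y \<in> carrier (Ob M Z) \<Longrightarrow>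
   zact (Poly_Mapping.single g c) y = c \<odot>\<^bsub>Ob M Z\<^esub> Act M Z Z g y"
  using Act_linear(1)[OF Z Z _ Z Z] by (intro Z.alg_act_single) auto

lemma keys_basis_mult:
  assumes "h \<in> VI_hom Z Z" "Poly_Mapping.keys r \<subseteq> VI_hom Z Z"
  shows "Poly_Mapping.keys (lin_ext (\<lambda>g. basis_elt (compose Z h g)) (r :: _ \<Rightarrow>\<^sub>0 'k)) \<subseteq> VI_hom Z Z"
  using keys_lin_ext[of "\<lambda>g. basis_elt (compose Z h g)" r] VI_hom_compose[OF _ assms(1) Z] assms(2) by fastforce

lemma zact_mult:
  assumes "Poly_Mapping.keys r \<subseteq> VI_hom Z Z" "h \<in> VI_hom Z Z" "y \<in> carrier (Ob M Z)"
  shows "zact (lin_ext (\<lambda>g. basis_elt (compose Z h g)) r) y = Act M Z Z h (zact r y)"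
  using assms(1)
proof (induction r rule: poly_mapping_keys_induct)
  case zero
  then show ?case using Act_linear(4)[OF Z Z assms(2) Z Z] by (simp add: Z.alg_act_zero)
next
  case (add g c r)
  have hg: "compose Z h g \<in> VI_hom Z Z" by (rule VI_hom_compose[OF add(1) assms(2) Z])
  have gy: "Act M Z Z g y \<in> carrier (Ob M Z)" by (rule Act_linear(1)[OF Z Z add(1) Z Z assms(3)])
  have ry: "zact r y \<in> carrier (Ob M Z)" by (rule zact_closed[OF add(2) assms(3)])
  have k: "Poly_Mapping.keys (Poly_Mapping.single x c) \<subseteq> VI_hom Z Z" if "x \<in> VI_hom Z Z" for x and c :: 'k
    using that by auto
  have "zact (lin_ext (\<lambda>g. basis_elt (compose Z h g)) (Poly_Mapping.single g c + r)) y =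
      zact (Poly_Mapping.single (compose Z h g) c + lin_ext (\<lambda>g. basis_elt (compose Z h g)) r) y"
    by (simp add: lin_ext_add)
  also have "\<dots> = c \<odot>\<^bsub>Ob M Z\<^esub> Act M Z Z (compose Z h g) y \<oplus>\<^bsub>Ob M Z\<^esub> Act M Z Z h (zact r y)"
    unfolding zact_add[OF k[OF hg] keys_basis_mult[OF assms(2) add(2)] assms(3)] zact_single[OF hg assms(3)] add(3) ..
  also have "\<dots> = Act M Z Z h (c \<odot>\<^bsub>Ob M Z\<^esub> Act M Z Z g y \<oplus>\<^bsub>Ob M Z\<^esub> zact r y)"
    unfolding Act_compose[OF Z Z Z add(1) assms(2,3)]
      Act_linear(2)[OF Z Z assms(2) Z Z Z.k_closed[OF gy] ry] Act_linear(3)[OF Z Z assms(2) Z Z gy] ..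
  also have "\<dots> = Act M Z Z h (zact (Poly_Mapping.single g c + r) y)"
    unfolding zact_add[OF k[OF add(1)] add(2) assms(3)] zact_single[OF add(1) assms(3)] ..
  finally show ?case .
qed

lemma zact_diff:
  assumes "Poly_Mapping.keys r \<subseteq> VI_hom Z Z" "Poly_Mapping.keys s \<subseteq> VI_hom Z Z" "y \<in> carrier (Ob M Z)"
  shows "zact (r - s) y = zact r y \<ominus>\<^bsub>Ob M Z\<^esub> zact s y"
proof -
  have ks: "Poly_Mapping.keys (r - s) \<subseteq> VI_hom Z Z"
    by (rule keys_diff_subset[OF assms(1,2)])
  have "zact r y = zact (r - s) y \<oplus>\<^bsub>Ob M Z\<^esub> zact s y"
    using zact_add[OF ks assms(2,3)] by simp
  then show ?thesis
    using zact_closed[OF ks assms(3)] zact_closed[OF assms(2,3)]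
    by (simp add: Z.M.minus_eq Z.M.a_assoc Z.M.r_neg)
qed

text \<open>Left multiplication by \<open>id - s v\<close> in the group algebra becomes the
  operation \<open>m - s v m\<close> on the module. The product that defines \<open>L_elt\<close>
  therefore never has to be expanded in the group algebra.\<close>

lemma zact_fold:
  assumes "\<And>v. v \<in> set ws \<Longrightarrow> s v \<in> VI_hom Z Z" "Poly_Mapping.keys r \<subseteq> VI_hom Z Z" "y \<in> carrier (Ob M Z)"
  shows "zact (fold (\<lambda>v a. alg_mult Z (basis_elt (restrict id Z) - basis_elt (s v)) a) ws r) y =
    fold (\<lambda>v m. m \<ominus>\<^bsub>Ob M Z\<^esub> Act M Z Z (s v) m) ws (zact r y)"
  using assms(1,2)
proof (induction ws arbitrary: r)
  case (Cons v ws)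
  let ?f = "\<lambda>h. lin_ext (\<lambda>g. basis_elt (compose Z h g)) r"
  have idh: "restrict id Z \<in> VI_hom Z Z" by (rule VI_hom_id[OF Z])
  have sv: "s v \<in> VI_hom Z Z" using Cons.prems(1) by simp
  have eq: "alg_mult Z (basis_elt (restrict id Z) - basis_elt (s v)) r = ?f (restrict id Z) - ?f (s v)"
    by (simp add: alg_mult_lin_ext lin_ext_diff)
  have k1: "Poly_Mapping.keys (?f (restrict id Z)) \<subseteq> VI_hom Z Z" by (rule keys_basis_mult[OF idh Cons.prems(2)])
  have k2: "Poly_Mapping.keys (?f (s v)) \<subseteq> VI_hom Z Z" by (rule keys_basis_mult[OF sv Cons.prems(2)])
  have k: "Poly_Mapping.keys (?f (restrict id Z) - ?f (s v)) \<subseteq> VI_hom Z Z"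
    by (rule keys_diff_subset[OF k1 k2])
  have "zact (?f (restrict id Z) - ?f (s v)) y = zact r y \<ominus>\<^bsub>Ob M Z\<^esub> Act M Z Z (s v) (zact r y)"
    unfolding zact_diff[OF k1 k2 assms(3)] zact_mult[OF Cons.prems(2) idh assms(3)]
      zact_mult[OF Cons.prems(2) sv assms(3)] Act_id[OF Z zact_closed[OF Cons.prems(2) assms(3)]] ..
  moreover have "zact (fold (\<lambda>v a. alg_mult Z (basis_elt (restrict id Z) - basis_elt (s v)) a) ws
        (?f (restrict id Z) - ?f (s v))) y =
      fold (\<lambda>v m. m \<ominus>\<^bsub>Ob M Z\<^esub> Act M Z Z (s v) m) ws (zact (?f (restrict id Z) - ?f (s v)) y)"
    by (rule Cons.IH[OF Cons.prems(1) k]) simp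
  ultimately show ?case unfolding fold_simps eq by (simp only:)
qed simp

end

end

text \<open>Here \<open>triple_data\<close> is an arbitrary function into pairs (functional,
  vector). Since \<open>s v\<close> fixes all the vectors, it acts on an element only by shifting
  \<open>gs\<close>, so each operation \<open>m - s v m\<close> puts one more factor in front. The
  list is reversed because the head of \<open>ws\<close> is applied first and thus ends up
  innermost.\<close>

lemma (in vi_elt) fold_sigma:
  assumes Z: "Z \<in> VI_obj"
    and s: "\<And>v. v \<in> set ws \<Longrightarrow> s v \<in> VI_hom Z Z"
    and fix_u: "\<And>v q. v \<in> set ws \<Longrightarrow> q \<in> set (rev (map triple_data ws) @ ps) \<Longrightarrow> s v (snd q) = snd q"
    and sh: "\<And>v i. v \<in> set ws \<Longrightarrow> i < d \<Longrightarrow> s v (gs i) = shift gs (triple_data v) i"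
    and g: "indep_data Z d gs (rev (map triple_data ws) @ ps)"
  shows "fold (\<lambda>v m. m \<ominus>\<^bsub>Ob M Z\<^esub> Act M Z Z (s v) m) ws (G Z gs ps) = G Z gs (rev (map triple_data ws) @ ps)"
  using s fix_u sh g
proof (induction ws arbitrary: ps)
  case (Cons v ws)
  have gps: "indep_data Z d gs ps" by (rule indep_data_suffix[OF Cons.prems(4)])
  have "Act M Z Z (s v) (G Z gs ps) = G Z (s v \<circ> gs) (map (apsnd (s v)) ps)"
    by (rule G_Act[OF Z Z _ gps]) (use Cons.prems(1) in simp)
  also have "map (apsnd (s v)) ps = ps"
  proof (rule map_idI)
    fix q assume "q \<in> set ps"
    then have "s v (snd q) = snd q" using Cons.prems(2)[of v q] by simp
    then show "apsnd (s v) q = q" by (cases q) simp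
  qed
  also have "G Z (s v \<circ> gs) ps = G Z (shift gs (triple_data v)) ps"
    by (rule diff_elt_cong) (use Cons.prems(3) in simp)
  finally have "fold (\<lambda>v m. m \<ominus>\<^bsub>Ob M Z\<^esub> Act M Z Z (s v) m) (v # ws) (G Z gs ps) =
    fold (\<lambda>v m. m \<ominus>\<^bsub>Ob M Z\<^esub> Act M Z Z (s v) m) ws (G Z gs (triple_data v # ps))" by simp
  also have "\<dots> = G Z gs (rev (map triple_data ws) @ triple_data v # ps)"
    by (rule Cons.IH) (use Cons.prems in auto)
  finally show ?case by simp
qed simp

section \<open>The transvections of the construction\<close>

text \<open>The \<alpha>-coordinate with respect to the decomposition of the space as the sum of F
  \<alpha>, \<open>C\<close> and \<open>C'\<close>. Under the assumptions of the locale
  \<open>flag\<close> it is well defined and linear.\<close>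

definition coef :: "'f::field fvec \<Rightarrow> 'f fvec set \<Rightarrow> 'f fvec set \<Rightarrow> 'f fvec \<Rightarrow> 'f" where
  "coef \<alpha> C C' x = (THE a. \<exists>c\<in>C. \<exists>c'\<in>C'. x = fscale a \<alpha> + c + c')"

locale flag =
  fixes X W :: "'f::field fvec set" and \<alpha> C C'
  assumes alpha: "\<alpha> \<noteq> 0" and C: "is_complement W (fvs.span {\<alpha>}) C" and C': "is_complement X W C'"
    and W: "fvs.subspace W"
begin

lemma C_sub: "fvs.subspace C" "fvs.subspace C'" "C \<subseteq> W" "C' \<subseteq> X"
  using C C' by (auto simp: is_complement_def)

lemma alpha_W: "fscale a \<alpha> \<in> W"
proof -
  have "fscale a \<alpha> \<in> fvs.span {\<alpha>}" by (intro fvs.span_scale fvs.span_base) simp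
  moreover have "0 \<in> C" by (rule fvs.subspace_0[OF C_sub(1)])
  ultimately have "fscale a \<alpha> + 0 \<in> W" using C unfolding is_complement_def by blast
  then show ?thesis by simp
qed

lemma coef_eq:
  assumes "c \<in> C" "c' \<in> C'"
  shows "coef \<alpha> C C' (fscale a \<alpha> + c + c') = a"
  unfolding coef_def
proof (rule the_equality)
  show "\<exists>c1\<in>C. \<exists>c1'\<in>C'. fscale a \<alpha> + c + c' = fscale a \<alpha> + c1 + c1'" using assms by blast
next
  fix b assume "\<exists>c1\<in>C. \<exists>c1'\<in>C'. fscale a \<alpha> + c + c' = fscale b \<alpha> + c1 + c1'"
  then obtain c1 c1' where 1: "c1 \<in> C" "c1' \<in> C'" "fscale a \<alpha> + c + c' = fscale b \<alpha> + c1 + c1'" by blast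
  have W1: "fscale a \<alpha> + c - (fscale b \<alpha> + c1) \<in> W"
    using assms 1 C_sub W alpha_W by (intro fvs.subspace_diff fvs.subspace_add) auto
  have eq: "fscale a \<alpha> + c - (fscale b \<alpha> + c1) = c1' - c'" using 1(3) by (simp add: algebra_simps)
  have "c1' - c' \<in> C'" using assms 1 C_sub by (intro fvs.subspace_diff) auto
  then have "c1' - c' \<in> W \<inter> C'" using W1 eq by simp
  then have "c1' - c' = 0" using C' unfolding is_complement_def by blast
  then have eq2: "fscale a \<alpha> - fscale b \<alpha> = c1 - c" using eq by (simp add: algebra_simps)
  have "c1 - c \<in> C" using assms 1 C_sub by (intro fvs.subspace_diff) auto
  moreover have "fscale a \<alpha> - fscale b \<alpha> \<in> fvs.span {\<alpha>}"
    by (intro fvs.span_diff fvs.span_scale fvs.span_base) auto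
  ultimately have "fscale a \<alpha> - fscale b \<alpha> \<in> fvs.span {\<alpha>} \<inter> C" using eq2 by simp
  then have "fscale a \<alpha> - fscale b \<alpha> = 0" using C unfolding is_complement_def by blast
  then have "fscale (a - b) \<alpha> = 0" by (simp add: fvs.scale_left_diff_distrib)
  then show "b = a" using alpha by simp
qed

lemma decompose:
  assumes "x \<in> X"
  obtains c c' where "c \<in> C" "c' \<in> C'" "x = fscale (coef \<alpha> C C' x) \<alpha> + c + c'"
proof -
  obtain w c' where w: "w \<in> W" "c' \<in> C'" "x = w + c'" using assms C' unfolding is_complement_def by blast
  obtain u c where u: "u \<in> fvs.span {\<alpha>}" "c \<in> C" "w = u + c" using w(1) C unfolding is_complement_def by blast
  obtain a where "u = fscale a \<alpha>" using u(1) fvs.span_singleton[of \<alpha>] by auto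
  then have "x = fscale a \<alpha> + c + c'" using w u by simp
  then show ?thesis using that[OF u(2) w(2)] coef_eq[OF u(2) w(2), of a] by simp
qed

lemma coef_add:
  assumes "x \<in> X" "y \<in> X" shows "coef \<alpha> C C' (x + y) = coef \<alpha> C C' x + coef \<alpha> C C' y"
proof -
  obtain c c' where x: "c \<in> C" "c' \<in> C'" "x = fscale (coef \<alpha> C C' x) \<alpha> + c + c'" by (rule decompose[OF assms(1)])
  obtain e e' where y: "e \<in> C" "e' \<in> C'" "y = fscale (coef \<alpha> C C' y) \<alpha> + e + e'" by (rule decompose[OF assms(2)])
  have "x + y = fscale (coef \<alpha> C C' x + coef \<alpha> C C' y) \<alpha> + (c + e) + (c' + e')"
    by (subst x(3), subst y(3)) (simp add: fvs.scale_left_distrib add_ac)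
  then show ?thesis using coef_eq[of "c + e" "c' + e'"] x y C_sub by (metis fvs.subspace_add)
qed

lemma coef_scale:
  assumes "x \<in> X" shows "coef \<alpha> C C' (fscale b x) = b * coef \<alpha> C C' x"
proof -
  obtain c c' where x: "c \<in> C" "c' \<in> C'" "x = fscale (coef \<alpha> C C' x) \<alpha> + c + c'" by (rule decompose[OF assms(1)])
  have "fscale b x = fscale (b * coef \<alpha> C C' x) \<alpha> + fscale b c + fscale b c'"
    by (subst x(3)) (simp add: fvs.scale_right_distrib)
  then show ?thesis using coef_eq[of "fscale b c" "fscale b c'"] x C_sub by (metis fvs.subspace_scale)
qed

lemma coef_alpha: "coef \<alpha> C C' \<alpha> = 1"
  using coef_eq[OF fvs.subspace_0[OF C_sub(1)] fvs.subspace_0[OF C_sub(2)], of 1] by simp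

lemma coef_C: "c \<in> C \<Longrightarrow> coef \<alpha> C C' c = 0" "c' \<in> C' \<Longrightarrow> coef \<alpha> C C' c' = 0"
  using coef_eq[OF _ fvs.subspace_0[OF C_sub(2)], of c 0] coef_eq[OF fvs.subspace_0[OF C_sub(1)], of c' 0] by auto

end


lemma std_incl_image: "std_incl d ` std_space d = (std_space d :: 'f::field fvec set)"
  by (simp add: std_incl_def)

lemma mem_std_V:
  "(\<alpha>, C, C') \<in> std_V d n \<longleftrightarrow> (\<exists>i<d. \<alpha> = std_vec i \<and>
     is_complement (std_space d) (fvs.span {std_vec i}) C \<and> std_vec ` {..<i} \<subseteq> C \<and>
     is_complement (std_space n) (std_space d) C')"
proof -
  have "set (take i (map std_vec [0..<d])) = (std_vec ` {..<i} :: 'a fvec set)" if "i < d" for i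
    using that by (simp add: take_map atLeast0LessThan)
  then show ?thesis
    unfolding std_V_def Vset_def std_incl_image mem_Collect_eq prod.case
    by (intro ex_cong1) (auto simp: take_map)
qed

lemma std_vec_nonzero: "std_vec i \<noteq> (0 :: 'f::field fvec)"
  by (auto simp: std_vec_def fun_eq_iff intro!: exI[of _ i])

lemma flag_std_V:
  assumes "(\<alpha>, C, C') \<in> std_V d n"
  shows "flag (std_space n) (std_space d) \<alpha> C C'"
  using assms unfolding mem_std_V flag_def by (auto simp: std_vec_nonzero std_space_subspace)

section \<open>The space X + E and the identification of \<open>sigma\<close> with a
  transvection\<close>

locale V_order =
  fixes d n :: nat and vs :: "'f::field triple list"
  assumes dn: "d \<le> n" and dis: "distinct vs" and set_vs: "set vs = std_V d n"
begin

abbreviation "X \<equiv> (std_space n :: 'f fvec set)"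
abbreviation "Z \<equiv> XE X vs"

text \<open>The linear map from X + E to X that is the identity on X and sends each e_v to
  \<alpha>_v. On X + E its kernel is spanned by the vectors e_v - \<alpha>_v, so composing a
  coordinate on X with it gives a functional that vanishes on all of them.\<close>

definition proj :: "'f fvec \<Rightarrow> 'f fvec" where
  "proj z = (\<lambda>i. z (2 * i)) + (\<Sum>i<length vs. fscale (z (Suc (2 * i))) (fst (vs ! i)))"

definition uvec :: "'f triple \<Rightarrow> 'f fvec" where
  "uvec v = dpair 0 (e_vec vs v) - dpair (fst v) 0"

definition phi :: "'f triple \<Rightarrow> 'f fvec \<Rightarrow> 'f" where
  "phi v z = coef (fst v) (fst (snd v)) (snd (snd v)) (proj z)"

lemma e_vec_nth: "i < length vs \<Longrightarrow> e_vec vs (vs ! i) = std_vec i"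
  unfolding e_vec_def
  by (rule arg_cong[of _ _ std_vec], rule the_equality) (use dis in \<open>auto simp: nth_eq_iff_index_eq\<close>)

lemma Z_obj: "Z \<in> VI_obj" by (rule XE_VI_obj)

lemma Z_sub: "fvs.subspace Z" by (rule VI_obj_subspace[OF Z_obj])

lemma dpair_Z: "dpair x e \<in> Z \<longleftrightarrow> x \<in> X \<and> e \<in> std_space (length vs)"
  by (simp add: dsum_std dpair_in_coord_space)

lemma std_space_mono: "std_space d \<subseteq> X"
  using dn by (auto simp: std_space_def)

lemma zero_std: "0 \<in> std_space m"
  by (simp add: std_space_def)

lemma flag_v: "(\<alpha>, C, C') \<in> set vs \<Longrightarrow> flag X (std_space d) \<alpha> C C'"
  using flag_std_V set_vs by blast

lemma fst_in: "v \<in> set vs \<Longrightarrow> \<exists>i<d. fst v = std_vec i"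
  using set_vs by (cases v) (auto simp: mem_std_V)

lemma fst_X: "v \<in> set vs \<Longrightarrow> fst v \<in> std_space d" "v \<in> set vs \<Longrightarrow> fst v \<in> X"
proof -
  show 1: "fst v \<in> std_space d" if "v \<in> set vs" for v
    using fst_in[OF that] by (auto simp: std_vec_in)
  show "v \<in> set vs \<Longrightarrow> fst v \<in> X" using 1 std_space_mono by blast
qed

lemma uvec_Z: "v \<in> set vs \<Longrightarrow> uvec v \<in> Z"
  unfolding uvec_def using fst_X(2)[of v] e_vec_nth std_vec_in
  by (intro fvs.subspace_diff[OF Z_sub]) (auto simp: dpair_Z zero_std in_set_conv_nth)

lemma proj_add: "proj (x + y) = proj x + proj y"
  by (simp add: proj_def fvs.scale_left_distrib sum.distrib fun_eq_iff)

lemma proj_scale: "proj (fscale c x) = fscale c (proj x)"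
proof -
  have "fscale c x i = c * x i" for i by (simp add: fscale_def)
  then have "(\<Sum>i<length vs. fscale (fscale c x (Suc (2 * i))) (fst (vs ! i))) =
     fscale c (\<Sum>i<length vs. fscale (x (Suc (2 * i))) (fst (vs ! i)))"
    by (simp add: fvs.scale_sum_right)
  moreover have "(\<lambda>i. fscale c x (2 * i)) = fscale c (\<lambda>i. x (2 * i))" by (simp add: fscale_def)
  ultimately show ?thesis unfolding proj_def by (simp add: fvs.scale_right_distrib)
qed

lemma proj_X:
  assumes "z \<in> Z" shows "proj z \<in> X"
proof -
  obtain x e where z: "z = dpair x e" "x \<in> X" using assms dpair_surj[of z] dpair_Z by blast
  have "(\<lambda>i. z (2 * i)) \<in> X" using z by (simp add: dpair_fst)
  then show ?thesis unfolding proj_def using fst_X(2)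
    by (intro fvs.subspace_add fvs.subspace_sum fvs.subspace_scale) (auto simp: std_space_subspace)
qed

lemma proj_fst: "proj (dpair x 0) = x"
  by (simp add: proj_def dpair_fst dpair_snd)

lemma proj_uvec:
  assumes "v \<in> set vs" shows "proj (uvec v) = 0"
proof -
  obtain j where j: "j < length vs" "v = vs ! j" using assms by (auto simp: in_set_conv_nth)
  have u: "uvec v = dpair (- fst v) (std_vec j)"
    unfolding uvec_def dpair_diff using e_vec_nth[OF j(1)] j(2) by simp
  have "(\<Sum>i<length vs. fscale (std_vec j i) (fst (vs ! i))) = (\<Sum>i<length vs. if i = j then fst v else 0)"
    by (rule sum.cong) (auto simp: std_vec_def j)
  also have "\<dots> = fst v" using j(1) by simp
  finally have S: "(\<Sum>i<length vs. fscale (std_vec j i) (fst (vs ! i))) = fst v" .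
  have "(\<lambda>i. uvec v (2 * i)) = - fst v" unfolding u by (rule ext) (simp only: dpair_fst)
  then show ?thesis unfolding proj_def unfolding u dpair_snd S by simp
qed

text \<open>X + E is spanned by X and the vectors \<open>uvec v\<close>, since e_v = \<alpha>_v +
  \<open>uvec v\<close>. The coefficients are the E-coordinates of \<open>z\<close>. This spanning
  property gives the uniqueness of \<open>sigma\<close>.\<close>

lemma Z_expand:
  assumes "z \<in> Z"
  obtains b where "z = dpair (proj z) 0 + (\<Sum>i<length vs. fscale (b i) (uvec (vs ! i)))"
proof -
  obtain x e where z: "z = dpair x e" "e \<in> std_space (length vs)" using assms dpair_surj[of z] dpair_Z by blast
  have "dpair x e j = (dpair (proj z) 0 + (\<Sum>i<length vs. fscale (e i) (uvec (vs ! i)))) j" for j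
  proof -
    have u: "uvec (vs ! i) = dpair (- fst (vs ! i)) (std_vec i)" if "i < length vs" for i
      unfolding uvec_def dpair_diff using e_vec_nth[OF that] by simp
    have ds: "(\<Sum>i\<in>A. dpair (f i) (g i)) = dpair (\<Sum>i\<in>A. f i) (\<Sum>i\<in>A. g i)" for f g and A :: "nat set"
      by (induction A rule: infinite_finite_induct) (simp_all only: sum.infinite sum.empty sum.insert dpair_add dpair_zero not_False_eq_True)
    have "(\<Sum>i<length vs. fscale (e i) (uvec (vs ! i))) =
        (\<Sum>i<length vs. dpair (fscale (e i) (- fst (vs ! i))) (fscale (e i) (std_vec i)))"
      by (rule sum.cong) (simp_all add: u dpair_scale)
    also have "\<dots> = dpair (- (\<Sum>i<length vs. fscale (e i) (fst (vs ! i)))) e"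
      unfolding ds using std_expand[OF z(2)] by (simp add: sum_negf)
    finally show ?thesis unfolding z(1) proj_def by (simp add: dpair_add dpair_fst dpair_snd)
  qed
  then show ?thesis using that[of e] z(1) by blast
qed

lemma phi_add: "v \<in> set vs \<Longrightarrow> x \<in> Z \<Longrightarrow> y \<in> Z \<Longrightarrow> phi v (x + y) = phi v x + phi v y"
  unfolding phi_def proj_add using flag.coef_add[OF flag_v] proj_X by (cases v) simp

lemma phi_scale: "v \<in> set vs \<Longrightarrow> x \<in> Z \<Longrightarrow> phi v (fscale c x) = c * phi v x"
  unfolding phi_def proj_scale using flag.coef_scale[OF flag_v] proj_X by (cases v) simp

text \<open>\<open>proj\<close> kills every \<open>uvec w\<close>. Hence each transvection fixes the
  vectors of all the others, which makes them commute and is the hypothesis needed for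
  \<open>fold_sigma\<close>.\<close>

lemma phi_uvec: "v \<in> set vs \<Longrightarrow> w \<in> set vs \<Longrightarrow> phi v (uvec w) = 0"
  using phi_scale[of v "uvec w" 0] uvec_Z[of w] proj_uvec[of w] proj_scale[of 0 "uvec w"]
  by (simp add: phi_def)

definition transvection :: "'f triple \<Rightarrow> 'f fvec \<Rightarrow> 'f fvec" where
  "transvection v = restrict (\<lambda>z. z + fscale (phi v z) (uvec v)) Z"

lemma transvection_uvec: "v \<in> set vs \<Longrightarrow> w \<in> set vs \<Longrightarrow> transvection v (uvec w) = uvec w"
  by (simp add: transvection_def uvec_Z phi_uvec)

text \<open>As \<open>phi v\<close> vanishes on \<open>uvec v\<close>, the value
  \<open>phi v z\<close> does not change under the map, and subtracting \<open>phi v z\<close> times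
  \<open>uvec v\<close> inverts it.\<close>

lemma transvection_GL:
  assumes v: "v \<in> set vs" shows "transvection v \<in> GL Z"
proof -
  let ?u = "uvec v"
  have cl: "z + fscale c ?u \<in> Z" "z - fscale c ?u \<in> Z" if "z \<in> Z" for z c
    using that uvec_Z[OF v] Z_sub by (simp_all add: fvs.subspace_add fvs.subspace_diff fvs.subspace_scale)
  have phi_id: "phi v (z + fscale c ?u) = phi v z" "phi v (z - fscale c ?u) = phi v z" if "z \<in> Z" for z c
  proof -
    show *: "phi v (z + fscale c ?u) = phi v z" for c
      using phi_add[OF v that fvs.subspace_scale[OF Z_sub uvec_Z[OF v]], of c]
        phi_scale[OF v uvec_Z[OF v], of c] phi_uvec[OF v v] by simp
    show "phi v (z - fscale c ?u) = phi v z" using *[of "- c"] by simp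
  qed
  have "inj_on (transvection v) Z"
  proof (rule inj_onI)
    fix x y assume xy: "x \<in> Z" "y \<in> Z" "transvection v x = transvection v y"
    then have eq: "x + fscale (phi v x) ?u = y + fscale (phi v y) ?u" by (simp add: transvection_def)
    then have "phi v x = phi v y" using phi_id(1)[OF xy(1)] phi_id(1)[OF xy(2)] by metis
    then show "x = y" using eq by simp
  qed
  moreover have "transvection v ` Z = Z"
  proof
    show "transvection v ` Z \<subseteq> Z" using cl by (auto simp: transvection_def)
    show "Z \<subseteq> transvection v ` Z"
    proof
      fix z assume z: "z \<in> Z"
      have "transvection v (z - fscale (phi v z) ?u) = z"
        using cl(2)[OF z] phi_id(2)[OF z] by (simp add: transvection_def)
      then show "z \<in> transvection v ` Z" using cl(2)[OF z] by (metis imageI)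
    qed
  qed
  moreover have "transvection v \<in> Z \<rightarrow>\<^sub>E Z" using cl by (auto simp: transvection_def)
  moreover have "transvection v (x + y) = transvection v x + transvection v y" if "x \<in> Z" "y \<in> Z" for x y
    using that fvs.subspace_add[OF Z_sub that] by (simp add: transvection_def phi_add[OF v] fvs.scale_left_distrib)
  moreover have "transvection v (fscale c x) = fscale c (transvection v x)" if "x \<in> Z" for c x
    using that fvs.subspace_scale[OF Z_sub that]
    by (simp add: transvection_def phi_scale[OF v] fvs.scale_right_distrib)
  ultimately show ?thesis by (simp add: GL_def VI_hom_def)
qed

text \<open>The transvection has the required values, because \<open>phi v\<close> is 1 on \<alpha>
  and 0 on \<open>C\<close>, on \<open>C'\<close> and on all \<open>uvec w\<close>. These vectors
  span the whole space, so the definite description has exactly one solution.\<close>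

lemma sigma_eq:
  assumes v: "v \<in> set vs" shows "sigma X vs v = transvection v"
proof -
  obtain \<alpha> C C' where vv: "v = (\<alpha>, C, C')" by (cases v) auto
  interpret flag X "std_space d" \<alpha> C C' using flag_v v vv by simp
  have aX: "\<alpha> \<in> X" using fst_X(2)[OF v] vv by simp
  have CX: "c \<in> X" if "c \<in> C \<union> C'" for c using that C_sub std_space_mono by blast
  have XZ: "dpair x 0 \<in> Z" if "x \<in> X" for x using that by (simp add: dpair_Z zero_std)
  have aeq: "dpair \<alpha> 0 + uvec v = dpair 0 (e_vec vs v)" by (simp add: uvec_def vv)
  have neg: "dpair (fst w) 0 - dpair 0 (e_vec vs w) = - uvec w" for w by (simp add: uvec_def)
  show ?thesis unfolding vv sigma_def prod.case
  proof (rule the_equality, intro conjI ballI)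
    show "transvection (\<alpha>, C, C') \<in> GL Z" using transvection_GL[OF v] vv by simp
    have "phi v (dpair \<alpha> 0) = 1" by (simp add: phi_def vv proj_fst coef_alpha)
    then show "transvection (\<alpha>, C, C') (dpair \<alpha> 0) = dpair 0 (e_vec vs (\<alpha>, C, C'))"
      using XZ[OF aX] aeq by (simp add: transvection_def vv)
  next
    fix c assume c: "c \<in> C \<union> C'"
    then have "phi v (dpair c 0) = 0" using coef_C by (auto simp: phi_def vv proj_fst)
    then show "transvection (\<alpha>, C, C') (dpair c 0) = dpair c 0"
      using XZ[OF CX[OF c]] by (simp add: transvection_def vv)
  next
    fix w assume w: "w \<in> set vs"
    have "phi v (- uvec w) = 0"
      using phi_scale[OF v uvec_Z[OF w], of "-1"] phi_uvec[OF v w] by simp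
    moreover have "- uvec w \<in> Z" using fvs.subspace_neg[OF Z_sub uvec_Z[OF w]] .
    ultimately show "transvection (\<alpha>, C, C') (dpair (fst w) 0 - dpair 0 (e_vec vs w)) =
        dpair (fst w) 0 - dpair 0 (e_vec vs w)"
      unfolding neg by (simp add: transvection_def vv)
  next
    fix s assume s: "s \<in> GL Z \<and> s (dpair \<alpha> 0) = dpair 0 (e_vec vs (\<alpha>, C, C')) \<and>
      (\<forall>c\<in>C \<union> C'. s (dpair c 0) = dpair c 0) \<and>
      (\<forall>w\<in>set vs. s (dpair (fst w) 0 - dpair 0 (e_vec vs w)) = dpair (fst w) 0 - dpair 0 (e_vec vs w))"
    then have sh: "s \<in> VI_hom Z Z" by (simp add: GL_def)
    obtain k where k: "flinear k" "\<And>z. z \<in> Z \<Longrightarrow> k z = s z" using VI_hom_linear[OF Z_obj sh] by blast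
    interpret k: Vector_Spaces.linear fscale fscale k by (rule k(1))
    have ka: "k (dpair \<alpha> 0) = dpair \<alpha> 0 + uvec v" using k(2)[OF XZ[OF aX]] s aeq vv by simp
    have kc: "k (dpair c 0) = dpair c 0" if "c \<in> C \<union> C'" for c using k(2)[OF XZ[OF CX[OF that]]] s that by simp
    have ku: "k (uvec w) = uvec w" if "w \<in> set vs" for w
    proof -
      have "k (- uvec w) = - uvec w"
        using k(2)[OF fvs.subspace_neg[OF Z_sub uvec_Z[OF that]]] s that unfolding neg by simp
      then show ?thesis by (simp add: k.neg)
    qed
    have "s z = transvection v z" if z: "z \<in> Z" for z
    proof -
      obtain b where b: "z = dpair (proj z) 0 + (\<Sum>i<length vs. fscale (b i) (uvec (vs ! i)))"
        by (rule Z_expand[OF z])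
      obtain c c' where c: "c \<in> C" "c' \<in> C'" "proj z = fscale (coef \<alpha> C C' (proj z)) \<alpha> + c + c'"
        by (rule decompose[OF proj_X[OF z]])
      have p: "dpair (proj z) 0 = fscale (phi v z) (dpair \<alpha> 0) + dpair c 0 + dpair c' 0"
        by (subst c(3)) (simp add: phi_def vv dpair_add dpair_scale)
      have "k (dpair (proj z) 0) = dpair (proj z) 0 + fscale (phi v z) (uvec v)"
        unfolding p using kc[of c] kc[of c'] c(1,2) ka by (simp add: k.add k.scale fvs.scale_right_distrib)
      moreover have "k (\<Sum>i<length vs. fscale (b i) (uvec (vs ! i))) = (\<Sum>i<length vs. fscale (b i) (uvec (vs ! i)))"
        unfolding k.sum by (rule sum.cong) (simp_all add: k.scale ku)
      ultimately have "k z = z + fscale (phi v z) (uvec v)"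
        by (subst (1 2) b) (simp add: k.add)
      then show ?thesis using k(2)[OF z] z by (simp add: transvection_def)
    qed
    then show "s = transvection (\<alpha>, C, C')"
      using VI_hom_extensional[OF sh] unfolding vv[symmetric] transvection_def
      by (intro extensionalityI[of _ Z]) auto
  qed
qed

end

text \<open>The functional phi_v o f, by its coefficients. On the image of f the coordinate does not
  depend on the complement of the image (\<open>coef_W\<close>), so \<open>{0}\<close> may replace
  it; thus the functional depends only on \<alpha> and \<open>C\<close>, and different n can be
  compared. The value 0 from index \<open>d\<close> on makes equal functionals equal as
  functions.\<close>

definition vtype :: "nat \<Rightarrow> 'f::field triple \<Rightarrow> 'f fvec" where
  "vtype d v = (\<lambda>i. if i < d then coef (fst v) (fst (snd v)) {0} (std_vec i) else 0)"

lemma (in flag) coef_W: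
  assumes "x \<in> W" shows "coef \<alpha> C {0} x = coef \<alpha> C C' x"
proof -
  have "is_complement W W {0}" using fvs.subspace_0[OF W] by (auto simp: is_complement_def)
  then interpret W: flag W W \<alpha> C "{0}" using alpha C W by (simp add: flag_def)
  obtain c c' where c: "c \<in> C" "c' \<in> {0}" "x = fscale (coef \<alpha> C {0} x) \<alpha> + c + c'"
    by (rule W.decompose[OF assms])
  have "coef \<alpha> C C' (fscale (coef \<alpha> C {0} x) \<alpha> + c + 0) = coef \<alpha> C {0} x"
    by (rule coef_eq[OF c(1) fvs.subspace_0[OF C_sub(2)]])
  moreover have "fscale (coef \<alpha> C {0} x) \<alpha> + c + 0 = x" using c by simp
  ultimately show ?thesis by simp
qed

definition std_frame :: "nat \<Rightarrow> 'f::field fvec" where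
  "std_frame i = dpair (std_vec i) 0"

context V_order
begin

definition triple_data :: "'f triple \<Rightarrow> 'f fvec \<times> 'f fvec" where
  "triple_data v = (vtype d v, uvec v)"

lemma std_frame_Z: "i < d \<Longrightarrow> std_frame i \<in> Z"
  unfolding std_frame_def dpair_Z using std_vec_in[of i d] std_space_mono zero_std by blast

lemma transvection_std_frame:
  assumes "v \<in> set vs" "i < d"
  shows "transvection v (std_frame i) = shift std_frame (triple_data v) i"
proof -
  obtain \<alpha> C C' where vv: "v = (\<alpha>, C, C')" by (cases v) auto
  interpret flag X "std_space d" \<alpha> C C' using flag_v assms(1) vv by simp
  have "phi v (std_frame i) = vtype d v i"
    using coef_W[OF std_vec_in[OF assms(2)]] assms(2)
    by (simp add: phi_def vtype_def vv std_frame_def proj_fst)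
  then show ?thesis using std_frame_Z[OF assms(2)] by (simp add: transvection_def shift_def triple_data_def)
qed

text \<open>Every \<alpha>_v is one of the frame vectors, so replacing e_v by e_v - \<alpha>_v keeps
  the span. Independence then follows from that of distinct coordinate vectors.\<close>

lemma indep_data_std: "indep_data Z d std_frame (map triple_data vs)"
proof -
  let ?r = "length vs"
  \<comment> \<open>The functionals are set to 0 as placeholders, since independence concerns the
    vectors only.\<close>
  define qs where "qs = map (\<lambda>i. (0 :: 'f fvec, dpair 0 (std_vec i) :: 'f fvec)) [0..<?r]"
  have set_qs: "std_frame ` {..<d} \<union> snd ` set qs = std_vec ` dsum_idx d ?r"
    by (auto simp: qs_def std_frame_def dpair_std_vec dsum_idx_def image_Un image_image atLeast0LessThan)
  have "card (std_vec ` dsum_idx d ?r :: 'f fvec set) = d + ?r"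
    by (metis card_image card_dsum_idx inj_on_subset inj_std_vec subset_UNIV)
  then have dim: "fvs.dim (std_vec ` dsum_idx d ?r :: 'f fvec set) = d + ?r"
    by (simp add: fvs.dim_eq_card_independent[OF independent_std_vec])
  have "snd ` set qs \<subseteq> Z" by (auto simp: qs_def dpair_Z zero_std std_vec_in)
  then have gq: "indep_data Z d std_frame qs"
    unfolding indep_data_iff set_qs dim using std_frame_Z by (auto simp: qs_def)
  have eq: "uvec (vs ! i) = dpair 0 (std_vec i) - std_frame k" if "i < ?r" "fst (vs ! i) = std_vec k" for i k
    using that by (simp add: uvec_def e_vec_nth std_frame_def)
  have set_pr: "snd ` set (map triple_data vs) = uvec ` set vs" by (auto simp: triple_data_def image_image)
  show ?thesis
  proof (rule indep_data_span[OF gq Z_sub])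
    let ?A = "std_frame ` {..<d} \<union> snd ` set qs" and ?B = "std_frame ` {..<d} \<union> snd ` set (map triple_data vs)"
    have "uvec v \<in> fvs.span ?A" if v: "v \<in> set vs" for v
    proof -
      obtain i where i: "i < ?r" "v = vs ! i" using v by (auto simp: in_set_conv_nth)
      obtain k where k: "k < d" "fst v = std_vec k" using fst_in[OF v] by blast
      have "dpair 0 (std_vec i) \<in> snd ` set qs" using i by (force simp: qs_def)
      then show ?thesis
        unfolding i(2) eq[OF i(1) k(2)[unfolded i(2)]] using k(1) by (intro fvs.span_diff fvs.span_base) auto
    qed
    then show "?B \<subseteq> fvs.span ?A" unfolding set_pr by (auto intro: fvs.span_base)
    have "dpair 0 (std_vec i) \<in> fvs.span ?B" if i: "i < ?r" for i
    proof -
      obtain k where k: "k < d" "fst (vs ! i) = std_vec k" using fst_in[of "vs ! i"] i by auto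
      have "dpair 0 (std_vec i) = uvec (vs ! i) + std_frame k" using eq[OF i k(2)] by simp
      also have "\<dots> \<in> fvs.span ?B" unfolding set_pr using i k(1) by (intro fvs.span_add fvs.span_base) auto
      finally show ?thesis .
    qed
    then show "?A \<subseteq> fvs.span ?B" by (auto simp: qs_def intro: fvs.span_base)
  qed (simp add: qs_def)
qed

lemma lin_map_std_frame:
  "lin_map d (std_frame :: nat \<Rightarrow> 'f fvec) = compose (std_space d) (\<lambda>x. dpair x 0) (std_incl d)"
proof -
  have ds: "(\<Sum>i\<in>A. dpair (f i) 0) = dpair (\<Sum>i\<in>A. f i) (0 :: 'f fvec)" for f and A :: "nat set"
    by (induction A rule: infinite_finite_induct) (simp_all only: sum.infinite sum.empty sum.insert dpair_add dpair_zero not_False_eq_True add_0_right)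
  have "(\<Sum>i<d. fscale (x i) (std_frame i)) = dpair x 0" if "x \<in> std_space d" for x :: "'f fvec"
  proof -
    have "(\<Sum>i<d. fscale (x i) (std_frame i)) = (\<Sum>i<d. dpair (fscale (x i) (std_vec i)) 0)"
      by (simp add: std_frame_def dpair_scale)
    then show ?thesis unfolding ds using std_expand[OF that] by simp
  qed
  then show ?thesis unfolding lin_map_def compose_def std_incl_def by (intro restrict_ext) auto
qed

text \<open>This connects the construction with \<open>diff_elt\<close>. Starting from the empty
  product, the transvections contribute their factors by \<open>fold_sigma\<close>, as each fixes
  all \<open>uvec w\<close> and shifts the frame of f^E by its own pair.\<close>

lemma generator_eq:
  fixes M :: "('f, 'k::field, 'm) vimod"
  assumes "VI_module M" "x \<in> carrier (Ob M (std_space d))"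
  shows "alg_act (Ob M Z) (Act M Z Z) (L_elt X vs (std_V d n)) (Act M (std_space d) Z (lin_map d std_frame) x) =
    diff_elt M d x Z std_frame (rev (map triple_data vs))"
proof -
  interpret vi_elt M d x using assms by unfold_locales auto
  interpret Z: kmod "Ob M Z" by (rule kmod_Ob[OF Z_obj])
  have g: "indep_data Z d std_frame (rev (map triple_data vs) @ [])" using indep_data_mset[OF indep_data_std] by simp
  have y: "G Z std_frame [] \<in> carrier (Ob M Z)"
    by (rule G_closed[OF Z_obj indep_data_suffix[OF g]])
  have s: "sigma X vs v \<in> VI_hom Z Z" if "v \<in> set vs" for v
    using transvection_GL[OF that] sigma_eq[OF that] by (simp add: GL_def)
  \<comment> \<open>The set S is the whole of V here, so the filter in \<open>L_elt\<close> keeps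
    every entry of the list.\<close>
  have "filter (\<lambda>v. v \<in> std_V d n) vs = vs" using set_vs by (simp add: filter_id_conv)
  then have L: "L_elt X vs (std_V d n) =
      fold (\<lambda>v a. alg_mult Z (basis_elt (restrict id Z) - basis_elt (sigma X vs v)) a) vs (basis_elt (restrict id Z))"
    unfolding L_elt_def by (simp only:)
  have k: "Poly_Mapping.keys (basis_elt (restrict id Z) :: _ \<Rightarrow>\<^sub>0 'k) \<subseteq> VI_hom Z Z"
    by (rule keys_single_subset[OF VI_hom_id[OF Z_obj]])
  have one: "zact Z (basis_elt (restrict id Z)) (G Z std_frame []) = G Z std_frame []"
    unfolding zact_single[OF Z_obj VI_hom_id[OF Z_obj] y] Act_id[OF Z_obj y] by (rule Z.k_one[OF y])
  have "zact Z (L_elt X vs (std_V d n)) (G Z std_frame []) =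
      fold (\<lambda>v m. m \<ominus>\<^bsub>Ob M Z\<^esub> Act M Z Z (sigma X vs v) m) vs (G Z std_frame [])"
    unfolding L using zact_fold[where s = "sigma X vs", OF Z_obj s k y] unfolding one .
  also have "\<dots> = G Z std_frame (rev (map triple_data vs) @ [])"
  proof (rule fold_sigma[OF Z_obj s _ _ g])
    fix v q assume v: "v \<in> set vs" and q: "q \<in> set (rev (map triple_data vs) @ [])"
    then obtain w where "w \<in> set vs" "snd q = uvec w" by (auto simp: triple_data_def)
    then show "sigma X vs v (snd q) = snd q" using transvection_uvec[OF v] sigma_eq[OF v] by simp
  next
    fix v i assume "v \<in> set vs" "i < d"
    then show "sigma X vs v (std_frame i) = shift std_frame (triple_data v) i"
      using transvection_std_frame sigma_eq by simp
  qed
  finally show ?thesis by simp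
qed

end

text \<open>Two lists of pairs with the same multiset of functionals can be aligned entry by entry,
  after which only their vectors remain to be matched by a morphism.\<close>

lemma mset_map_fst_exists:
  assumes "image_mset fst (mset ps) = mset cs"
  shows "\<exists>qs. mset qs = mset ps \<and> map fst qs = cs"
  using assms
proof (induction cs arbitrary: ps)
  case (Cons c cs)
  then have "c \<in># image_mset fst (mset ps)" by simp
  then obtain p where p: "p \<in> set ps" "fst p = c" by auto
  then obtain as bs where ps: "ps = as @ p # bs" by (metis split_list)
  have "image_mset fst (mset (as @ bs)) = mset cs" using Cons.prems p(2) ps by simp
  then obtain qs where "mset qs = mset (as @ bs)" "map fst qs = cs" using Cons.IH by blast
  then have "mset (p # qs) = mset ps \<and> map fst (p # qs) = c # cs" using p(2) ps by simp
  then show ?case by (rule exI)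
qed simp

section \<open>VI-submodules generated by a set of elements\<close>

context vi_mod
begin

lemma VI_submoduleD:
  assumes "VI_submodule N M" "Y \<in> VI_obj"
  shows "ksubmodule (N Y) (Ob M Y)" "N Y \<subseteq> carrier (Ob M Y)"
    "Z \<in> VI_obj \<Longrightarrow> g \<in> VI_hom Y Z \<Longrightarrow> y \<in> N Y \<Longrightarrow> Act M Y Z g y \<in> N Z"
proof -
  interpret kmod "Ob M Y" by (rule kmod_Ob[OF assms(2)])
  show "ksubmodule (N Y) (Ob M Y)" using assms by (simp add: VI_submodule_def)
  then show "N Y \<subseteq> carrier (Ob M Y)" by (rule k_submodule(1))
  show "Z \<in> VI_obj \<Longrightarrow> g \<in> VI_hom Y Z \<Longrightarrow> y \<in> N Y \<Longrightarrow> Act M Y Z g y \<in> N Z"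
    using assms by (simp add: VI_submodule_def)
qed

lemma VI_submodule_whole: "VI_submodule (\<lambda>X. carrier (Ob M X)) M"
  unfolding VI_submodule_def
  using Act_linear(1) module.carrier_is_submodule[OF kmodule_Ob] by blast

lemma mem_VI_generated:
  "y \<in> VI_generated M S X \<longleftrightarrow> (\<forall>N. VI_submodule N M \<longrightarrow> (\<forall>(Y, z)\<in>S. z \<in> N Y) \<longrightarrow> y \<in> N X)"
  unfolding VI_generated_def by blast

lemma VI_generated_superset: "(Y, y) \<in> S \<Longrightarrow> y \<in> VI_generated M S Y"
  unfolding VI_generated_def by blast

lemma VI_generated_minimal:
  "VI_submodule N M \<Longrightarrow> (\<And>Y y. (Y, y) \<in> S \<Longrightarrow> y \<in> N Y) \<Longrightarrow> VI_generated M S X \<subseteq> N X"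
  unfolding VI_generated_def by blast

lemma VI_generated_submodule:
  assumes "\<And>Y y. (Y, y) \<in> S \<Longrightarrow> y \<in> carrier (Ob M Y)"
  shows "VI_submodule (VI_generated M S) M"
  unfolding VI_submodule_def
proof (intro conjI ballI)
  fix X :: "'f fvec set" assume X: "X \<in> VI_obj"
  interpret kmod "Ob M X" by (rule kmod_Ob[OF X])
  show "ksubmodule (VI_generated M S X) (Ob M X)"
  proof (rule k_submoduleI)
    show "VI_generated M S X \<subseteq> carrier (Ob M X)"
      by (rule VI_generated_minimal[OF VI_submodule_whole assms])
  qed (use k_submodule(2-4)[OF VI_submoduleD(1)[OF _ X]] in \<open>unfold mem_VI_generated, blast+\<close>)
next
  fix X Y :: "'f fvec set" and g x
  assume "X \<in> VI_obj" "Y \<in> VI_obj" "g \<in> VI_hom X Y" "x \<in> VI_generated M S X"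
  then show "Act M X Y g x \<in> VI_generated M S Y"
    unfolding mem_VI_generated using VI_submoduleD(3) by blast
qed

end

text \<open>Once the functionals are aligned, \<open>VI_hom_extend\<close> carries one independent
  frame to the other, and by \<open>G_Act\<close> the given element goes to the wanted one. With dim
  Z = n + |V| for the generators of M_n, the dimension hypothesis becomes the bound of the
  theorem.\<close>

lemma (in vi_elt) contains_type_generated:
  assumes N: "VI_submodule N M" and Z: "Z \<in> VI_obj" and Y: "Y \<in> VI_obj"
    and g: "indep_data Z d gs ps" and GN: "G Z gs ps \<in> N Z" and le: "fvs.dim Z \<le> fvs.dim Y"
  shows "contains_type M d x Y (N Y) (image_mset fst (mset ps))"
  unfolding contains_type_def
proof (intro allI impI)
  fix gs' ps' assume g': "indep_data Y d gs' ps'" and t: "image_mset fst (mset ps') = image_mset fst (mset ps)"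
  obtain qs where qs: "mset qs = mset ps'" "map fst qs = map fst ps"
    using mset_map_fst_exists[of ps' "map fst ps"] t by auto
  have gq: "indep_data Y d gs' qs" by (rule indep_data_mset[OF g' qs(1)])
  have len: "length qs = length ps" using qs(2) by (metis length_map)
  obtain h where h: "h \<in> VI_hom Z Y"
    "\<And>i. i < length (data_frame d gs ps) \<Longrightarrow> h (data_frame d gs ps ! i) = data_frame d gs' qs ! i"
    by (rule VI_hom_extend[OF Z Y, of "data_frame d gs ps" "data_frame d gs' qs"])
      (use g gq le len in \<open>auto simp: indep_data_def length_data_frame\<close>)
  have h1: "h (gs i) = gs' i" if "i < d" for i
    using h(2)[of i] that by (simp add: data_frame_def nth_append)
  have h2: "h (snd (ps ! i)) = snd (qs ! i)" if "i < length ps" for i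
    using h(2)[of "d + i"] that len by (simp add: data_frame_def nth_append)
  have f: "fst (ps ! i) = fst (qs ! i)" if "i < length ps" for i
    using arg_cong[OF qs(2), of "\<lambda>l. l ! i"] that len by simp
  have "map (apsnd h) ps = qs"
    by (rule nth_equalityI) (simp_all add: len prod_eq_iff h2 f)
  then have "Act M Z Y h (G Z gs ps) = G Y (h \<circ> gs) qs" using G_Act[OF Z Y h(1) g] by simp
  also have "\<dots> = G Y gs' qs" by (rule diff_elt_cong) (simp add: h1)
  also have "\<dots> = G Y gs' ps'" by (rule G_mset[OF Y gq qs(1)])
  finally show "G Y gs' ps' \<in> N Y" using VI_submoduleD(3)[OF N Z Y h(1) GN] by simp
qed

section \<open>Equality of submodules up to torsion\<close>

context vi_mod
begin

lemma vi_mod_VI_sub: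
  assumes "VI_submodule N M" shows "vi_mod (VI_sub M N)"
proof
  show "VI_module (VI_sub M N)"
    unfolding VI_module_def VI_sub_def
  proof (simp only: vimod.simps, intro conjI ballI)
    fix X :: "'f fvec set" assume X: "X \<in> VI_obj"
    show "kmodule ((Ob M X)\<lparr>carrier := N X\<rparr>)"
      by (rule submodule.submodule_is_module[OF VI_submoduleD(1)[OF assms X] kmodule_Ob[OF X]])
  next
    fix X Y :: "'f fvec set" and g
    assume XY: "X \<in> VI_obj" "Y \<in> VI_obj" "g \<in> VI_hom X Y"
    note l = Act_linear[OF XY XY(1,2)]
    show "Act M X Y g \<in> klinear ((Ob M X)\<lparr>carrier := N X\<rparr>) ((Ob M Y)\<lparr>carrier := N Y\<rparr>)"
      using VI_submoduleD(2)[OF assms XY(1)] VI_submoduleD(3)[OF assms XY(1,2,3)] l(2,3)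
      unfolding klinear_def by (auto simp: subset_iff)
  next
    fix X :: "'f fvec set" and y
    assume "X \<in> VI_obj" "y \<in> carrier ((Ob M X)\<lparr>carrier := N X\<rparr>)"
    then show "Act M X X (restrict id X) y = y"
      using Act_id[of X y] VI_submoduleD(2)[OF assms] by auto
  next
    fix X Y Z :: "'f fvec set" and g h y
    assume "X \<in> VI_obj" "Y \<in> VI_obj" "Z \<in> VI_obj" "g \<in> VI_hom X Y" "h \<in> VI_hom Y Z"
      "y \<in> carrier ((Ob M X)\<lparr>carrier := N X\<rparr>)"
    then show "Act M X Z (compose X h g) y = Act M Y Z h (Act M X Y g y)"
      using Act_compose[of X Y Z g h y] VI_submoduleD(2)[OF assms] by auto
  qed
qed

lemma VI_submodule_VI_sub:
  assumes A: "VI_submodule A M" and C: "VI_submodule C M" and CA: "\<And>X. X \<in> VI_obj \<Longrightarrow> C X \<subseteq> A X"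
  shows "VI_submodule C (VI_sub M A)"
  unfolding VI_submodule_def VI_sub_def
proof (simp only: vimod.simps, intro conjI ballI)
  fix X :: "'f fvec set" assume X: "X \<in> VI_obj"
  interpret M: kmod "Ob M X" by (rule kmod_Ob[OF X])
  interpret A: kmod "(Ob M X)\<lparr>carrier := A X\<rparr>"
    using vi_mod.kmod_Ob[OF vi_mod_VI_sub[OF A] X] by (simp add: VI_sub_def)
  show "ksubmodule (C X) ((Ob M X)\<lparr>carrier := A X\<rparr>)"
    by (rule A.k_submoduleI) (use CA[OF X] M.k_submodule[OF VI_submoduleD(1)[OF C X]] in auto)
qed (use VI_submoduleD(3)[OF C] in auto)

lemma VI_submodule_zero: "VI_submodule (\<lambda>X. {\<zero>\<^bsub>Ob M X\<^esub>}) M"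
  unfolding VI_submodule_def
proof (intro conjI ballI)
  fix X :: "'f fvec set" assume X: "X \<in> VI_obj"
  interpret kmod "Ob M X" by (rule kmod_Ob[OF X])
  show "ksubmodule {\<zero>\<^bsub>Ob M X\<^esub>} (Ob M X)"
    using smult_r_null by (intro k_submoduleI) auto
next
  fix X Y :: "'f fvec set" and g x
  assume XY: "X \<in> VI_obj" "Y \<in> VI_obj" "g \<in> VI_hom X Y" "x \<in> {\<zero>\<^bsub>Ob M X\<^esub>}"
  then show "Act M X Y g x \<in> {\<zero>\<^bsub>Ob M Y\<^esub>}"
    using Act_linear(4)[OF XY(1,2,3,1,2)] by simp
qed

lemma VI_torsion_zero: "VI_torsion (VI_sub M (\<lambda>X. {\<zero>\<^bsub>Ob M X\<^esub>}))"
  unfolding VI_torsion_def VI_sub_def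
proof (simp only: vimod.simps, intro ballI)
  fix X :: "'f fvec set" and x assume X: "X \<in> VI_obj" "x \<in> carrier ((Ob M X)\<lparr>carrier := {\<zero>\<^bsub>Ob M X\<^esub>}\<rparr>)"
  interpret kmod "Ob M X" by (rule kmod_Ob[OF X(1)])
  have "Act M X X (restrict id X) x = \<zero>\<^bsub>Ob M X\<^esub>"
    using Act_id[OF X(1), of x] X(2) by simp
  then show "\<exists>Y\<in>VI_obj. \<exists>g\<in>VI_hom X Y. Act M X Y g x = \<zero>\<^bsub>(Ob M Y)\<lparr>carrier := {\<zero>\<^bsub>Ob M Y\<^esub>}\<rparr>\<^esub>"
    using X(1) VI_hom_id[OF X(1)] by auto
qed

lemma VI_torsion_quot:
  assumes C: "VI_submodule C M"
    and tors: "\<And>X x. X \<in> VI_obj \<Longrightarrow> x \<in> carrier (Ob M X) \<Longrightarrow> \<exists>Y\<in>VI_obj. \<exists>g\<in>VI_hom X Y. Act M X Y g x \<in> C Y"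
  shows "VI_torsion (VI_quot M C)"
  unfolding VI_torsion_def VI_quot_def
proof (simp only: vimod.simps, intro ballI)
  fix X :: "'f fvec set" and S assume X: "X \<in> VI_obj" and "S \<in> carrier (quot_module (Ob M X) (C X))"
  then obtain x where x: "x \<in> carrier (Ob M X)" "S = C X +>\<^bsub>Ob M X\<^esub> x"
    by (auto simp: kmod.carrier_quot_module[OF kmod_Ob])
  obtain Y g where Y: "Y \<in> VI_obj" "g \<in> VI_hom X Y" "Act M X Y g x \<in> C Y" using tors[OF X x(1)] by blast
  interpret Y: kmod "Ob M Y" by (rule kmod_Ob[OF Y(1)])
  note C' = VI_submoduleD(1)[OF C X] VI_submoduleD(1)[OF C Y(1)]
  have gc: "Act M X Y g x \<in> carrier (Ob M Y)" by (rule Act_linear(1)[OF X Y(1,2) X Y(1) x(1)])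
  have "(\<Union>y\<in>S. C Y +>\<^bsub>Ob M Y\<^esub> Act M X Y g y) = C Y +>\<^bsub>Ob M Y\<^esub> Act M X Y g x"
    unfolding x(2)
    by (rule quot_module_map(1)[OF kmod_Ob[OF X] kmod_Ob[OF Y(1)] C' Act_klinear[OF X Y(1,2)] _ x(1)])
      (rule VI_submoduleD(3)[OF C X Y(1,2)])
  also have "\<dots> = C Y +>\<^bsub>Ob M Y\<^esub> \<zero>\<^bsub>Ob M Y\<^esub>"
    using Y.coset_eq_iff[OF C'(2) gc Y.M.zero_closed]
      Y.k_submodule(6)[OF C'(2) Y(3) Y.k_submodule(2)[OF C'(2)]] by simp
  also have "\<dots> = \<zero>\<^bsub>quot_module (Ob M Y) (C Y)\<^esub>" using Y.quot_module_simps(1)[OF C'(2)] by simp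
  finally show "\<exists>Y\<in>VI_obj. \<exists>g\<in>VI_hom X Y. (\<Union>y\<in>S. C Y +>\<^bsub>Ob M Y\<^esub> Act M X Y g y) = \<zero>\<^bsub>quot_module (Ob M Y) (C Y)\<^esub>"
    using Y(1,2) by blast
qed

lemma VI_sub_simps:
  "Ob (VI_sub M N) X = (Ob M X)\<lparr>carrier := N X\<rparr>" "Act (VI_sub M N) = Act M"
  "carrier (Ob (VI_sub M N) X) = N X" "\<zero>\<^bsub>Ob (VI_sub M N) X\<^esub> = \<zero>\<^bsub>Ob M X\<^esub>"
  by (simp_all add: VI_sub_def)

text \<open>The factorization is the fraction defined on the common submodule \<open>C\<close>, with
  zero subobject of the target, sending \<open>a\<close> to its coset \<open>{a}\<close>. The domain
  is allowed because A/C is torsion.\<close>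

lemma gen_factorsI:
  assumes A: "VI_submodule A M" and B: "VI_submodule B M" and C: "VI_submodule C M"
    and CA: "\<And>X. X \<in> VI_obj \<Longrightarrow> C X \<subseteq> A X" and CB: "\<And>X. X \<in> VI_obj \<Longrightarrow> C X \<subseteq> B X"
    and tors: "\<And>X x. X \<in> VI_obj \<Longrightarrow> x \<in> A X \<Longrightarrow> \<exists>Y\<in>VI_obj. \<exists>g\<in>VI_hom X Y. Act M X Y g x \<in> C Y"
  shows "gen_factors M A B"
proof -
  interpret A: vi_mod "VI_sub M A" by (rule vi_mod_VI_sub[OF A])
  interpret B: vi_mod "VI_sub M B" by (rule vi_mod_VI_sub[OF B])
  let ?O = "\<lambda>X. {\<zero>\<^bsub>Ob M X\<^esub>}"
  let ?\<phi> = "\<lambda>X a. {\<zero>\<^bsub>Ob M X\<^esub>} +>\<^bsub>Ob M X\<^esub> a"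
  have phi: "?\<phi> X a = {a}" if "X \<in> VI_obj" "a \<in> carrier (Ob M X)" for X a
  proof -
    interpret kmod "Ob M X" by (rule kmod_Ob[OF that(1)])
    show ?thesis using that(2) by (simp add: a_r_coset_def')
  qed
  have CM: "a \<in> carrier (Ob M X)" if "X \<in> VI_obj" "a \<in> C X" for X a
    using VI_submoduleD(2)[OF C that(1)] that(2) by auto
  have CVA: "VI_submodule C (VI_sub M A)" by (rule VI_submodule_VI_sub[OF A C CA])
  have torsA: "VI_torsion (VI_quot (VI_sub M A) C)"
    by (rule A.VI_torsion_quot[OF CVA]) (simp add: VI_sub_simps tors)
  have OB: "VI_submodule ?O (VI_sub M B)" "VI_torsion (VI_sub (VI_sub M B) ?O)"
    using B.VI_submodule_zero B.VI_torsion_zero by (simp_all add: VI_sub_simps)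
  have adm: "admissible (VI_sub M A) (VI_sub M B) C ?O"
    using CVA torsA OB by (simp add: admissible_def)
  have adm': "admissible (VI_sub M A) M C ?O"
    using CVA torsA VI_submodule_zero VI_torsion_zero by (simp add: admissible_def)
  have trans: "VI_trans (VI_sub (VI_sub M A) C) (VI_quot (VI_sub M B) ?O) ?\<phi>"
    unfolding VI_trans_def
  proof (intro conjI ballI)
    fix X :: "'f fvec set" assume X: "X \<in> VI_obj"
    interpret BX: kmod "Ob (VI_sub M B) X" by (rule B.kmod_Ob[OF X])
    note q = BX.carrier_quot_module BX.quot_module_simps[OF B.VI_submoduleD(1)[OF OB(1) X]]
    have r: "?O X +>\<^bsub>Ob (VI_sub M B) X\<^esub> a = ?\<phi> X a" for a
      by (simp add: a_r_coset_def' VI_sub_simps)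
    have cl: "C X \<subseteq> B X" by (rule CB[OF X])
    show "?\<phi> X \<in> klinear (Ob (VI_sub (VI_sub M A) C) X) (Ob (VI_quot (VI_sub M B) ?O) X)"
      unfolding klinear_def VI_quot_def vimod.simps
    proof (intro CollectI conjI Pi_I ballI allI)
      fix a assume "a \<in> carrier (Ob (VI_sub (VI_sub M A) C) X)"
      then have "a \<in> carrier (Ob (VI_sub M B) X)" using cl by (auto simp: VI_sub_def)
      then show "?\<phi> X a \<in> carrier (quot_module (Ob (VI_sub M B) X) (?O X))"
        unfolding q(1) r[symmetric] by blast
    next
      fix a b assume "a \<in> carrier (Ob (VI_sub (VI_sub M A) C) X)" "b \<in> carrier (Ob (VI_sub (VI_sub M A) C) X)"
      then have "a \<in> carrier (Ob (VI_sub M B) X)" "b \<in> carrier (Ob (VI_sub M B) X)"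
        using cl by (auto simp: VI_sub_def)
      from q(3)[OF this] show "?\<phi> X (a \<oplus>\<^bsub>Ob (VI_sub (VI_sub M A) C) X\<^esub> b) =
          ?\<phi> X a \<oplus>\<^bsub>quot_module (Ob (VI_sub M B) X) (?O X)\<^esub> ?\<phi> X b"
        unfolding r by (simp add: VI_sub_def)
    next
      fix c a assume "a \<in> carrier (Ob (VI_sub (VI_sub M A) C) X)"
      then have "a \<in> carrier (Ob (VI_sub M B) X)" using cl by (auto simp: VI_sub_def)
      from q(4)[OF this] show "?\<phi> X (c \<odot>\<^bsub>Ob (VI_sub (VI_sub M A) C) X\<^esub> a) =
          c \<odot>\<^bsub>quot_module (Ob (VI_sub M B) X) (?O X)\<^esub> ?\<phi> X a"
        unfolding r by (simp add: VI_sub_def)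
    qed
  next
    fix X Y :: "'f fvec set" and g x
    assume XY: "X \<in> VI_obj" "Y \<in> VI_obj" "g \<in> VI_hom X Y" and "x \<in> carrier (Ob (VI_sub (VI_sub M A) C) X)"
    then have x: "x \<in> C X" by (simp add: VI_sub_def)
    have r: "S +>\<^bsub>Ob (VI_sub M B) X\<^esub> a = S +>\<^bsub>Ob M X\<^esub> a" for X S a
      by (simp add: a_r_coset_def' VI_sub_simps)
    show "?\<phi> Y (Act (VI_sub (VI_sub M A) C) X Y g x) = Act (VI_quot (VI_sub M B) ?O) X Y g (?\<phi> X x)"
      unfolding VI_quot_def vimod.simps r phi[OF XY(1) CM[OF XY(1) x]] by (simp add: VI_sub_def)
  qed
  have "gen_hom (VI_sub M A) (VI_sub M B) (C, ?O, ?\<phi>)" using adm trans by simp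
  moreover have "gen_hom_eq (VI_sub M A) M (gen_comp (gen_incl M B) (C, ?O, ?\<phi>)) (gen_incl M A)"
  proof -
    have B0: "\<zero>\<^bsub>Ob M X\<^esub> \<in> B X" if "X \<in> VI_obj" for X
      using kmod.k_submodule(2)[OF kmod_Ob[OF that] VI_submoduleD(1)[OF B that]] .
    \<comment> \<open>The two fractions are compared on \<open>C\<close> modulo the zero submodule,
      where both send \<open>a\<close> to \<open>{a}\<close>.\<close>
    have "C X \<subseteq> {a \<in> C X. ?\<phi> X a \<inter> B X \<noteq> {}} \<inter> A X \<and>
          (\<Union>b\<in>B X \<inter> ?O X. ?\<phi> X b) \<union> ?O X \<subseteq> ?O X \<and>
          (\<forall>a\<in>C X. ?O X <+>\<^bsub>Ob M X\<^esub> (\<Union>b\<in>?\<phi> X a \<inter> B X. ?\<phi> X b) = ?O X <+>\<^bsub>Ob M X\<^esub> ?\<phi> X a)"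
      if X: "X \<in> VI_obj" for X
    proof -
      interpret kmod "Ob M X" by (rule kmod_Ob[OF X])
      have p0: "?\<phi> X \<zero>\<^bsub>Ob M X\<^esub> = ?O X" using phi[OF X] by simp
      have pC: "?\<phi> X a = {a}" if "a \<in> C X" for a using phi[OF X CM[OF X that]] .
      have "?\<phi> X a \<inter> B X = {a}" if "a \<in> C X" for a using pC[OF that] CB[OF X] that by auto
      then have "(\<Union>b\<in>?\<phi> X a \<inter> B X. ?\<phi> X b) = ?\<phi> X a" if "a \<in> C X" for a using pC that by simp
      moreover have "(\<Union>b\<in>B X \<inter> ?O X. ?\<phi> X b) \<subseteq> ?O X" using p0 by auto
      moreover have "C X \<subseteq> {a \<in> C X. ?\<phi> X a \<inter> B X \<noteq> {}} \<inter> A X" using pC CB[OF X] CA[OF X] by auto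
      ultimately show ?thesis by simp
    qed
    then show ?thesis unfolding gen_incl_def gen_comp.simps gen_hom_eq.simps using adm' by blast
  qed
  ultimately show ?thesis unfolding gen_factors_def by blast
qed

end

section \<open>Counting the triples\<close>

definition type_mset :: "nat \<Rightarrow> nat \<Rightarrow> 'f::field fvec multiset" where
  "type_mset d n = image_mset (vtype d) (mset_set (std_V d n))"

lemma is_complement_decompose:
  assumes "is_complement W U C" "x \<in> W"
  obtains u c where "u \<in> U" "c \<in> C" "x = u + c"
proof -
  have "W = {u + c |u c. u \<in> U \<and> c \<in> C}" using assms(1) unfolding is_complement_def by (elim conjE)
  then have "x \<in> {u + c |u c. u \<in> U \<and> c \<in> C}" by (rule subst) (rule assms(2))
  then show ?thesis using that by blast
qed

text \<open>The set in braces is \<open>C\<close> plus the line of the new coordinate vector: from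
  \<open>x\<close> its last coordinate is split off and the rest must lie in
  \<open>C\<close>.\<close>

lemma complement_extend:
  assumes dn: "d \<le> n" and C: "is_complement (std_space n) (std_space d) C"
  shows "is_complement (std_space (Suc n)) (std_space d)
    {x \<in> std_space (Suc n). x - fscale (x n) (std_vec n) \<in> C}" (is "is_complement _ _ ?C")
proof -
  have sub: "fvs.subspace C" "C \<subseteq> std_space n" and int: "std_space d \<inter> C = {0}"
    using C by (auto simp: is_complement_def)
  have mono: "std_space d \<subseteq> (std_space (Suc n) :: 'a fvec set)" using dn by (auto simp: std_space_def)
  have S: "fvs.subspace (std_space (Suc n) :: 'a fvec set)" by (rule std_space_subspace)
  have C0: "0 \<in> C" by (rule fvs.subspace_0[OF sub(1)])
  have z0: "0 \<in> (std_space m :: 'a fvec set)" for m by (simp add: std_space_def)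
  have vn: "std_vec n \<in> (std_space (Suc n) :: 'a fvec set)" by (simp add: std_vec_in)
  have "fvs.subspace ?C" unfolding fvs.subspace_def
  proof (intro conjI ballI allI)
    show "0 \<in> ?C" using C0 z0 by simp
  next
    fix x y assume "x \<in> ?C" "y \<in> ?C"
    then have xy: "x \<in> std_space (Suc n)" "y \<in> std_space (Suc n)"
      "x - fscale (x n) (std_vec n) \<in> C" "y - fscale (y n) (std_vec n) \<in> C" by auto
    have "x + y - fscale ((x + y) n) (std_vec n) = (x - fscale (x n) (std_vec n)) + (y - fscale (y n) (std_vec n))"
      by (simp add: fvs.scale_left_distrib)
    then have "x + y - fscale ((x + y) n) (std_vec n) \<in> C" using fvs.subspace_add[OF sub(1) xy(3,4)] by (simp only:)
    then show "x + y \<in> ?C" using fvs.subspace_add[OF S xy(1,2)] by simp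
  next
    fix c x assume "x \<in> ?C"
    then have x: "x \<in> std_space (Suc n)" "x - fscale (x n) (std_vec n) \<in> C" by auto
    have "fscale c x - fscale (fscale c x n) (std_vec n) = fscale c (x - fscale (x n) (std_vec n))"
    proof -
      have "fscale c x n = c * x n" by (simp add: fscale_def)
      then show ?thesis by (simp add: fvs.scale_right_diff_distrib)
    qed
    then have "fscale c x - fscale (fscale c x n) (std_vec n) \<in> C" using fvs.subspace_scale[OF sub(1) x(2)] by simp
    then show "fscale c x \<in> ?C" using fvs.subspace_scale[OF S x(1)] by simp
  qed
  moreover have "std_space d \<inter> ?C = {0}"
  proof
    show "std_space d \<inter> ?C \<subseteq> {0}"
    proof
      fix x assume x: "x \<in> std_space d \<inter> ?C"
      then have "x n = 0" using dn by (simp add: std_space_def)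
      then have "x \<in> std_space d \<inter> C" using x by simp
      then show "x \<in> {0}" using int by simp
    qed
    show "{0} \<subseteq> std_space d \<inter> ?C" using C0 z0 by simp
  qed
  moreover have "std_space (Suc n) = {u + c |u c. u \<in> std_space d \<and> c \<in> ?C}"
  proof
    show "{u + c |u c. u \<in> std_space d \<and> c \<in> ?C} \<subseteq> std_space (Suc n)"
      using mono fvs.subspace_add[OF S] by blast
    show "std_space (Suc n) \<subseteq> {u + c |u c. u \<in> std_space d \<and> c \<in> ?C}"
    proof
      fix x :: "'a fvec" assume x: "x \<in> std_space (Suc n)"
      have "x - fscale (x n) (std_vec n) \<in> std_space n"
      proof -
        have "(x - fscale (x n) (std_vec n)) i = 0" if "n \<le> i" for i
        proof (cases "i = n")
          case False
          then have "Suc n \<le> i" using that by simp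
          then show ?thesis using x False by (simp add: fscale_def std_vec_def std_space_def)
        qed (simp add: fscale_def std_vec_def)
        then show ?thesis unfolding std_space_def by blast
      qed
      then obtain u c where uc: "u \<in> std_space d" "c \<in> C" "x - fscale (x n) (std_vec n) = u + c"
        by (rule is_complement_decompose[OF C])
      define c' where "c' = c + fscale (x n) (std_vec n)"
      have cn: "c n = 0" using uc(2) sub(2) by (auto simp: std_space_def)
      have "c \<in> std_space (Suc n)" using uc(2) sub(2) by (auto simp: std_space_def)
      then have "c' \<in> std_space (Suc n)"
        unfolding c'_def by (intro fvs.subspace_add[OF S] fvs.subspace_scale[OF S] vn)
      moreover have "c' n = x n" using cn by (simp add: c'_def fscale_def std_vec_def)
      ultimately have "c' \<in> ?C" using uc(2) by (simp add: c'_def)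
      moreover have "x = u + c'" using uc(3) by (simp add: c'_def algebra_simps)
      ultimately show "x \<in> {u + c |u c. u \<in> std_space d \<and> c \<in> ?C}" using uc(1) by blast
    qed
  qed
  ultimately show ?thesis by (auto simp: is_complement_def)
qed

text \<open>Enlarging C' by the line of the new coordinate vector embeds V over F^n into V over
  F^(n+1); C' is recovered as the intersection with F^n. The functional does not involve C', so it
  is preserved.\<close>

lemma type_mset_Suc:
  assumes "d \<le> n" "finite (std_V d n :: 'f::field triple set)" "finite (std_V d (Suc n) :: 'f triple set)"
  shows "(type_mset d n :: 'f fvec multiset) \<subseteq># type_mset d (Suc n)"
proof -
  define E where "E C = {x \<in> std_space (Suc n). x - fscale (x n) (std_vec n) \<in> C}" for C :: "'f fvec set"
  define e where "e v = (fst v, fst (snd v), E (snd (snd v)))" for v :: "'f triple"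
  let ?A = "std_V d n :: 'f triple set"
  have e_in: "e ` ?A \<subseteq> std_V d (Suc n)"
  proof
    fix w assume "w \<in> e ` ?A"
    then obtain a C C' where v: "(a, C, C') \<in> ?A" "w = (a, C, E C')" by (auto simp: e_def)
    then show "w \<in> std_V d (Suc n)"
      using complement_extend[OF assms(1), of C'] unfolding v(2) mem_std_V E_def by blast
  qed
  have EC: "E C \<inter> std_space n = C" if "is_complement (std_space n) (std_space d) C" for C
  proof -
    have "C \<subseteq> std_space n" using that unfolding is_complement_def by blast
    then show ?thesis by (auto simp: E_def std_space_def)
  qed
  have inj: "inj_on e ?A"
  proof (rule inj_onI)
    fix v w assume vw: "v \<in> ?A" "w \<in> ?A" "e v = e w"
    obtain a C C' where v: "v = (a, C, C')" by (cases v) auto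
    obtain b D D' where w: "w = (b, D, D')" by (cases w) auto
    have cd: "is_complement (std_space n) (std_space d) C'" "is_complement (std_space n) (std_space d) D'"
      using vw(1,2) unfolding v w mem_std_V by auto
    have "E C' = E D'" using vw(3) by (simp add: e_def v w)
    then have "E C' \<inter> std_space n = E D' \<inter> std_space n" by (rule arg_cong)
    then have "C' = D'" unfolding EC[OF cd(1)] EC[OF cd(2)] .
    then show "v = w" using vw(3) by (simp add: e_def v w)
  qed
  have t: "vtype d (e v) = vtype d v" for v unfolding vtype_def e_def fst_conv snd_conv ..
  have "type_mset d n = image_mset (vtype d) (mset_set (e ` ?A))"
    unfolding image_mset_mset_set[OF inj, symmetric] by (simp add: type_mset_def t multiset.map_comp comp_def)
  also have "\<dots> \<subseteq># type_mset d (Suc n)"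
    unfolding type_mset_def
    by (intro image_mset_subseteq_mono subset_imp_msubset_mset_set e_in assms(3))
  finally show ?thesis .
qed

lemma type_mset_mono:
  assumes "d \<le> n" "\<And>m. d \<le> m \<Longrightarrow> finite (std_V d m :: 'f::field triple set)"
  shows "(type_mset d d :: 'f fvec multiset) \<subseteq># type_mset d n"
  using assms(1)
proof (induction n rule: dec_induct)
  case (step n)
  then show ?case using type_mset_Suc[OF step(1) assms(2) assms(2)] subset_mset.order_trans by fastforce
qed simp

text \<open>Over F^d the image is everything and \<open>{0}\<close> is a complement, so replacing C'
  by \<open>{0}\<close> gives a triple with the same functional. Hence passing from d to n changes
  multiplicities but adds no functional.\<close>

lemma set_type_mset:
  assumes "finite (std_V d d :: 'f::field triple set)" "finite (std_V d n :: 'f triple set)"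
  shows "set_mset (type_mset d n :: 'f fvec multiset) \<subseteq> set_mset (type_mset d d)"
proof
  fix c :: "'f fvec" assume "c \<in># type_mset d n"
  then obtain a C C' where v: "(a, C, C') \<in> std_V d n" "c = vtype d (a, C, C')"
    using assms(2) by (auto simp: type_mset_def)
  have "is_complement (std_space d) (std_space d) {0 :: 'f fvec}"
    by (auto simp: is_complement_def std_space_def)
  then have "(a, C, {0}) \<in> std_V d d" using v(1) by (auto simp: mem_std_V)
  moreover have "vtype d (a, C, {0}) = c" unfolding v(2) vtype_def fst_conv snd_conv ..
  ultimately show "c \<in># type_mset d d" using assms(1) by (force simp: type_mset_def)
qed

text \<open>The vectors \<open>std_vec j - w j\<close> with \<open>j\<close> in \<open>J\<close>
  span \<open>C1\<close>: for \<open>x\<close> in \<open>C1\<close>, subtracting the matching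
  combination leaves an element of both \<open>U\<close> and \<open>C1\<close>, that is 0. As these
  vectors lie in \<open>C2\<close> too, the inclusion follows.\<close>

lemma complement_subset:
  assumes C1: "is_complement (std_space m) U C1" and C2: "fvs.subspace C2" and U: "fvs.subspace U"
    and J: "\<And>j. j < m \<Longrightarrow> j \<notin> J \<Longrightarrow> std_vec j \<in> U"
    and w: "\<And>j. j < m \<Longrightarrow> j \<in> J \<Longrightarrow> w j \<in> U \<and> std_vec j - w j \<in> C1 \<and> std_vec j - w j \<in> C2"
  shows "C1 \<subseteq> C2"
proof
  fix x assume x: "x \<in> C1"
  have C1': "fvs.subspace C1" "C1 \<subseteq> std_space m" "U \<inter> C1 = {0}" using C1 by (auto simp: is_complement_def)
  define f where "f j = (if j \<in> J then std_vec j - w j else 0)" for j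
  define g where "g j = (if j \<in> J then w j else std_vec j)" for j
  define y where "y = (\<Sum>j<m. fscale (x j) (f j))"
  have "y \<in> C1" "y \<in> C2" unfolding y_def f_def
    using w C1'(1) C2 by (auto intro!: fvs.subspace_sum fvs.subspace_scale fvs.subspace_0)
  have "x = (\<Sum>j<m. fscale (x j) (std_vec j))" using x C1'(2) by (intro std_expand) auto
  also have "\<dots> = (\<Sum>j<m. fscale (x j) (f j) + fscale (x j) (g j))"
    by (rule sum.cong) (auto simp: f_def g_def simp flip: fvs.scale_right_distrib)
  also have "\<dots> = y + (\<Sum>j<m. fscale (x j) (g j))" by (simp add: y_def sum.distrib)
  finally have "x - y = (\<Sum>j<m. fscale (x j) (g j))" by (metis add_diff_cancel_left')
  also have "\<dots> \<in> U" unfolding g_def using w J U by (auto intro!: fvs.subspace_sum fvs.subspace_scale)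
  finally have "x - y \<in> U \<inter> C1" using fvs.subspace_diff[OF C1'(1) x \<open>y \<in> C1\<close>] by simp
  then have "x = y" using C1'(3) by simp
  then show "x \<in> C2" using \<open>y \<in> C2\<close> by simp
qed

text \<open>The image of \<open>std_vec j\<close> under the projection to \<open>U\<close> along \<open>C\<close>.\<close>

definition complement_code :: "'f::field fvec set \<Rightarrow> 'f fvec set \<Rightarrow> nat \<Rightarrow> 'f fvec" where
  "complement_code U C j = (SOME w. w \<in> U \<and> std_vec j - w \<in> C)"

lemma complement_code:
  assumes "is_complement (std_space m) U C" "j < m"
  shows "complement_code U C j \<in> U \<and> std_vec j - complement_code U C j \<in> C"
proof -
  have "std_vec j \<in> (std_space m :: 'a fvec set)" by (rule std_vec_in[OF assms(2)])
  then obtain u c where "u \<in> U" "c \<in> C" "std_vec j = u + c"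
    by (rule is_complement_decompose[OF assms(1)])
  then have "\<exists>w. w \<in> U \<and> std_vec j - w \<in> C" by (intro exI[of _ u]) simp
  then show ?thesis unfolding complement_code_def by (rule someI_ex)
qed

text \<open>A complement is determined by the projections of the basis vectors outside
  \<open>U\<close>. For an index in \<open>K\<close> the basis vector lies in both complements and
  has projection 0; leaving these indices out of the code is what brings the count down to the
  stated bound.\<close>

lemma complement_eqI:
  assumes C: "is_complement (std_space m) U C" and D: "is_complement (std_space m) U D"
    and U: "fvs.subspace U"
    and J: "\<And>j. j < m \<Longrightarrow> j \<notin> J \<Longrightarrow> std_vec j \<in> U"
    and K: "std_vec ` K \<subseteq> C \<inter> D"
    and eq: "\<And>j. j < m \<Longrightarrow> j \<in> J \<Longrightarrow> j \<notin> K \<Longrightarrow> complement_code U C j = complement_code U D j"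
  shows "C = D"
proof -
  define w where "w j = (if j \<in> K then 0 else complement_code U C j)" for j
  have w: "w j \<in> U \<and> std_vec j - w j \<in> C \<and> std_vec j - w j \<in> D" if "j < m" "j \<in> J" for j
  proof (cases "j \<in> K")
    case True
    then show ?thesis using K fvs.subspace_0[OF U] by (auto simp: w_def)
  next
    case False
    then show ?thesis
      using complement_code[OF C that(1)] complement_code[OF D that(1)] eq[OF that False] by (simp add: w_def)
  qed
  have sub: "fvs.subspace C" "fvs.subspace D" using C D by (auto simp: is_complement_def)
  show ?thesis
  proof
    show "C \<subseteq> D" by (rule complement_subset[OF C sub(2) U J, where w = w]) (use w in auto)
    show "D \<subseteq> C" by (rule complement_subset[OF D sub(1) U J, where w = w]) (use w in auto)
  qed
qed

lemma card_std_space: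
  "finite (std_space d :: 'f::{field,finite} fvec set) \<and> card (std_space d :: 'f fvec set) \<le> CARD('f) ^ d"
proof -
  let ?P = "PiE {..<d} (\<lambda>_. UNIV :: 'f set)"
  have inj: "inj_on (\<lambda>x. restrict x {..<d}) (std_space d :: 'f fvec set)"
  proof (rule inj_onI)
    fix x y :: "'f fvec" assume xy: "x \<in> std_space d" "y \<in> std_space d" "restrict x {..<d} = restrict y {..<d}"
    show "x = y"
    proof
      fix i show "x i = y i"
        using xy(1,2) fun_cong[OF xy(3), of i] by (cases "i < d") (auto simp: std_space_def)
    qed
  qed
  have img: "(\<lambda>x. restrict x {..<d}) ` (std_space d :: 'f fvec set) \<subseteq> ?P" by (auto split: if_splits)
  have fin: "finite ?P" by (intro finite_PiE) auto
  have "card ?P = CARD('f) ^ d" by (simp add: card_PiE)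
  then show ?thesis
    using card_inj_on_le[OF inj img fin] inj_on_finite[OF inj img fin] by simp
qed

text \<open>A triple is encoded injectively by the index i of \<alpha>, the projections to its line
  of the d - 1 - i later basis vectors, and the projections to the image of the n - d remaining
  ones. This allows at most q^(d-1-i) choices of C and (q^d)^(n-d) choices of C'; the sum over i is
  then reversed.\<close>

lemma card_std_V:
  assumes "d \<le> n"
  shows "card (std_V d n :: 'f::{field,finite} triple set) \<le> CARD('f) ^ (d * (n - d)) * (\<Sum>i<d. CARD('f) ^ i)"
proof -
  let ?q = "CARD('f)"
  define ix :: "'f fvec \<Rightarrow> nat" where "ix = the_inv std_vec"
  have ix: "ix (std_vec i) = i" for i unfolding ix_def by (rule the_inv_f_f[OF inj_std_vec])
  let ?L = "\<lambda>i. fvs.span {std_vec i :: 'f fvec}"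
  let ?W = "std_space d :: 'f fvec set"
  define code :: "'f triple \<Rightarrow> nat \<times> (nat \<Rightarrow> 'f fvec) \<times> (nat \<Rightarrow> 'f fvec)" where
    "code v = (case v of (a, C, C') \<Rightarrow> (ix a, restrict (complement_code (?L (ix a)) C) {ix a<..<d},
        restrict (complement_code ?W C') {d..<n}))" for v
  define T where "T = Sigma {..<d} (\<lambda>i. PiE {i<..<d} (\<lambda>_. ?L i) \<times> PiE {d..<n} (\<lambda>_. ?W))"
  have inj: "inj_on code (std_V d n)"
  proof (rule inj_onI)
    fix v w :: "'f triple" assume vw: "v \<in> std_V d n" "w \<in> std_V d n" "code v = code w"
    obtain a C C' where v: "v = (a, C, C')" by (cases v) auto
    obtain b D D' where w: "w = (b, D, D')" by (cases w) auto
    obtain i where i: "i < d" "a = std_vec i" "is_complement ?W (?L i) C" "std_vec ` {..<i} \<subseteq> C"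
      "is_complement (std_space n) ?W C'" using vw(1) unfolding v mem_std_V by blast
    obtain j where j: "j < d" "b = std_vec j" "is_complement ?W (?L j) D" "std_vec ` {..<j} \<subseteq> D"
      "is_complement (std_space n) ?W D'" using vw(2) unfolding w mem_std_V by blast
    have ij: "i = j" using vw(3) by (simp add: code_def v w i(2) j(2) ix)
    have r1: "restrict (complement_code (?L i) C) {i<..<d} = restrict (complement_code (?L i) D) {i<..<d}"
      and r2: "restrict (complement_code ?W C') {d..<n} = restrict (complement_code ?W D') {d..<n}"
      using vw(3) by (simp_all add: code_def v w i(2) j(2) ix flip: ij)
    \<comment> \<open>The i-th basis vector spans the line and the earlier ones lie in both
      complements, so only the codes at indices above i have to agree.\<close>
    have "C = D"
    proof (rule complement_eqI[OF i(3) j(3)[folded ij], where J = "- {i}" and K = "{..<i}"])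
      fix k assume "k < d" "k \<in> - {i}" "k \<notin> {..<i}"
      then show "complement_code (?L i) C k = complement_code (?L i) D k"
        using fun_cong[OF r1, of k] by simp
    qed (use i(4) j(4) ij in \<open>auto intro: fvs.span_base\<close>)
    moreover have "C' = D'"
    proof (rule complement_eqI[OF i(5) j(5), where J = "{d..}" and K = "{}"])
      fix k assume "k < n" "k \<in> {d..}"
      then show "complement_code ?W C' k = complement_code ?W D' k"
        using fun_cong[OF r2, of k] by simp
    qed (auto simp: std_space_subspace std_vec_in)
    ultimately show "v = w" using v w i(2) j(2) ij by simp
  qed
  have img: "code ` std_V d n \<subseteq> T"
  proof
    fix y assume "y \<in> code ` std_V d n"
    then obtain a C C' where v: "(a, C, C') \<in> std_V d n" "y = code (a, C, C')" by auto
    obtain i where i: "i < d" "a = std_vec i" "is_complement ?W (?L i) C"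
      "is_complement (std_space n) ?W C'" using v(1) unfolding mem_std_V by blast
    show "y \<in> T"
      using complement_code[OF i(3)] complement_code[OF i(4)] i(1)
      by (auto simp: v(2) code_def T_def i(2) ix)
  qed
  have finW: "finite ?W" and cW: "card ?W \<le> ?q ^ d" using card_std_space by blast+
  have L: "?L i = range (\<lambda>k. fscale k (std_vec i))" for i by (rule fvs.span_singleton)
  have finL: "finite (?L i)" and cL: "card (?L i) \<le> ?q" for i
    unfolding L using card_image_le[of "UNIV :: 'f set"] by auto
  have finT: "finite T" unfolding T_def by (intro finite_SigmaI finite_cartesian_product finite_PiE finL finW) auto
  have "card T = (\<Sum>i<d. card (PiE {i<..<d} (\<lambda>_. ?L i)) * card (PiE {d..<n} (\<lambda>_. ?W)))"
    unfolding T_def using finL finW by (subst card_SigmaI) (auto simp: card_cartesian_product intro!: finite_PiE)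
  also have "\<dots> = (\<Sum>i<d. card (?L i) ^ (d - Suc i) * card ?W ^ (n - d))"
    by (simp add: card_PiE)
  also have "\<dots> \<le> (\<Sum>i<d. ?q ^ (d - Suc i) * (?q ^ d) ^ (n - d))"
    by (intro sum_mono mult_mono power_mono cL cW) auto
  also have "\<dots> = (\<Sum>i<d. ?q ^ (d - Suc i)) * ?q ^ (d * (n - d))"
    by (simp add: sum_distrib_right power_mult)
  also have "(\<Sum>i<d. ?q ^ (d - Suc i)) = (\<Sum>i<d. ?q ^ i)" by (rule sum.nat_diff_reindex)
  finally have "card T \<le> ?q ^ (d * (n - d)) * (\<Sum>i<d. ?q ^ i)" by (simp add: mult.commute)
  then show ?thesis using card_inj_on_le[OF inj img finT] by simp
qed

section \<open>The chain of submodules\<close>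

locale VI_chain = gl_rep d \<Theta> \<rho>
  for d and \<Theta> :: "('k::field, 'v) module" and \<rho> :: "('f::{field,finite} fvec \<Rightarrow> 'f fvec) \<Rightarrow> 'v \<Rightarrow> 'v" +
  fixes vs :: "nat \<Rightarrow> 'f triple list"
  assumes q_inv: "of_nat CARD('f) \<noteq> (0 :: 'k)"
    and orders: "\<And>n. d \<le> n \<Longrightarrow> distinct (vs n) \<and> set (vs n) = std_V d n"
begin

abbreviation "I \<equiv> Ind d \<Theta> \<rho>"
abbreviation "Ms n \<equiv> M_sub d \<Theta> \<rho> n (vs n)"
abbreviation "Zs n \<equiv> XE (std_space n) (vs n) :: 'f fvec set"
abbreviation "gen_list n \<equiv> rev (map (V_order.triple_data d (vs n)) (vs n))"

text \<open>Every [g] (x) theta is the image of [id] (x) theta under g, so these elements over F^d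
  are the ones to which the arguments on \<open>diff_elt\<close> apply.\<close>

definition unit_elt :: "'v \<Rightarrow> ('f, 'k, 'v) ind_elt" where
  "unit_elt \<theta> = ind_tensor d \<Theta> \<rho> D (restrict id D) \<theta>"

lemma V_order: "d \<le> n \<Longrightarrow> V_order d n (vs n)"
  using orders by (simp add: V_order_def)

sublocale I: vi_mod I
  by unfold_locales (rule VI_module_Ind)

lemma unit_elt_closed: "\<theta> \<in> carrier \<Theta> \<Longrightarrow> unit_elt \<theta> \<in> carrier (Ob I D)"
  unfolding unit_elt_def by (rule ind_tensor_closed[OF VI_hom_id[OF std_space_VI_obj]])

lemma vi_elt: "\<theta> \<in> carrier \<Theta> \<Longrightarrow> vi_elt I d (unit_elt \<theta>)"
  by unfold_locales (rule unit_elt_closed)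

lemma indep_data_gen: "d \<le> n \<Longrightarrow> indep_data (Zs n) d std_frame (gen_list n)"
  using indep_data_mset[OF V_order.indep_data_std[OF V_order]] by simp

lemma types_gen:
  assumes "d \<le> n" shows "image_mset fst (mset (gen_list n)) = type_mset d n"
proof -
  interpret V_order d n "vs n" by (rule V_order[OF assms])
  have "mset (vs n) = mset_set (std_V d n)"
    using orders[OF assms] mset_set_set[of "vs n"] by simp
  then show ?thesis by (simp add: type_mset_def multiset.map_comp comp_def triple_data_def)
qed

lemma size_type_mset: "d \<le> n \<Longrightarrow> size (type_mset d n :: 'f fvec multiset) = length (vs n)"
  using types_gen[of n, THEN arg_cong[of _ _ size]] by simp

lemma finite_std_V: "d \<le> n \<Longrightarrow> finite (std_V d n :: 'f triple set)"
  using orders[of n] by (metis List.finite_set)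

text \<open>Since [f^E] (x) theta is the image of [id] (x) theta under f^E, the rule
  \<open>generator_eq\<close> turns the generators of the construction into elements
  \<open>diff_elt\<close>.\<close>

lemma Ms_eq:
  assumes n: "d \<le> n"
  shows "Ms n = VI_generated I {(Zs n, diff_elt I d (unit_elt \<theta>) (Zs n) std_frame (gen_list n)) |\<theta>. \<theta> \<in> carrier \<Theta>}"
proof -
  interpret V_order d n "vs n" by (rule V_order[OF n])
  have "alg_act (Ob I (Zs n)) (Act I (Zs n) (Zs n)) (L_elt (std_space n) (vs n) (std_V d n))
        (ind_tensor d \<Theta> \<rho> (Zs n) (lin_map d std_frame) \<theta>) =
      diff_elt I d (unit_elt \<theta>) (Zs n) std_frame (gen_list n)" if th: "\<theta> \<in> carrier \<Theta>" for \<theta>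
  proof -
    have h: "lin_map d std_frame \<in> VI_hom D (Zs n)" by (rule lin_map_VI_hom[OF indep_data_std Z_obj])
    have "compose D (lin_map d std_frame) (restrict id D) = lin_map d (std_frame :: nat \<Rightarrow> 'f fvec)"
      by (auto simp: compose_def lin_map_def fun_eq_iff)
    then have "ind_tensor d \<Theta> \<rho> (Zs n) (lin_map d std_frame) \<theta> = Act I D (Zs n) (lin_map d std_frame) (unit_elt \<theta>)"
      using Act_ind_tensor[OF VI_hom_id[OF std_space_VI_obj] h th] by (simp only: unit_elt_def)
    then show ?thesis using generator_eq[OF VI_module_Ind unit_elt_closed[OF th]] by simp
  qed
  then have "{(Zs n, alg_act (Ob I (Zs n)) (Act I (Zs n) (Zs n)) (L_elt (std_space n) (vs n) (std_V d n))
        (ind_tensor d \<Theta> \<rho> (Zs n) (lin_map d std_frame) \<theta>)) |\<theta>. \<theta> \<in> carrier \<Theta>} =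
      {(Zs n, diff_elt I d (unit_elt \<theta>) (Zs n) std_frame (gen_list n)) |\<theta>. \<theta> \<in> carrier \<Theta>}" by force
  then show ?thesis unfolding M_sub_def Let_def lin_map_std_frame[symmetric] by (simp only:)
qed

lemma gen_closed:
  assumes "d \<le> n" "\<theta> \<in> carrier \<Theta>"
  shows "diff_elt I d (unit_elt \<theta>) (Zs n) std_frame (gen_list n) \<in> carrier (Ob I (Zs n))"
  by (rule vi_elt.G_closed[OF vi_elt[OF assms(2)] XE_VI_obj indep_data_gen[OF assms(1)]])

lemma Ms_submodule: "d \<le> n \<Longrightarrow> VI_submodule (Ms n) I"
  unfolding Ms_eq by (rule I.VI_generated_submodule) (auto simp: gen_closed)

lemma Ms_minimal:
  assumes "d \<le> n" "VI_submodule N I"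
    and "\<And>\<theta>. \<theta> \<in> carrier \<Theta> \<Longrightarrow> diff_elt I d (unit_elt \<theta>) (Zs n) std_frame (gen_list n) \<in> N (Zs n)"
  shows "Ms n X \<subseteq> N X"
  unfolding Ms_eq[OF assms(1)] by (rule I.VI_generated_minimal[OF assms(2)]) (auto simp: assms(3))

lemma Ms_contains_type:
  assumes "d \<le> n" "\<theta> \<in> carrier \<Theta>" "Y \<in> VI_obj" "n + length (vs n) \<le> fvs.dim Y"
  shows "contains_type I d (unit_elt \<theta>) Y (Ms n Y) (type_mset d n)"
proof -
  have "diff_elt I d (unit_elt \<theta>) (Zs n) std_frame (gen_list n) \<in> Ms n (Zs n)"
    unfolding Ms_eq[OF assms(1)] by (rule I.VI_generated_superset) (use assms(2) in blast)
  from vi_elt.contains_type_generated[OF vi_elt[OF assms(2)] Ms_submodule[OF assms(1)] XE_VI_obj assms(3)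
      indep_data_gen[OF assms(1)] this]
  show ?thesis using assms(4) unfolding dim_XE types_gen[OF assms(1)] by blast
qed

lemma Ms_antimono_step:
  assumes n: "d \<le> n" shows "Ms (Suc n) Y \<subseteq> Ms n Y"
proof (rule Ms_minimal)
  show "d \<le> Suc n" using n by simp
  show "VI_submodule (Ms n) I" by (rule Ms_submodule[OF n])
  fix \<theta> assume th: "\<theta> \<in> carrier \<Theta>"
  let ?Z = "Zs (Suc n)"
  have sub: "(type_mset d n :: 'f fvec multiset) \<subseteq># type_mset d (Suc n)"
    using type_mset_Suc[OF n finite_std_V finite_std_V] n by simp
  then obtain B where B: "type_mset d (Suc n) = (type_mset d n :: 'f fvec multiset) + B"
    by (metis subset_mset.add_diff_inverse)
  \<comment> \<open>The comparison of sizes ensures that the space of the generators for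
    \<open>Suc n\<close> is large enough to contain all data of type
    \<open>type_mset d n\<close>.\<close>
  have "length (vs n) \<le> length (vs (Suc n))"
    using size_mset_mono[OF sub] size_type_mset[OF n] size_type_mset[of "Suc n"] n by simp
  then have "contains_type I d (unit_elt \<theta>) ?Z (Ms n ?Z) (type_mset d n)"
    by (intro Ms_contains_type[OF n th XE_VI_obj]) (simp add: dim_XE)
  then have "contains_type I d (unit_elt \<theta>) ?Z (Ms n ?Z) (type_mset d (Suc n))"
    unfolding B by (rule vi_elt.contains_type_add[OF vi_elt[OF th] XE_VI_obj I.VI_submoduleD(1)[OF Ms_submodule[OF n] XE_VI_obj]])
  then show "diff_elt I d (unit_elt \<theta>) ?Z std_frame (gen_list (Suc n)) \<in> Ms n ?Z"
    using indep_data_gen[of "Suc n"] types_gen[of "Suc n"] n unfolding contains_type_def by simp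
qed

lemma Ms_subset_d: "d \<le> n \<Longrightarrow> Ms n Y \<subseteq> Ms d Y"
proof (induction n rule: dec_induct)
  case (step n)
  then show ?case using Ms_antimono_step[OF step(1), of Y] by blast
qed simp

text \<open>The generators of M_d live over a space that may be too small for the averaging, so the
  claim concerns images in large spaces. The elements all of whose images in spaces of sufficient
  dimension lie in M_n form a VI-submodule \<open>N\<close>; it is enough that \<open>N\<close>
  contains the generators of M_d.\<close>

lemma Ms_d_image:
  assumes n: "d \<le> n" and X: "X \<in> VI_obj" and x: "x \<in> Ms d X"
    and Y: "Y \<in> VI_obj" "g \<in> VI_hom X Y" "n + length (vs n) \<le> fvs.dim Y"
  shows "Act I X Y g x \<in> Ms n Y"
proof -
  define N where "N X = {x \<in> carrier (Ob I X). \<forall>Y\<in>VI_obj. \<forall>g\<in>VI_hom X Y.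
      n + length (vs n) \<le> fvs.dim Y \<longrightarrow> Act I X Y g x \<in> Ms n Y}" for X
  have "VI_submodule N I" unfolding VI_submodule_def
  proof (intro conjI ballI)
    fix X :: "'f fvec set" assume X: "X \<in> VI_obj"
    interpret kmod "Ob I X" by (rule I.kmod_Ob[OF X])
    have sub: "ksubmodule (Ms n Y) (Ob I Y)" if "Y \<in> VI_obj" for Y
      by (rule I.VI_submoduleD(1)[OF Ms_submodule[OF n] that])
    note s = kmod.k_submodule[OF I.kmod_Ob sub]
    show "ksubmodule (N X) (Ob I X)"
    proof (rule k_submoduleI)
      show "\<zero>\<^bsub>Ob I X\<^esub> \<in> N X"
        using I.Act_linear(4)[OF X _ _ X] s(2) by (auto simp: N_def)
      show "x \<oplus>\<^bsub>Ob I X\<^esub> y \<in> N X" if "x \<in> N X" "y \<in> N X" for x y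
        using that I.Act_linear(2)[OF X _ _ X, of _ _ x y] s(3) by (auto simp: N_def)
      show "c \<odot>\<^bsub>Ob I X\<^esub> x \<in> N X" if "x \<in> N X" for c x
        using that I.Act_linear(3)[OF X _ _ X, of _ _ x c] s(4) k_closed by (auto simp: N_def)
    qed (auto simp: N_def)
  next
    fix X X' :: "'f fvec set" and h x
    assume X: "X \<in> VI_obj" "X' \<in> VI_obj" "h \<in> VI_hom X X'" "x \<in> N X"
    then have xc: "x \<in> carrier (Ob I X)" by (simp add: N_def)
    have "Act I X' Y g (Act I X X' h x) \<in> Ms n Y"
      if "Y \<in> VI_obj" "g \<in> VI_hom X' Y" "n + length (vs n) \<le> fvs.dim Y" for Y g
      using I.Act_compose[OF X(1,2) that(1) X(3) that(2) xc] VI_hom_compose[OF X(3) that(2) X(1)] X(4) that(1,3)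
      unfolding N_def by force
    then show "Act I X X' h x \<in> N X'"
      using I.Act_linear(1)[OF X(1,2,3,1,2) xc] by (simp add: N_def)
  qed
  moreover have "diff_elt I d (unit_elt \<theta>) (Zs d) std_frame (gen_list d) \<in> N (Zs d)" if th: "\<theta> \<in> carrier \<Theta>" for \<theta>
  proof -
    interpret vi_elt I d "unit_elt \<theta>" by (rule vi_elt[OF th])
    have "Act I (Zs d) Y g (G (Zs d) std_frame (gen_list d)) \<in> Ms n Y"
      if Y: "Y \<in> VI_obj" "g \<in> VI_hom (Zs d) Y" "n + length (vs n) \<le> fvs.dim Y" for Y g
    proof -
      have "(type_mset d d :: 'f fvec multiset) \<subseteq># type_mset d n"
        by (rule type_mset_mono[OF n finite_std_V])
      then obtain B where B: "type_mset d n = (type_mset d d :: 'f fvec multiset) + B"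
        by (metis subset_mset.add_diff_inverse)
      have "set_mset B \<subseteq> set_mset (type_mset d d)"
        using set_type_mset[OF finite_std_V[OF order_refl] finite_std_V[OF n]] B by auto
      \<comment> \<open>The removal asks for d + |V| only; n + |V| was required to have all data of
        the larger type in M_n.\<close>
      moreover have "d + size (type_mset d d + B) \<le> fvs.dim Y"
        using size_type_mset[OF n] Y(3) n unfolding B by simp
      ultimately have hit: "contains_type I d (unit_elt \<theta>) Y (Ms n Y) (type_mset d d)"
        using contains_type_remove_many[OF Y(1) I.VI_submoduleD(1)[OF Ms_submodule[OF n] Y(1)]
            Ms_contains_type[OF n th Y(1,3), unfolded B]] q_inv by simp
      note gd = indep_data_gen[OF order_refl]
      have "Act I (Zs d) Y g (G (Zs d) std_frame (gen_list d)) = G Y (g \<circ> std_frame) (map (apsnd g) (gen_list d))"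
        by (rule G_Act[OF XE_VI_obj Y(1,2) gd])
      moreover have "indep_data Y d (g \<circ> std_frame) (map (apsnd g) (gen_list d))"
        by (rule indep_data_VI_hom[OF gd XE_VI_obj Y(2)])
      moreover have "image_mset fst (mset (map (apsnd g) (gen_list d))) = image_mset fst (mset (gen_list d))"
        by (simp add: multiset.map_comp comp_def)
      ultimately show ?thesis using hit types_gen[OF order_refl] unfolding contains_type_def by simp
    qed
    then show ?thesis using gen_closed[OF order_refl th] by (simp add: N_def)
  qed
  ultimately have "Ms d X \<subseteq> N X" by (rule Ms_minimal[OF order_refl])
  then show ?thesis using x Y by (auto simp: N_def)
qed

lemma Ms_eq_large:
  assumes "d \<le> n" "Y \<in> VI_obj" "n + length (vs n) \<le> fvs.dim Y"
  shows "Ms d Y = Ms n Y"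
proof
  show "Ms n Y \<subseteq> Ms d Y" by (rule Ms_subset_d[OF assms(1)])
  show "Ms d Y \<subseteq> Ms n Y"
  proof
    fix x assume x: "x \<in> Ms d Y"
    then have "x \<in> carrier (Ob I Y)" using I.VI_submoduleD(2)[OF Ms_submodule[OF order_refl] assms(2)] by auto
    then show "x \<in> Ms n Y"
      using Ms_d_image[OF assms(1,2) x assms(2) VI_hom_id[OF assms(2)] assms(3)] I.Act_id[OF assms(2)] by simp
  qed
qed

lemma Ms_torsion:
  assumes "d \<le> n" "X \<in> VI_obj" "x \<in> Ms d X"
  shows "\<exists>Y\<in>VI_obj. \<exists>g\<in>VI_hom X Y. Act I X Y g x \<in> Ms n Y"
proof -
  \<comment> \<open>The dimension is the least that admits an injection from \<open>X\<close> and
    also satisfies the bound of \<open>Ms_d_image\<close>.\<close>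
  define Y where "Y = (std_space (max (fvs.dim X) (n + length (vs n))) :: 'f fvec set)"
  have Y: "Y \<in> VI_obj" and dY: "fvs.dim Y = max (fvs.dim X) (n + length (vs n))"
    by (simp_all add: Y_def std_space_VI_obj dim_std_space)
  have "fvs.dim ({} :: 'f fvec set) = 0"
    using fvs.dim_eq_card_independent[OF fvs.independent_empty] by simp
  then obtain g where "g \<in> VI_hom X Y"
    using VI_hom_extend[OF assms(2) Y, of "[]" "[]"] dY by auto
  then show ?thesis using Ms_d_image[OF assms Y] Y dY by auto
qed

lemma Ms_gen_equal:
  assumes n: "d \<le> n" shows "gen_equal I (Ms n) (Ms d)"
proof -
  note s = Ms_submodule[OF n] Ms_submodule[OF order_refl]
  have "gen_factors I (Ms n) (Ms d)"
  \<comment> \<open>M_n serves as the common submodule in both directions. Here the torsion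
    condition holds by the identity morphism; in the other direction it is
    \<open>Ms_torsion\<close>.\<close>
  proof (rule I.gen_factorsI[OF s s(1)])
    fix X :: "'f fvec set" and x assume "X \<in> VI_obj" "x \<in> Ms n X"
    then show "\<exists>Y\<in>VI_obj. \<exists>g\<in>VI_hom X Y. Act I X Y g x \<in> Ms n Y"
      using I.VI_submoduleD(3)[OF s(1)] VI_hom_id by blast
  qed (use Ms_subset_d[OF n] in auto)
  moreover have "gen_factors I (Ms d) (Ms n)"
    by (rule I.gen_factorsI[OF s(2,1,1)]) (use Ms_subset_d[OF n] Ms_torsion[OF n] in auto)
  ultimately show ?thesis by (simp add: gen_equal_def)
qed

lemma Ms_supported_below:
  assumes n: "d \<le> n"
  shows "supported_below (n + CARD('f) ^ (d * (n - d)) * (\<Sum>i<d. CARD('f) ^ i)) (VI_quot (VI_sub I (Ms d)) (Ms n))"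
  unfolding supported_below_def
proof (intro allI impI)
  fix m assume m: "n + CARD('f) ^ (d * (n - d)) * (\<Sum>i<d. CARD('f) ^ i) \<le> m"
  let ?Y = "std_space m :: 'f fvec set"
  have Y: "?Y \<in> VI_obj" by (rule std_space_VI_obj)
  have "length (vs n) = card (std_V d n :: 'f triple set)"
    using orders[OF n] distinct_card[of "vs n"] by simp
  then have eq: "Ms d ?Y = Ms n ?Y"
    using m card_std_V[OF n, where 'f = 'f] by (intro Ms_eq_large[OF n Y]) (simp add: dim_std_space)
  interpret S: vi_mod "VI_sub I (Ms d)" by (rule I.vi_mod_VI_sub[OF Ms_submodule[OF order_refl]])
  interpret kmod "Ob (VI_sub I (Ms d)) ?Y" by (rule S.kmod_Ob[OF Y])
  have c: "carrier (Ob (VI_sub I (Ms d)) ?Y) = Ms n ?Y" using eq by (simp add: I.VI_sub_simps)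
  have sub: "ksubmodule (Ms n ?Y) (Ob (VI_sub I (Ms d)) ?Y)"
    using carrier_is_submodule unfolding c .
  have "Ms n ?Y +>\<^bsub>Ob (VI_sub I (Ms d)) ?Y\<^esub> x = Ms n ?Y +>\<^bsub>Ob (VI_sub I (Ms d)) ?Y\<^esub> \<zero>\<^bsub>Ob (VI_sub I (Ms d)) ?Y\<^esub>"
    if "x \<in> carrier (Ob (VI_sub I (Ms d)) ?Y)" for x
    using coset_eq_iff[OF sub that M.zero_closed] M.minus_closed[OF that M.zero_closed] c by simp
  then show "carrier (Ob (VI_quot (VI_sub I (Ms d)) (Ms n)) ?Y) =
      {\<zero>\<^bsub>Ob (VI_quot (VI_sub I (Ms d)) (Ms n)) ?Y\<^esub>}"
    unfolding VI_quot_def vimod.simps carrier_quot_module quot_module_simps(1)[OF sub]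
    using M.zero_closed by blast
qed

end

theorem theorem1p8:
  fixes d :: nat
    and \<Theta> :: "('k::field, 'v) module"
    and \<rho> :: "('f::{field,finite} fvec \<Rightarrow> 'f fvec) \<Rightarrow> 'v \<Rightarrow> 'v"
    and vs :: "nat \<Rightarrow> 'f triple list"
  assumes q_invertible: "of_nat CARD('f) \<noteq> (0::'k)"
    and rep: "is_GL_rep d \<Theta> \<rho>"
    and orders: "\<And>n. n \<ge> d \<Longrightarrow> distinct (vs n) \<and> set (vs n) = std_V d n"
  defines "M \<equiv> (\<lambda>n. M_sub d \<Theta> \<rho> n (vs n))"
  shows "(\<forall>n\<ge>d. \<forall>Y\<in>VI_obj. M (Suc n) Y \<subseteq> M n Y) \<and>
         (\<exists>n0\<ge>d. \<forall>n\<ge>n0. gen_equal (Ind d \<Theta> \<rho>) (M n) (M n0)) \<and>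
         (\<forall>n\<ge>d. supported_below (n + CARD('f) ^ (d * (n - d)) * (\<Sum>i<d. CARD('f) ^ i))
                   (VI_quot (VI_sub (Ind d \<Theta> \<rho>) (M d)) (M n))) \<and>
         (\<forall>n\<ge>d. gen_equal (Ind d \<Theta> \<rho>) (M n) (M d))"
proof -
  interpret VI_chain d \<Theta> \<rho> vs
    by unfold_locales (use q_invertible rep orders in auto)
  show ?thesis
    \<comment> \<open>Stabilization is witnessed by \<open>n0 = d\<close>, as every
      \<open>M n\<close> is already equal to \<open>M d\<close> in the quotient category.\<close>
    unfolding M_def using Ms_antimono_step Ms_gen_equal Ms_supported_below by blast
qed

end
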